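(* Assume there exist complex scalars $a,b,c,a^*,b^*,c^*,x$ such that one of the following eight cases holds (with the formulas for $\xi_i$ valid for $0\le i\le N-1$ and those for $\theta_i,\theta^*_i$ valid for $0\le i\le N$): (I$^+$) $b\ne0$, $b^*=0$, $c\neq0$, $c^*\neq0$; $\xi_i=x-q^{-1-N-M-i}(q-1)^2cc^*$, $\theta_i=a+bq^i+cq^{-i}$, $\theta^*_i=a^*+c^*q^{-i}$; (I$^-$) $b=0$, $b^*\ne0$, $c\neq0$, $c^*\neq0$; $\xi_i=x-q^{-1-N-M-i}(q-1)^2cc^*$, $\theta_i=a+cq^{-i}$, $\theta^*_i=a^*+b^*q^i+c^*q^{-i}$; (I$^0$) $b=b^*=0$, $c\neq0$, $c^*\neq0$; $\xi_i=x-q^{-1-N-M-i}(q-1)^2cc^*$, $\theta_i=a+cq^{-i}$, $\theta^*_i=a^*+c^*q^{-i}$; (II$^+$) $c\ne0$, $c^*=0$, $b\ne0$, $b^*\ne0$; $\xi_i=x-q^{-1-N-M-i}(q-1)^2bb^*$, $\theta_i=a+bq^{-i}+cq^{i}$, $\theta^*_i=a^*+b^*q^{-i}$; (II$^-$) $c=0$, $c^*\ne0$, $b\ne0$, $b^*\ne0$; $\xi_i=x-q^{-1-N-M-i}(q-1)^2bb^*$, $\theta_i=a+bq^{-i}$, $\theta^*_i=a^*+b^*q^{-i}+c^*q^{i}$; (II$^0$) $c=c^*=0$, $b\ne0$, $b^*\ne0$; $\xi_i=x-q^{-1-N-M-i}(q-1)^2bb^*$, $\theta_i=a+bq^{-i}$,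 $\theta^*_i=a^*+b^*q^{-i}$; (III$^+$) $x\ne0$, $b\neq0$, $b^*=0$, $c=0$, $c^*\neq0$; $\xi_i=x$, $\theta_i=a+bq^i$, $\theta^*_i=a^*+c^*q^{-i}$; (III$^-$) $x\ne0$, $b=0$, $b^*\neq0$, $c\neq0$, $c^*=0$; $\xi_i=x$, $\theta_i=a+cq^{-i}$, $\theta^*_i=a^*+b^*q^{i}$. Let $W$ be an irreducible $T$-module with endpoint $r$ and diameter $d$. Then $A,A^*$ act on $W$ as a Leonard pair if and only if $$x\neq q^{r+d-N-M}(q-1)^2(bc^*+cb^* )q^{-i}\qquad (1\le i\le d).$$
   Context: Let $N\ge 6$ and $M\ge1$ be integers, let $\mathbb{F}_q$ be a finite field with $q$ elements. Let $H$ be an $(N+M)$-dimensional vector space over $\mathbb{F}_q$ and fix an $M$-dimensional subspace $h$ of $H$. Let $P$ be the set of subspaces $x$ of $H$ with $x\cap h=0$, partially ordered by inclusion, and for $0\le i\le N$ let $P_i$ be the set of elements of $P$ of dimension $i$. For $x,y\in P$ say $y$ covers $x$ if $x\subsetneq y$ and there is no $z\in P$ with $x\subsetneq z\subsetneq y$. Define $L,R\in\mathrm{Mat}_P(\mathbb{C})$ (complex matrices indexed by $P$) by $L_{xy}=1$ if $y$ covers $x$ and $0$ otherwise, $R_{xy}=1$ if $x$ covers $y$ and $0$ otherwise. For $0\le i\le N$ let $F_i$ be the diagonal matrix with $(F_i)_{yy}=1$ if $y\in P_i$ and $0$ otherwise. Let $K=\sum_{i=0}^Nq^{N+M-i}F_i$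 and let $T$ be the subalgebra of $\mathrm{Mat}_P(\mathbb{C})$ generated by $R,L,K,K^{-1}$; $\mathbb{C}P$ (the complex vector space with basis $P$) is a $T$-module, and a $T$-module means a $T$-submodule of $\mathbb{C}P$. For an irreducible $T$-module $W$, its endpoint is $\min\{i: F_iW\neq 0\}$ and its diameter is $|\{i:0\le i\le N,\ F_iW\ne0\}|-1$. Let $A=\sum_{i=0}^{N-1}\alpha_iRF_i+\sum_{i=0}^N\theta_iF_i$ and $A^*=\sum_{i=1}^{N}\alpha^*_iLF_i+\sum_{i=0}^N\theta^*_iF_i$, where $\alpha_i,\alpha^*_i,\theta_i,\theta^*_i$ are complex scalars with $\alpha_i\ne0$ ($0\le i\le N-1$), $\alpha^*_i\neq0$ ($1\le i\le N$), $\theta_i\ne\theta_j$ and $\theta^*_i\ne\theta^*_j$ for $0\le i\neq j\le N$. Set $\xi_i=\alpha_i\alpha^*_{i+1}$ for $0\le i\le N-1$. A Leonard pair on a finite-dimensional complex vector space $V$ is an ordered pair $X,X^*$ of linear maps $V\to V$ such that (i) there is a basis of $V$ with respect to which the matrix of $X$ is irreducible tridiagonal (nonzero entries only on the diagonal, sub- and superdiagonal, with all sub- and superdiagonal entries nonzero) and the matrix of $X^*$ is diagonal; (ii) there is a basis of $V$ with respect to which the matrix of $X^*$ is irreducible tridiagonal and the matrix of $X$ is diagonal. *)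

theory Defs
  imports "HOL-Analysis.Analysis"
begin

section \<open>The poset P\<close>

text \<open>
  The ambient space H is the whole type \<open>'v\<close>, with scalar multiplication \<open>smul\<close>. The class
  constraint \<open>finite\<close> on \<open>'v\<close> is no restriction, since H is finite-dimensional over a finite field;
  it makes \<open>'v set\<close> a finite index type for vectors and matrices.
\<close>

definition att_poset :: "('k::field \<Rightarrow> 'v::ab_group_add \<Rightarrow> 'v) \<Rightarrow> 'v set \<Rightarrow> 'v set set" where
  "att_poset smul h = {x. module.subspace smul x \<and> x \<inter> h = {0}}"

definition att_level :: "('k::field \<Rightarrow> 'v::ab_group_add \<Rightarrow> 'v) \<Rightarrow> 'v set \<Rightarrow> nat \<Rightarrow> 'v set set" where
  "att_level smul h i = {x \<in> att_poset smul h. vector_space.dim smul x = i}"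

definition covers :: "'a set set \<Rightarrow> 'a set \<Rightarrow> 'a set \<Rightarrow> bool" where
  "covers P y x \<longleftrightarrow> x \<in> P \<and> y \<in> P \<and> x \<subset> y \<and> \<not> (\<exists>z\<in>P. x \<subset> z \<and> z \<subset> y)"


section \<open>Matrices indexed by P\<close>

text \<open>
  A matrix indexed by a subset \<open>P\<close> of the index type is represented by the matrix over the whole
  index type that vanishes outside \<open>P \<times> P\<close>; in particular the identity of this algebra is
  \<open>mat_id_on P\<close>, not \<open>mat 1\<close>. Likewise the vector space with basis \<open>P\<close> is the set of vectors
  vanishing outside \<open>P\<close>.
\<close>

definition mats_on :: "'n set \<Rightarrow> (complex^'n^'n) set" where
  "mats_on P = {B. \<forall>x y. B $ x $ y \<noteq> 0 \<longrightarrow> x \<in> P \<and> y \<in> P}"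

definition vecs_on :: "'n set \<Rightarrow> (complex^'n) set" where
  "vecs_on P = {v. \<forall>x. v $ x \<noteq> 0 \<longrightarrow> x \<in> P}"

definition mat_id_on :: "'n set \<Rightarrow> complex^'n^'n" where
  "mat_id_on P = (\<chi> x y. if x = y \<and> x \<in> P then 1 else 0)"

definition mat_inv_on :: "'n set \<Rightarrow> complex^'n^'n \<Rightarrow> complex^'n^'n" where
  "mat_inv_on P B = (THE C. C \<in> mats_on P \<and> B ** C = mat_id_on P \<and> C ** B = mat_id_on P)"

definition mat_scale :: "complex \<Rightarrow> complex^'n^'m \<Rightarrow> complex^'n^'m"  (infixr \<open>*m\<close> 75) where
  "c *m B = map_matrix (\<lambda>z. c * z) B"

definition subalgebra_on :: "'n set \<Rightarrow> (complex^'n^'n) set \<Rightarrow> bool" where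
  "subalgebra_on P S \<longleftrightarrow> S \<subseteq> mats_on P \<and> mat_id_on P \<in> S \<and>
     (\<forall>B\<in>S. \<forall>C\<in>S. B + C \<in> S) \<and> (\<forall>B\<in>S. \<forall>C\<in>S. B ** C \<in> S) \<and> (\<forall>c. \<forall>B\<in>S. c *m B \<in> S)"


section \<open>The algebra T and its modules\<close>

definition L_mat :: "('k::field \<Rightarrow> 'v::{ab_group_add,finite} \<Rightarrow> 'v) \<Rightarrow> 'v set
    \<Rightarrow> complex^('v set)^('v set)" where
  "L_mat smul h = (\<chi> x y. if covers (att_poset smul h) y x then 1 else 0)"

definition R_mat :: "('k::field \<Rightarrow> 'v::{ab_group_add,finite} \<Rightarrow> 'v) \<Rightarrow> 'v set
    \<Rightarrow> complex^('v set)^('v set)" where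
  "R_mat smul h = (\<chi> x y. if covers (att_poset smul h) x y then 1 else 0)"

definition F_mat :: "('k::field \<Rightarrow> 'v::{ab_group_add,finite} \<Rightarrow> 'v) \<Rightarrow> 'v set \<Rightarrow> nat
    \<Rightarrow> complex^('v set)^('v set)" where
  "F_mat smul h i = (\<chi> x y. if x = y \<and> y \<in> att_level smul h i then 1 else 0)"

definition K_mat :: "('k::{field,finite} \<Rightarrow> 'v::{ab_group_add,finite} \<Rightarrow> 'v) \<Rightarrow> 'v set \<Rightarrow> nat \<Rightarrow> nat
    \<Rightarrow> complex^('v set)^('v set)" where
  "K_mat smul h N M = (\<Sum>i=0..N. (of_nat CARD('k) ^ (N + M - i)) *m F_mat smul h i)"

text \<open>The inverse of \<open>K_mat\<close> exists, so \<open>mat_inv_on\<close> yields the intended matrix in \<open>T_alg\<close>.\<close>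

lemma att_poset_dim_le:
  fixes smul :: "'k::{field,finite} \<Rightarrow> 'v::{ab_group_add,finite} \<Rightarrow> 'v"
  assumes "vector_space smul" "vector_space.dim smul (UNIV :: 'v set) = N + M"
    and "module.subspace smul h" "vector_space.dim smul h = M"
    and "x \<in> att_poset smul h"
  shows "vector_space.dim smul x \<le> N"
proof -
  interpret V: vector_space smul by fact
  obtain B where B: "V.independent B" "UNIV \<subseteq> V.span B"
    by (rule V.basis_exists[of UNIV])
  interpret V: finite_dimensional_vector_space smul B
    by unfold_locales (use B in auto)
  have x: "V.subspace x" "x \<inter> h = {0}" using assms(5) by (auto simp: att_poset_def)
  have "V.dim {a + b |a b. a \<in> x \<and> b \<in> h} + V.dim (x \<inter> h) = V.dim x + V.dim h"
    by (rule V.dim_sums_Int[OF x(1) assms(3)])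
  moreover have "V.dim {a + b |a b. a \<in> x \<and> b \<in> h} \<le> N + M"
    unfolding assms(2)[symmetric] by (rule V.dim_subset) (rule subset_UNIV)
  moreover have "V.dim (x \<inter> h) = 0" unfolding x(2) by simp
  ultimately show ?thesis using assms(4) by linarith
qed

lemma mat_inv_on_K_mat:
  fixes smul :: "'k::{field,finite} \<Rightarrow> 'v::{ab_group_add,finite} \<Rightarrow> 'v"
  assumes "vector_space smul" "vector_space.dim smul (UNIV :: 'v set) = N + M"
    and "module.subspace smul h" "vector_space.dim smul h = M"
  shows "mat_inv_on (att_poset smul h) (K_mat smul h N M) =
    (\<Sum>i=0..N. inverse (of_nat CARD('k) ^ (N + M - i)) *m F_mat smul h i)"
proof -
  define P where "P = att_poset smul h"
  define D where "D = (\<lambda>f. (\<chi> x y. if x = y \<and> x \<in> P then f (vector_space.dim smul x) else 0)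
    :: complex^('v set)^('v set))"
  have F: "(\<Sum>i=0..N. f i *m F_mat smul h i) = D f" for f
  proof -
    have "(\<Sum>i=0..N. f i *m F_mat smul h i) $ x $ y = D f $ x $ y" for x y
    proof (cases "x = y \<and> x \<in> P")
      case True
      hence "vector_space.dim smul x \<le> N"
        using att_poset_dim_le[OF assms, of x] unfolding P_def by blast
      thus ?thesis using True
        by (simp add: D_def F_mat_def mat_scale_def att_level_def P_def if_distrib sum.delta' cong: if_cong)
    next
      case False
      hence "F_mat smul h i $ x $ y = 0" for i by (auto simp: F_mat_def att_level_def P_def)
      moreover have "D f $ x $ y = 0" using False by (auto simp: D_def)
      ultimately show ?thesis by (simp add: mat_scale_def)
    qed
    thus ?thesis by (simp add: vec_eq_iff)
  qed
  have DB: "D f ** D g = D (\<lambda>i. f i * g i)" for f g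
  proof -
    have "(D f ** D g) $ x $ y = D (\<lambda>i. f i * g i) $ x $ y" for x y
    proof -
      have "(D f ** D g) $ x $ y = (\<Sum>z\<in>UNIV. if z = x then D f $ x $ x * D g $ x $ y else 0)"
        unfolding matrix_matrix_mult_def vec_lambda_beta by (rule sum.cong) (auto simp: D_def)
      also have "\<dots> = D f $ x $ x * D g $ x $ y" by simp
      finally show ?thesis by (auto simp: D_def)
    qed
    thus ?thesis by (simp add: vec_eq_iff)
  qed
  have idl: "mat_id_on P ** B = B" if "B \<in> mats_on P" for B
  proof -
    have "(mat_id_on P ** B) $ x $ y = B $ x $ y" for x y
    proof -
      have "(mat_id_on P ** B) $ x $ y = (\<Sum>z\<in>UNIV. if z = x then B $ x $ y else 0)"
        unfolding matrix_matrix_mult_def vec_lambda_beta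
        by (rule sum.cong) (use that in \<open>auto simp: mat_id_on_def mats_on_def\<close>)
      thus ?thesis by simp
    qed
    thus ?thesis by (simp add: vec_eq_iff)
  qed
  have idr: "B ** mat_id_on P = B" if "B \<in> mats_on P" for B
  proof -
    have "(B ** mat_id_on P) $ x $ y = B $ x $ y" for x y
    proof -
      have "(B ** mat_id_on P) $ x $ y = (\<Sum>z\<in>UNIV. if z = y then B $ x $ y else 0)"
        unfolding matrix_matrix_mult_def vec_lambda_beta
        by (rule sum.cong) (use that in \<open>auto simp: mat_id_on_def mats_on_def\<close>)
      thus ?thesis by simp
    qed
    thus ?thesis by (simp add: vec_eq_iff)
  qed
  define k where "k = (\<lambda>i. of_nat CARD('k) ^ (N + M - i) :: complex)"
  have k: "k i \<noteq> 0" for i by (simp add: k_def)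
  have id: "mat_id_on P = D (\<lambda>_. 1)" by (simp add: mat_id_on_def D_def)
  have inv: "D k ** D (\<lambda>i. inverse (k i)) = mat_id_on P" "D (\<lambda>i. inverse (k i)) ** D k = mat_id_on P"
    using k by (simp_all add: DB id)
  have mem: "D (\<lambda>i. inverse (k i)) \<in> mats_on P" by (auto simp: D_def mats_on_def)
  have "mat_inv_on P (D k) = D (\<lambda>i. inverse (k i))"
    unfolding mat_inv_on_def
  proof (rule the_equality, intro conjI mem inv)
    fix C assume C: "C \<in> mats_on P \<and> D k ** C = mat_id_on P \<and> C ** D k = mat_id_on P"
    have "C = C ** (D k ** D (\<lambda>i. inverse (k i)))" using C idr inv by simp
    also have "\<dots> = D (\<lambda>i. inverse (k i))" using C idl mem by (simp add: matrix_mul_assoc)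
    finally show "C = D (\<lambda>i. inverse (k i))" .
  qed
  thus ?thesis unfolding P_def[symmetric] K_mat_def
    using F[of k] F[of "\<lambda>i. inverse (k i)"] by (simp add: k_def)
qed

definition T_alg :: "('k::{field,finite} \<Rightarrow> 'v::{ab_group_add,finite} \<Rightarrow> 'v) \<Rightarrow> 'v set \<Rightarrow> nat \<Rightarrow> nat
    \<Rightarrow> (complex^('v set)^('v set)) set" where
  "T_alg smul h N M = subalgebra_on (att_poset smul h) hull
     {R_mat smul h, L_mat smul h, K_mat smul h N M,
      mat_inv_on (att_poset smul h) (K_mat smul h N M)}"

definition T_module :: "('k::{field,finite} \<Rightarrow> 'v::{ab_group_add,finite} \<Rightarrow> 'v) \<Rightarrow> 'v set
    \<Rightarrow> nat \<Rightarrow> nat \<Rightarrow> (complex^('v set)) set \<Rightarrow> bool" where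
  "T_module smul h N M W \<longleftrightarrow> W \<subseteq> vecs_on (att_poset smul h) \<and> vec.subspace W \<and>
     (\<forall>B\<in>T_alg smul h N M. \<forall>w\<in>W. B *v w \<in> W)"

definition irreducible_T_module :: "('k::{field,finite} \<Rightarrow> 'v::{ab_group_add,finite} \<Rightarrow> 'v) \<Rightarrow> 'v set
    \<Rightarrow> nat \<Rightarrow> nat \<Rightarrow> (complex^('v set)) set \<Rightarrow> bool" where
  "irreducible_T_module smul h N M W \<longleftrightarrow> T_module smul h N M W \<and> W \<noteq> {0} \<and>
     (\<forall>U. T_module smul h N M U \<and> U \<subseteq> W \<longrightarrow> U = {0} \<or> U = W)"

definition support_levels :: "('k::field \<Rightarrow> 'v::{ab_group_add,finite} \<Rightarrow> 'v) \<Rightarrow> 'v set \<Rightarrow> nat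
    \<Rightarrow> (complex^('v set)) set \<Rightarrow> nat set" where
  "support_levels smul h N W = {i. i \<le> N \<and> (\<lambda>w. F_mat smul h i *v w) ` W \<noteq> {0}}"

definition endpoint :: "('k::field \<Rightarrow> 'v::{ab_group_add,finite} \<Rightarrow> 'v) \<Rightarrow> 'v set \<Rightarrow> nat
    \<Rightarrow> (complex^('v set)) set \<Rightarrow> nat" where
  "endpoint smul h N W = Min (support_levels smul h N W)"

definition module_diameter :: "('k::field \<Rightarrow> 'v::{ab_group_add,finite} \<Rightarrow> 'v) \<Rightarrow> 'v set \<Rightarrow> nat
    \<Rightarrow> (complex^('v set)) set \<Rightarrow> nat" where
  "module_diameter smul h N W = card (support_levels smul h N W) - 1"

definition A_mat :: "('k::field \<Rightarrow> 'v::{ab_group_add,finite} \<Rightarrow> 'v) \<Rightarrow> 'v set \<Rightarrow> nat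
    \<Rightarrow> (nat \<Rightarrow> complex) \<Rightarrow> (nat \<Rightarrow> complex) \<Rightarrow> complex^('v set)^('v set)" where
  "A_mat smul h N \<alpha> \<theta> = (\<Sum>i<N. \<alpha> i *m (R_mat smul h ** F_mat smul h i))
     + (\<Sum>i=0..N. \<theta> i *m F_mat smul h i)"

definition A_star_mat :: "('k::field \<Rightarrow> 'v::{ab_group_add,finite} \<Rightarrow> 'v) \<Rightarrow> 'v set \<Rightarrow> nat
    \<Rightarrow> (nat \<Rightarrow> complex) \<Rightarrow> (nat \<Rightarrow> complex) \<Rightarrow> complex^('v set)^('v set)" where
  "A_star_mat smul h N \<alpha>' \<theta>' = (\<Sum>i=1..N. \<alpha>' i *m (L_mat smul h ** F_mat smul h i))
     + (\<Sum>i=0..N. \<theta>' i *m F_mat smul h i)"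


section \<open>Leonard pairs\<close>

definition linear_endo_on :: "(complex^'n) set \<Rightarrow> (complex^'n \<Rightarrow> complex^'n) \<Rightarrow> bool" where
  "linear_endo_on V X \<longleftrightarrow> (\<forall>v\<in>V. X v \<in> V) \<and> (\<forall>v\<in>V. \<forall>w\<in>V. X (v + w) = X v + X w) \<and>
     (\<forall>c. \<forall>v\<in>V. X (c *s v) = c *s X v)"

definition basis_list :: "(complex^'n) set \<Rightarrow> (complex^'n) list \<Rightarrow> bool" where
  "basis_list V vs \<longleftrightarrow> distinct vs \<and> vec.independent (set vs) \<and> vec.span (set vs) = V"

text \<open>Column \<open>j\<close> of \<open>B\<close> holds the coordinates of the image of the \<open>j\<close>-th basis vector.\<close>

definition represents :: "(complex^'n) list \<Rightarrow> (complex^'n \<Rightarrow> complex^'n) \<Rightarrow> (nat \<Rightarrow> nat \<Rightarrow> complex) \<Rightarrow> bool" where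
  "represents vs X B \<longleftrightarrow> (\<forall>j<length vs. X (vs ! j) = (\<Sum>i<length vs. B i j *s (vs ! i)))"

definition diagonal_mat :: "nat \<Rightarrow> (nat \<Rightarrow> nat \<Rightarrow> complex) \<Rightarrow> bool" where
  "diagonal_mat n B \<longleftrightarrow> (\<forall>i<n. \<forall>j<n. i \<noteq> j \<longrightarrow> B i j = 0)"

definition irred_tridiagonal :: "nat \<Rightarrow> (nat \<Rightarrow> nat \<Rightarrow> complex) \<Rightarrow> bool" where
  "irred_tridiagonal n B \<longleftrightarrow>
     (\<forall>i<n. \<forall>j<n. Suc i < j \<or> Suc j < i \<longrightarrow> B i j = 0) \<and>
     (\<forall>i. Suc i < n \<longrightarrow> B (Suc i) i \<noteq> 0 \<and> B i (Suc i) \<noteq> 0)"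

definition leonard_pair :: "(complex^'n) set \<Rightarrow> (complex^'n \<Rightarrow> complex^'n)
    \<Rightarrow> (complex^'n \<Rightarrow> complex^'n) \<Rightarrow> bool" where
  "leonard_pair V X X' \<longleftrightarrow> linear_endo_on V X \<and> linear_endo_on V X' \<and>
     (\<exists>vs B B'. basis_list V vs \<and> represents vs X B \<and> represents vs X' B' \<and>
        irred_tridiagonal (length vs) B \<and> diagonal_mat (length vs) B') \<and>
     (\<exists>vs B B'. basis_list V vs \<and> represents vs X B \<and> represents vs X' B' \<and>
        diagonal_mat (length vs) B \<and> irred_tridiagonal (length vs) B')"


section \<open>The eight cases\<close>

text \<open>
  A prime stands for the star of the informal notation. Integer exponents are used in \<open>powi\<close>, so
  \<open>q powi (- int i)\<close> is the \<open>i\<close>-th power of the inverse of \<open>q\<close>. The disjuncts are, in order,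
  the cases I+, I-, I0, II+, II-, II0, III+, III-.
\<close>

definition eight_cases :: "complex \<Rightarrow> nat \<Rightarrow> nat \<Rightarrow> (nat \<Rightarrow> complex) \<Rightarrow> (nat \<Rightarrow> complex) \<Rightarrow> (nat \<Rightarrow> complex)
    \<Rightarrow> complex \<Rightarrow> complex \<Rightarrow> complex \<Rightarrow> complex \<Rightarrow> complex \<Rightarrow> complex \<Rightarrow> complex \<Rightarrow> bool" where
  "eight_cases q N M \<xi> \<theta> \<theta>' a b c a' b' c' x \<longleftrightarrow>
    (b \<noteq> 0 \<and> b' = 0 \<and> c \<noteq> 0 \<and> c' \<noteq> 0 \<and>
     (\<forall>i<N. \<xi> i = x - q powi (-1 - int N - int M - int i) * (q - 1)^2 * c * c') \<and>
     (\<forall>i\<le>N. \<theta> i = a + b * q ^ i + c * q powi (- int i)) \<and>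
     (\<forall>i\<le>N. \<theta>' i = a' + c' * q powi (- int i))) \<or>
    (b = 0 \<and> b' \<noteq> 0 \<and> c \<noteq> 0 \<and> c' \<noteq> 0 \<and>
     (\<forall>i<N. \<xi> i = x - q powi (-1 - int N - int M - int i) * (q - 1)^2 * c * c') \<and>
     (\<forall>i\<le>N. \<theta> i = a + c * q powi (- int i)) \<and>
     (\<forall>i\<le>N. \<theta>' i = a' + b' * q ^ i + c' * q powi (- int i))) \<or>
    (b = 0 \<and> b' = 0 \<and> c \<noteq> 0 \<and> c' \<noteq> 0 \<and>
     (\<forall>i<N. \<xi> i = x - q powi (-1 - int N - int M - int i) * (q - 1)^2 * c * c') \<and>
     (\<forall>i\<le>N. \<theta> i = a + c * q powi (- int i)) \<and>
     (\<forall>i\<le>N. \<theta>' i = a' + c' * q powi (- int i))) \<or>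
    (c \<noteq> 0 \<and> c' = 0 \<and> b \<noteq> 0 \<and> b' \<noteq> 0 \<and>
     (\<forall>i<N. \<xi> i = x - q powi (-1 - int N - int M - int i) * (q - 1)^2 * b * b') \<and>
     (\<forall>i\<le>N. \<theta> i = a + b * q powi (- int i) + c * q ^ i) \<and>
     (\<forall>i\<le>N. \<theta>' i = a' + b' * q powi (- int i))) \<or>
    (c = 0 \<and> c' \<noteq> 0 \<and> b \<noteq> 0 \<and> b' \<noteq> 0 \<and>
     (\<forall>i<N. \<xi> i = x - q powi (-1 - int N - int M - int i) * (q - 1)^2 * b * b') \<and>
     (\<forall>i\<le>N. \<theta> i = a + b * q powi (- int i)) \<and>
     (\<forall>i\<le>N. \<theta>' i = a' + b' * q powi (- int i) + c' * q ^ i)) \<or>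
    (c = 0 \<and> c' = 0 \<and> b \<noteq> 0 \<and> b' \<noteq> 0 \<and>
     (\<forall>i<N. \<xi> i = x - q powi (-1 - int N - int M - int i) * (q - 1)^2 * b * b') \<and>
     (\<forall>i\<le>N. \<theta> i = a + b * q powi (- int i)) \<and>
     (\<forall>i\<le>N. \<theta>' i = a' + b' * q powi (- int i))) \<or>
    (x \<noteq> 0 \<and> b \<noteq> 0 \<and> b' = 0 \<and> c = 0 \<and> c' \<noteq> 0 \<and>
     (\<forall>i<N. \<xi> i = x) \<and>
     (\<forall>i\<le>N. \<theta> i = a + b * q ^ i) \<and>
     (\<forall>i\<le>N. \<theta>' i = a' + c' * q powi (- int i))) \<or>
    (x \<noteq> 0 \<and> b = 0 \<and> b' \<noteq> 0 \<and> c \<noteq> 0 \<and> c' = 0 \<and>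
     (\<forall>i<N. \<xi> i = x) \<and>
     (\<forall>i\<le>N. \<theta> i = a + c * q powi (- int i)) \<and>
     (\<forall>i\<le>N. \<theta>' i = a' + b' * q ^ i))"

end

(* On an irreducible module with endpoint r and diameter d, an eigenvector of LR in the lowest level
   generates, under R, a basis w_0, ..., w_d on which L w_k is a multiple of w_(k-1).  The multiples are
   determined by the cubic relation L R^2 - (q+1) R L R + q R^2 L = -(q+1) q^(N+M-1-j) R on level j,
   which is a path count in the attenuated space.  After rescaling this basis, A is lower bidiagonal
   and A* is upper bidiagonal with explicit entries, so A and A* are in split form.

   In the eigenbasis of A the matrix of A* vanishes below the subdiagonal by the Askey-Wilson relation,
   and above the superdiagonal by the bidiagonal shape; its superdiagonal entries never vanish, and its
   subdiagonal entries factor, with the nonequalities of the theorem as the only factor that can vanish.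
   Reversing the basis exchanges A and A*, which gives the other half of the Leonard property. *)

theory Submission
  imports Defs "HOL-Computational_Algebra.Fundamental_Theorem_Algebra"
begin

section \<open>Pairs in split form\<close>

text \<open>The Askey-Wilson relation turns each entry above the diagonal of A* in the eigenbasis of
  A, times a quadratic in two eigenvalues of A, into zero. That quadratic vanishes just for
  neighbouring indices, so the eigenbasis never has to be inverted. In each of the eight cases
  \<open>b * b'\<close> or \<open>c * c'\<close> is zero, yet both stay in the split sequence:
  reversing the basis interchanges them, and only the larger family lets one computation serve both
  halves. For the converse, the order of a given eigenbasis is unknown. It suffices that the nonzero
  pattern of an irreducible tridiagonal matrix is symmetric, so a nonzero subdiagonal entry in any
  order forces a nonzero opposite entry. The multiples on the chain obey a second-order recursion.
  They vanish at 0 and at d+1, and this leaves no freedom in the eigenvalue of LR. The right side of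
  the cubic relation measures how the number of covers drops from y to a cover z of y: the
  contribution of h cancels, and |H|/|z| remains.\<close>

definition theta_seq :: "complex \<Rightarrow> complex \<Rightarrow> complex \<Rightarrow> complex \<Rightarrow> nat \<Rightarrow> complex" where
  "theta_seq q a b c k = a + b * q ^ k + c / q ^ k"

text \<open>The q-Racah form of a split sequence: \<open>bb\<close> and \<open>cc\<close> stand for
  \<open>b * b'\<close> and \<open>c * c'\<close>, and \<open>\<tau>\<close> is the remaining free
  parameter. The first two factors vanish at \<open>k = 0\<close> and \<open>k = Suc d\<close>,
  which cuts the bidiagonal matrices off at both ends.\<close>

definition split_seq :: "complex \<Rightarrow> complex \<Rightarrow> complex \<Rightarrow> complex \<Rightarrow> nat \<Rightarrow> nat \<Rightarrow> complex" where
  "split_seq q \<tau> bb cc d k =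
     (q ^ k - 1) * (q * q ^ d / q ^ k - 1) * (\<tau> - bb * q ^ k / q - cc / (q ^ k * q ^ d))"

locale split_scalars =
  fixes q a b c a' b' c' \<tau> :: complex and d :: nat
  assumes q0: "q \<noteq> 0" and q1: "\<And>k. k \<ge> 1 \<Longrightarrow> q ^ k \<noteq> 1"
    and distinct: "\<And>i j. i \<le> d \<Longrightarrow> j \<le> d \<Longrightarrow> i \<noteq> j \<Longrightarrow> theta_seq q a b c i \<noteq> theta_seq q a b c j"
    and distinct': "\<And>i j. i \<le> d \<Longrightarrow> j \<le> d \<Longrightarrow> i \<noteq> j \<Longrightarrow> theta_seq q a' b' c' i \<noteq> theta_seq q a' b' c' j"
    and split_nz: "\<And>i. 1 \<le> i \<Longrightarrow> i \<le> d \<Longrightarrow> split_seq q \<tau> (b * b') (c * c') d i \<noteq> 0"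
begin

abbreviation "\<theta> \<equiv> theta_seq q a b c"
abbreviation "\<theta>' \<equiv> theta_seq q a' b' c'"
abbreviation "\<phi> \<equiv> split_seq q \<tau> (b * b') (c * c') d"

text \<open>
  Let \<open>X\<close> be the lower bidiagonal matrix with diagonal \<open>\<theta>\<close> and subdiagonal 1, and \<open>X'\<close> the upper
  bidiagonal matrix with diagonal \<open>\<theta>'\<close> and superdiagonal \<open>\<phi>\<close>. Then \<open>\<alpha> i\<close> is the eigenvector and
  \<open>p (\<theta> j)\<close> the left eigenvector of \<open>X\<close> for \<open>\<theta> i\<close> and \<open>\<theta> j\<close>, the row \<open>F t\<close> is \<open>p t\<close> times \<open>X'\<close>,
  and up to scaling of its columns \<open>m\<close> is the transpose of the matrix of \<open>X'\<close> in the eigenbasis of \<open>X\<close>.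
\<close>

definition p where "p t k = (\<Prod>l<k. t - \<theta> l)"
definition F where "F t k = \<theta>' k * p t k + \<phi> k * p t (k - 1)"
definition \<alpha> where "\<alpha> i k = 1 / (\<Prod>l=Suc i..k. \<theta> i - \<theta> l)"
definition m where "m i j = (\<Sum>k=i..d. \<alpha> i k * F (\<theta> j) k)"

lemma phi_0: "\<phi> 0 = 0" by (simp add: split_seq_def)

lemma phi_Suc_d: "\<phi> (Suc d) = 0" using q0 by (simp add: split_seq_def)

lemma p_0: "p t 0 = 1" by (simp add: p_def)

lemma p_Suc: "p t (Suc k) = (t - \<theta> k) * p t k" by (simp add: p_def)

lemma p_zero: "j < k \<Longrightarrow> p (\<theta> j) k = 0"
  unfolding p_def by (intro prod_zero) auto

lemma p_nz: "j \<le> d \<Longrightarrow> k \<le> j \<Longrightarrow> p (\<theta> j) k \<noteq> 0"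
  unfolding p_def using distinct by auto

lemma alpha_refl: "\<alpha> i i = 1" by (simp add: \<alpha>_def)

lemma alpha_Suc: "i \<le> k \<Longrightarrow> \<alpha> i (Suc k) = \<alpha> i k / (\<theta> i - \<theta> (Suc k))"
  by (simp add: \<alpha>_def)

text \<open>Telescoping, by \<open>\<alpha> i n = \<alpha> i (Suc n) * (\<theta> i - \<theta> (Suc
  n))\<close>. Since \<open>G\<close> is an arbitrary row, this is the eigenvector property of
  \<open>\<alpha> i\<close> up to a boundary term.\<close>

lemma alpha_adj:
  assumes "i \<le> n" "n \<le> d"
  shows "(\<Sum>k=i..n. \<alpha> i k * ((\<theta> k - \<theta> i) * G k + G (Suc k))) = \<alpha> i n * G (Suc n)"
  using assms
proof (induction n rule: dec_induct)
  case base
  then show ?case by simp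
next
  case (step n)
  have "\<theta> i - \<theta> (Suc n) \<noteq> 0" using step distinct by simp
  then have "\<alpha> i n = \<alpha> i (Suc n) * (\<theta> i - \<theta> (Suc n))"
    using alpha_Suc[of i n] step by simp
  then have "\<alpha> i n * G (Suc n)
      + \<alpha> i (Suc n) * ((\<theta> (Suc n) - \<theta> i) * G (Suc n) + G (Suc (Suc n)))
    = \<alpha> i (Suc n) * G (Suc (Suc n))"
    by algebra
  then show ?case using step by simp
qed

text \<open>The row \<open>G\<close> times \<open>X - e\<close>, paired with the eigenvector
  \<open>\<alpha> i\<close>. The condition on \<open>G (Suc d)\<close> removes the boundary
  term.\<close>

lemma alpha_eigen:
  assumes "i \<le> d" "G (Suc d) = 0"
  shows "(\<Sum>k=i..d. \<alpha> i k * ((\<theta> k - e) * G k + G (Suc k))) = (\<theta> i - e) * (\<Sum>k=i..d. \<alpha> i k * G k)"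
proof -
  have "(\<Sum>k=i..d. \<alpha> i k * ((\<theta> k - e) * G k + G (Suc k)))
    = (\<Sum>k=i..d. \<alpha> i k * ((\<theta> k - \<theta> i) * G k + G (Suc k)) + (\<theta> i - e) * (\<alpha> i k * G k))"
    by (rule sum.cong) (auto simp: algebra_simps)
  then show ?thesis using alpha_adj[OF assms(1) order_refl, of G] assms(2)
    by (simp add: sum.distrib sum_distrib_left)
qed

text \<open>Left and right eigenvectors for different eigenvalues are orthogonal: \<open>X\<close>
  between them can act on either side.\<close>

lemma alpha_p:
  assumes "i \<le> d" "j \<le> d" "i \<noteq> j"
  shows "(\<Sum>k=i..d. \<alpha> i k * p (\<theta> j) k) = 0"
proof -
  have "(\<theta> j - 0) * (\<Sum>k=i..d. \<alpha> i k * p (\<theta> j) k)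
    = (\<Sum>k=i..d. \<alpha> i k * ((\<theta> k - 0) * p (\<theta> j) k + p (\<theta> j) (Suc k)))"
    by (auto simp: p_Suc sum_distrib_left algebra_simps intro!: sum.cong)
  also have "\<dots> = (\<theta> i - 0) * (\<Sum>k=i..d. \<alpha> i k * p (\<theta> j) k)"
    using assms by (intro alpha_eigen) (auto intro: p_zero)
  finally show ?thesis using distinct[OF assms] by auto
qed

section \<open>The Askey-Wilson relation\<close>

definition \<beta> where "\<beta> = q + 1 / q"
text \<open>The constant value of \<open>y^2 - \<beta> * y * z + z^2\<close> on consecutive terms
  \<open>y\<close>, \<open>z\<close> of \<open>\<theta>\<close> shifted by \<open>a\<close>. Hence,
  for a fixed term, its two neighbours are the roots of one quadratic.\<close>

definition \<rho> where "\<rho> = b * c * (4 - \<beta>^2)"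
definition \<omega> where "\<omega> = (2 - \<beta>) * ((q * q ^ d + 1) * \<tau> + b * b' * q ^ d + c * c' / q ^ d + b' * c + b * c')"
definition \<eta> where "\<eta> = - ((\<tau> + b * b' * (q * q ^ d + 1) / q) * c * (1 - q^2) * (1 - 1 / q))
   - (q * q ^ d * \<tau> + c * c' * (q * q ^ d + 1) / q ^ d) * b * (1 - 1 / q^2) * (1 - q)"

definition step where "step G k = (\<theta> k - a) * G k + G (Suc k)"

text \<open>A rational identity in \<open>Q = q ^ k\<close> and \<open>D = q ^ d\<close>, with the
  constants \<open>a\<close> and \<open>a'\<close> removed. The term before \<open>th 0\<close> is a
  separate parameter \<open>tm\<close>, because for \<open>k = 0\<close> there is no such
  index.\<close>

lemma askey_wilson_core:
  assumes "q \<noteq> 0" "Q \<noteq> 0" "D \<noteq> (0::complex)"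
    and th: "\<And>j. th j = b * (Q * q ^ j) + c / (Q * q ^ j)"
    and th': "\<And>j. th' j = b' * (Q * q ^ j) + c' / (Q * q ^ j)"
    and tm: "tm = b * Q / q + c * q / Q"
    and ph: "\<And>j. ph j = (Q * q ^ j - 1) * (q * D / (Q * q ^ j) - 1)
        * (\<tau> - b * b' * (Q * q ^ j) / q - c * c' / (Q * q ^ j * D))"
  shows "(s - th 1) * (th' 0 * (s - tm) + ph 0)
     + (th 0 + th 1 - (q + 1 / q) * s) * (th' 1 * (s - th 0) + ph 1)
     + (th' 2 * (s - th 0) * (s - th 1) + ph 2 * (s - th 0))
     = (2 - (q + 1 / q)) * ((q * D + 1) * \<tau> + b * b' * D + c * c' / D + b' * c + b * c') * s
      - (\<tau> + b * b' * (q * D + 1) / q) * c * (1 - q^2) * (1 - 1 / q)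
   - (q * D * \<tau> + c * c' * (q * D + 1) / D) * b * (1 - 1 / q^2) * (1 - q)"
  using assms(1-3) unfolding th th' tm ph
  apply (simp add: divide_simps power2_eq_square)
  apply algebra
  done

text \<open>
  The Askey-Wilson relation for \<open>X\<close> and \<open>X'\<close>, multiplied from the left by the left eigenvector \<open>p (\<theta> j)\<close>.
  Here \<open>step\<close> is multiplication of a row by \<open>X - a\<close> from the right.
\<close>

lemma askey_wilson:
  assumes k: "j \<le> d"
  defines "s \<equiv> \<theta> j - a"
  shows "(s^2 - \<rho>) * F (\<theta> j) k - \<beta> * s * step (F (\<theta> j)) k + step (step (F (\<theta> j))) k
     = (a' * ((2 - \<beta>) * s^2 - \<rho>) + \<omega> * s + \<eta>) * p (\<theta> j) k"
proof -
  define th where "th i = \<theta> i - a" for i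
  define th' where "th' i = \<theta>' i - a'" for i
  define t where "t = b * q ^ k / q + c * q / q ^ k"
  define X where "X = p (\<theta> j) k"
  define Y where "Y = \<phi> k * p (\<theta> j) (k - 1)"
  have X1: "p (\<theta> j) (Suc k) = (s - th k) * X"
    by (simp add: p_Suc X_def s_def th_def)
  have X2: "p (\<theta> j) (Suc (Suc k)) = (s - th (Suc k)) * ((s - th k) * X)"
    by (simp add: p_Suc X_def s_def th_def)
  \<comment> \<open>This replaces division by \<open>s - t\<close>. At \<open>k = 0\<close> the
    truncated index \<open>k - 1\<close> does no harm because \<open>\<phi> 0 = 0\<close>, and
    \<open>t\<close> continues the sequence to index -1.\<close>
  have Y: "Y * (s - t) = \<phi> k * X"
  proof (cases k)
    case 0
    then show ?thesis by (simp add: Y_def phi_0)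
  next
    case (Suc n)
    have "t = \<theta> n - a" using Suc q0 by (simp add: theta_seq_def t_def)
    then have "s - t = \<theta> j - \<theta> n" by (simp add: s_def)
    then show ?thesis using Suc by (simp add: Y_def X_def p_Suc)
  qed
  \<comment> \<open>As a quadratic in \<open>s\<close>, the right side has the two neighbours
    \<open>t\<close> and \<open>th (Suc k)\<close> of \<open>th k\<close> as its roots.\<close>
  have P: "(s - t) * (s - th (Suc k)) = s^2 - \<rho> - \<beta> * s * th k + th k ^ 2"
    unfolding t_def th_def theta_seq_def \<rho>_def \<beta>_def using q0
    by (simp add: divide_simps power2_eq_square) algebra
  have F0: "F (\<theta> j) k = (th' k + a') * X + Y"
    by (simp add: F_def X_def Y_def th'_def)
  have F1: "F (\<theta> j) (Suc k) = (th' (Suc k) + a') * ((s - th k) * X) + \<phi> (Suc k) * X"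
    by (simp add: F_def X1) (simp add: X_def th'_def)
  have F2: "F (\<theta> j) (Suc (Suc k)) = (th' (Suc (Suc k)) + a') * ((s - th (Suc k)) * ((s - th k) * X))
      + \<phi> (Suc (Suc k)) * ((s - th k) * X)"
    by (simp add: F_def X1 X2) (simp add: X_def th'_def)
  have core: "(s - th (Suc k)) * (th' k * (s - t) + \<phi> k)
     + (th k + th (Suc k) - \<beta> * s) * (th' (Suc k) * (s - th k) + \<phi> (Suc k))
     + (th' (Suc (Suc k)) * (s - th k) * (s - th (Suc k)) + \<phi> (Suc (Suc k)) * (s - th k))
     = \<omega> * s + \<eta>"
    using askey_wilson_core[of "q ^ k" "q ^ d" "\<lambda>j. th (k + j)" "\<lambda>j. th' (k + j)" t "\<lambda>j. \<phi> (k + j)" s] q0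
    by (simp add: th_def th'_def theta_seq_def t_def split_seq_def power_add \<omega>_def \<eta>_def \<beta>_def)
  have step1: "step G k = th k * G k + G (Suc k)"
     "step (step G) k = th k ^ 2 * G k + (th k + th (Suc k)) * G (Suc k) + G (Suc (Suc k))" for G
    by (simp_all add: step_def th_def power2_eq_square algebra_simps)
  have P0: "(s - t) * (s - th (Suc k)) * a' * X - a' * \<beta> * s * (s - th k) * X
     + (th k + th (Suc k)) * a' * (s - th k) * X + a' * (s - th k) * (s - th (Suc k)) * X
    = a' * ((2 - \<beta>) * s^2 - \<rho>) * X"
    unfolding P by algebra
  have "(s^2 - \<rho>) * F (\<theta> j) k - \<beta> * s * step (F (\<theta> j)) k + step (step (F (\<theta> j))) k
    = (s - t) * (s - th (Suc k)) * F (\<theta> j) k + (th k + th (Suc k) - \<beta> * s) * F (\<theta> j) (Suc k)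
      + F (\<theta> j) (Suc (Suc k))"
    unfolding step1(2) unfolding step1(1) P by algebra
  also have "\<dots> = (\<omega> * s + \<eta>) * X + a' * ((2 - \<beta>) * s^2 - \<rho>) * X"
    unfolding F0 F1 F2 core[symmetric] P0[symmetric] using Y by algebra
  finally show ?thesis by (simp add: X_def algebra_simps)
qed

section \<open>Entries of X' in the eigenbasis of X\<close>

lemma theta_diff: "\<theta> k - \<theta> l = (q ^ k - q ^ l) * (b - c / (q ^ k * q ^ l))"
  using q0 by (simp add: theta_seq_def field_simps)

lemma b_c_nz: "k \<le> d \<Longrightarrow> l \<le> d \<Longrightarrow> k \<noteq> l \<Longrightarrow> b - c / (q ^ k * q ^ l) \<noteq> 0"
  using distinct[of k l] theta_diff[of k l] by auto

lemma F_zero: "Suc j < k \<Longrightarrow> F (\<theta> j) k = 0"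
  by (simp add: F_def p_zero)

lemma F_Suc: "F (\<theta> j) (Suc j) = \<phi> (Suc j) * p (\<theta> j) j"
  by (simp add: F_def p_zero)

lemma m_lower:
  assumes "Suc j < i"
  shows "m i j = 0"
  unfolding m_def by (rule sum.neutral) (use assms in \<open>auto simp: F_zero\<close>)

lemma m_Suc:
  assumes "i < d"
  shows "m (Suc i) i = \<phi> (Suc i) * p (\<theta> i) i"
proof -
  have "m (Suc i) i = (\<Sum>k\<in>{Suc i}. \<alpha> (Suc i) k * F (\<theta> i) k)"
    unfolding m_def by (rule sum.mono_neutral_right) (use assms in \<open>auto simp: F_zero\<close>)
  then show ?thesis by (simp add: alpha_refl F_Suc)
qed

lemma m_Suc_nz:
  assumes "i < d"
  shows "m (Suc i) i \<noteq> 0"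
  using assms split_nz[of "Suc i"] p_nz[of i i] by (simp add: m_Suc)

text \<open>Pairing the Askey-Wilson identity with \<open>\<alpha> i\<close> turns every
  \<open>step\<close> into the factor \<open>s'\<close>, and the right side pairs to zero by
  \<open>alpha_p\<close>. What remains is \<open>m i j\<close> times a quadratic that vanishes only
  if \<open>\<theta> j\<close> is a neighbour of \<open>\<theta> i\<close>.\<close>

lemma m_upper:
  assumes "Suc i < j" "j \<le> d"
  shows "m i j = 0"
proof -
  define s where "s = \<theta> j - a"
  define s' where "s' = \<theta> i - a"
  have F1: "F (\<theta> j) (Suc d) = 0"
    using assms by (simp add: F_def p_zero phi_Suc_d)
  have F2: "step (F (\<theta> j)) (Suc d) = 0"
    using assms F1 by (simp add: step_def F_zero)
  have A: "(\<Sum>k=i..d. \<alpha> i k * step G k) = s' * (\<Sum>k=i..d. \<alpha> i k * G k)"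
    if "G (Suc d) = 0" for G
    unfolding step_def s'_def using assms that by (intro alpha_eigen) auto
  have m1: "(\<Sum>k=i..d. \<alpha> i k * step (F (\<theta> j)) k) = s' * m i j"
    unfolding m_def by (rule A) fact
  have m2: "(\<Sum>k=i..d. \<alpha> i k * step (step (F (\<theta> j))) k) = s' * (s' * m i j)"
    using A[of "step (F (\<theta> j))"] F2 m1 by simp
  define e where "e = a' * ((2 - \<beta>) * s^2 - \<rho>) + \<omega> * s + \<eta>"
  have "(s^2 - \<rho>) * m i j - \<beta> * s * (s' * m i j) + s' * (s' * m i j)
    = (\<Sum>k=i..d. \<alpha> i k * ((s^2 - \<rho>) * F (\<theta> j) k - \<beta> * s * step (F (\<theta> j)) k
         + step (step (F (\<theta> j))) k))"
    unfolding ring_distribs(1)[of "\<alpha> i _"] right_diff_distrib[of "\<alpha> i _"] sum.distrib sum_subtractf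
      mult.left_commute[of "\<alpha> i _"] sum_distrib_left[symmetric] m1 m2 m_def[symmetric] by simp
  also have "\<dots> = (\<Sum>k=i..d. e * (\<alpha> i k * p (\<theta> j) k))"
    by (rule sum.cong) (simp_all add: askey_wilson[OF assms(2)] s_def e_def)
  also have "\<dots> = e * (\<Sum>k=i..d. \<alpha> i k * p (\<theta> j) k)"
    by (simp add: sum_distrib_left)
  also have "\<dots> = 0" using alpha_p[of i j] assms by simp
  finally have 0: "(s^2 - \<rho> - \<beta> * s * s' + s'^2) * m i j = 0"
    by (simp add: power2_eq_square algebra_simps)
  have "s^2 - \<rho> - \<beta> * s * s' + s'^2
      = (\<theta> j - \<theta> (Suc i)) * ((q ^ j - q ^ i / q) * (b - c * q / (q ^ i * q ^ j)))"
    unfolding \<rho>_def \<beta>_def s_def s'_def theta_seq_def power_Suc using q0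
    by (simp add: divide_simps power2_eq_square) algebra
  moreover have "\<theta> j \<noteq> \<theta> (Suc i)" using assms distinct by simp
  moreover have "q ^ j - q ^ i / q \<noteq> 0"
  proof
    assume "q ^ j - q ^ i / q = 0"
    then have "q ^ j * q = q ^ i" using q0 by (simp add: divide_simps)
    moreover have "q ^ j = q ^ (j - i) * q ^ i" using assms by (simp add: power_add[symmetric])
    ultimately have "q ^ Suc (j - i) = 1" using q0 by (simp add: mult_ac)
    then show False using q1[of "Suc (j - i)"] by simp
  qed
  moreover have "b - c * q / (q ^ i * q ^ j) \<noteq> 0"
  \<comment> \<open>For \<open>i = 0\<close> the lower neighbour has index -1, outside the range of
    \<open>distinct\<close>; the same factor occurs in
    \<open>\<theta> 0 - \<theta> (j - 1)\<close>.\<close>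
  proof (cases i)
    case 0
    then show ?thesis using b_c_nz[of 0 "j - 1"] assms q0 by (cases j) auto
  next
    case (Suc n)
    then show ?thesis using b_c_nz[of n j] assms q0 by simp
  qed
  ultimately show ?thesis using 0 by simp
qed

text \<open>Only \<open>k = i\<close>, \<open>Suc i\<close>, \<open>Suc (Suc i)\<close> contribute.
  If \<open>Suc i = d\<close>, the last term is absent; the formula persists because
  \<open>\<phi> (Suc d) = 0\<close>, whatever the denominator beside it.\<close>

lemma m_up_formula:
  assumes "i < d"
  shows "m i (Suc i) = \<phi> i * p (\<theta> (Suc i)) (i - 1) + p (\<theta> (Suc i)) i *
      (\<theta>' i - \<theta>' (Suc i) + \<phi> (Suc i) / (\<theta> i - \<theta> (Suc i))
        - \<phi> (Suc (Suc i)) / (\<theta> i - \<theta> (Suc (Suc i))))"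
proof -
  define x where "x = \<theta> i - \<theta> (Suc i)"
  have x: "x \<noteq> 0" using assms distinct by (simp add: x_def)
  have ps: "p (\<theta> (Suc i)) (Suc i) = - x * p (\<theta> (Suc i)) i" by (simp add: p_Suc x_def)
  have F2: "F (\<theta> (Suc i)) (Suc (Suc i)) = - \<phi> (Suc (Suc i)) * (x * p (\<theta> (Suc i)) i)"
    by (simp add: F_Suc ps)
  have F1: "F (\<theta> (Suc i)) (Suc i) = (\<phi> (Suc i) - \<theta>' (Suc i) * x) * p (\<theta> (Suc i)) i"
    by (simp add: F_def ps algebra_simps)
  have F0: "F (\<theta> (Suc i)) i = \<theta>' i * p (\<theta> (Suc i)) i + \<phi> i * p (\<theta> (Suc i)) (i - 1)"
    by (simp add: F_def)
  have a1: "\<alpha> i (Suc i) = 1 / x" by (simp add: alpha_Suc alpha_refl x_def)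
  show ?thesis
  proof (cases "Suc i = d")
    case True
    have "m i (Suc i) = (\<Sum>k\<in>{i, Suc i}. \<alpha> i k * F (\<theta> (Suc i)) k)"
      unfolding m_def by (rule sum.cong) (use True in auto)
    also have "\<dots> = \<alpha> i i * F (\<theta> (Suc i)) i + \<alpha> i (Suc i) * F (\<theta> (Suc i)) (Suc i)"
      by simp
    moreover have "\<phi> (Suc (Suc i)) = 0" using phi_Suc_d True by simp
    ultimately show ?thesis using x unfolding F0 F1 a1 alpha_refl x_def[symmetric]
      by (simp add: field_simps)
  next
    case False
    have "m i (Suc i) = (\<Sum>k\<in>{i, Suc i, Suc (Suc i)}. \<alpha> i k * F (\<theta> (Suc i)) k)"
      unfolding m_def by (rule sum.mono_neutral_right) (use assms False in \<open>auto simp: F_zero\<close>)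
    also have "\<dots> = \<alpha> i i * F (\<theta> (Suc i)) i + \<alpha> i (Suc i) * F (\<theta> (Suc i)) (Suc i)
      + \<alpha> i (Suc (Suc i)) * F (\<theta> (Suc i)) (Suc (Suc i))"
      by (simp add: algebra_simps)
    also have "\<alpha> i (Suc (Suc i)) = 1 / x / (\<theta> i - \<theta> (Suc (Suc i)))"
      by (simp add: alpha_Suc a1)
    finally have "m i (Suc i) = F (\<theta> (Suc i)) i + 1 / x * F (\<theta> (Suc i)) (Suc i)
      + 1 / x / (\<theta> i - \<theta> (Suc (Suc i))) * F (\<theta> (Suc i)) (Suc (Suc i))"
      by (simp add: a1 alpha_refl)
    also have "1 / x * F (\<theta> (Suc i)) (Suc i) = (\<phi> (Suc i) / x - \<theta>' (Suc i)) * p (\<theta> (Suc i)) i"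
      unfolding F1 using x by (simp add: field_simps)
    also have "1 / x / (\<theta> i - \<theta> (Suc (Suc i))) * F (\<theta> (Suc i)) (Suc (Suc i))
      = - (\<phi> (Suc (Suc i)) / (\<theta> i - \<theta> (Suc (Suc i)))) * p (\<theta> (Suc i)) i"
      unfolding F2 using x by simp
    finally show ?thesis unfolding F0 x_def[symmetric] by (simp add: algebra_simps)
  qed
qed

end

section \<open>Factorisation of the superdiagonal entries\<close>

context
  fixes q Q D b c b' c' \<tau> y1 y2 C :: complex and ph th' :: "nat \<Rightarrow> complex"
  assumes nz: "q \<noteq> 0" "q \<noteq> 1" "q^2 \<noteq> 1" "Q \<noteq> 0" "D \<noteq> 0"
    and th': "\<And>j. th' j = b' * (Q * q ^ j) + c' / (Q * q ^ j)"
    and ph: "\<And>j. ph j = (Q * q ^ j - 1) * (q * D / (Q * q ^ j) - 1)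
        * (\<tau> - b * b' * (Q * q ^ j) / q - c * c' / (Q * q ^ j * D))"
    and y1: "y1 = b * Q - c / (q * Q)" and y2: "y2 = b * Q - c / (q^2 * Q)"
    and C: "C = \<tau> - b * c' * Q / D - c * b' / (q * Q)"
begin

text \<open>
  The factorisation of the entry \<open>m i (Suc i)\<close>, with \<open>Q = q ^ i\<close> and \<open>D = q ^ d\<close>. At \<open>i = 0\<close>
  and at \<open>Suc i = d\<close> factors that may vanish have been cancelled from both sides.
\<close>

lemma up_core_general:
  "(q - 1 / q) * (b * Q - c / Q) * ((th' 0 - th' 1) * y1 * y2 * (1 - q) * (1 - q^2)
      + ph 1 * y2 * (1 - q^2) - ph 2 * y1 * (1 - q)) + ph 0 * y1 * y2 * (1 - q) * (1 - q^2)
   = - (1 - 1 / q) * (1 - 1 / q^2) * (b * q * D - c / Q) * (b * Q - c) * C * (1 - q) * (1 - q^2)"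
  using nz unfolding ph th' y1 y2 C
  by (simp add: divide_simps power2_eq_square) algebra

lemma up_core_first:
  assumes "Q = 1"
  shows "(q - 1 / q) * ((th' 0 - th' 1) * y1 * y2 * (1 - q) * (1 - q^2)
      + ph 1 * y2 * (1 - q^2) - ph 2 * y1 * (1 - q))
   = - (1 - 1 / q) * (1 - 1 / q^2) * (b * q * D - c) * C * (1 - q) * (1 - q^2)"
  using nz unfolding ph th' y1 y2 C assms
  by (simp add: divide_simps power2_eq_square) algebra

lemma up_core_last:
  assumes "D = q * Q"
  shows "(q - 1 / q) * (b * Q - c / Q) * ((th' 0 - th' 1) * y1 * (1 - q) + ph 1)
      + ph 0 * y1 * (1 - q)
   = - (1 - 1 / q) * (1 - 1 / q^2) * q^2 * (b * Q - c) * C * (1 - q)"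
  using nz unfolding ph th' y1 C assms
  by (simp add: divide_simps power2_eq_square) algebra

lemma up_core_only:
  assumes "D = q" "Q = 1"
  shows "(q - 1 / q) * ((th' 0 - th' 1) * y1 * (1 - q) + ph 1)
   = - (1 - 1 / q) * (1 - 1 / q^2) * q^2 * C * (1 - q)"
  using nz unfolding ph th' y1 C assms
  by (simp add: divide_simps power2_eq_square) algebra

end

context split_scalars
begin

text \<open>The entry is a nonzero multiple of \<open>C\<close>. Up to the factors
  \<open>1 - q\<close> and \<open>1 - q^2\<close>, \<open>y1\<close> and \<open>y2\<close> are the
  differences from \<open>\<theta> i\<close> to the next two eigenvalues. The four combinations of
  \<open>i = 0\<close> and \<open>Suc i = d\<close> are separate, since \<open>b * q ^ i - c\<close>
  at the lower end and \<open>y2\<close> at the upper end may be zero.\<close>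

lemma m_up_nz_iff:
  assumes "i < d"
  shows "m i (Suc i) \<noteq> 0 \<longleftrightarrow> \<tau> \<noteq> b * c' * q ^ i / q ^ d + c * b' / (q * q ^ i)"
proof -
  define C where "C = \<tau> - b * c' * q ^ i / q ^ d - c * b' / (q * q ^ i)"
  define y1 where "y1 = b * q ^ i - c / (q * q ^ i)"
  define y2 where "y2 = b * q ^ i - c / (q^2 * q ^ i)"
  define e where "e = \<theta>' i - \<theta>' (Suc i) + \<phi> (Suc i) / (\<theta> i - \<theta> (Suc i))
        - \<phi> (Suc (Suc i)) / (\<theta> i - \<theta> (Suc (Suc i)))"
  have qq: "q \<noteq> 1" "q^2 \<noteq> 1" using q1[of 1] q1[of 2] by auto
  have t1: "\<theta> i - \<theta> (Suc i) = (1 - q) * y1"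
    using q0 by (simp add: y1_def theta_seq_def field_simps)
  have t2: "\<theta> i - \<theta> (Suc (Suc i)) = (1 - q^2) * y2"
    using q0 by (simp add: y2_def theta_seq_def field_simps power2_eq_square)
  have y1: "y1 \<noteq> 0" using t1 assms distinct[of i "Suc i"] by auto
  have y2: "y2 \<noteq> 0" if "Suc i < d" using t2 that distinct[of i "Suc (Suc i)"] by auto
  define th' where "th' j = \<theta>' (i + j) - a'" for j
  define ph where "ph j = \<phi> (i + j)" for j
  have ph: "ph j = (q ^ i * q ^ j - 1) * (q * q ^ d / (q ^ i * q ^ j) - 1)
        * (\<tau> - b * b' * (q ^ i * q ^ j) / q - c * c' / (q ^ i * q ^ j * q ^ d))" for j
    by (simp add: ph_def split_seq_def power_add)
  have th': "th' j = b' * (q ^ i * q ^ j) + c' / (q ^ i * q ^ j)" for j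
    by (simp add: th'_def theta_seq_def power_add)
  have e: "e = th' 0 - th' 1 + ph 1 / ((1 - q) * y1) - ph 2 / ((1 - q^2) * y2)"
    unfolding e_def t1 t2 by (simp add: th'_def ph_def)
  have n1: "1 - q \<noteq> 0" "1 - q^2 \<noteq> 0" "1 - 1 / q \<noteq> 0" "1 - 1 / q^2 \<noteq> 0" "q - 1 / q \<noteq> 0"
    using qq q0 by (auto simp: field_simps power2_eq_square)
  have nq: "q ^ i \<noteq> 0" "q ^ d \<noteq> 0" using q0 by auto
  note [simp] = n1
  have e_last: "e = th' 0 - th' 1 + ph 1 / ((1 - q) * y1)" if "Suc i = d"
    unfolding e using phi_Suc_d that by (simp add: ph_def)
  have e_mid: "((1 - q) * y1) * ((1 - q^2) * y2) * e = (th' 0 - th' 1) * y1 * y2 * (1 - q) * (1 - q^2)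
      + ph 1 * y2 * (1 - q^2) - ph 2 * y1 * (1 - q)" if "y2 \<noteq> 0"
  proof -
    define z1 z2 where z: "z1 = (1 - q) * y1" "z2 = (1 - q^2) * y2"
    have "z1 \<noteq> 0" "z2 \<noteq> 0" using y1 that n1 by (simp_all add: z del: right_minus_eq)
    then have "z1 * z2 * e = (th' 0 - th' 1) * (z1 * z2) + ph 1 * z2 - ph 2 * z1"
      unfolding e z[symmetric] by (simp add: field_simps)
    then show ?thesis unfolding z by (simp add: mult_ac)
  qed
  \<comment> \<open>Up to a power of \<open>q\<close>, this is a factor of
    \<open>\<theta> d - \<theta> (Suc i)\<close>.\<close>
  have bE: "b * q * q ^ d - c / q ^ i \<noteq> 0" if "Suc i < d"
  proof -
    have "b - c / (q ^ d * q ^ Suc i) \<noteq> 0" using that b_c_nz[of d "Suc i"] by simp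
    then show ?thesis using q0 by (simp add: field_simps)
  qed
  \<comment> \<open>A multiple of the corresponding factor of
    \<open>\<theta> i - \<theta> 0\<close>.\<close>
  have bQ: "b * q ^ i - c \<noteq> 0" if "i \<noteq> 0"
    using b_c_nz[of i 0] that assms q0 by (simp add: field_simps)
  have iff: "m i (Suc i) \<noteq> 0 \<longleftrightarrow> C \<noteq> 0"
  proof (cases "i = 0")
    case True
    have "m i (Suc i) = e" using m_up_formula[OF assms] True
      by (simp add: e_def phi_0 p_0)
    moreover have "e \<noteq> 0 \<longleftrightarrow> C \<noteq> 0"
    proof (cases "Suc i = d")
      case last: True
      have "(1 - q) * y1 \<noteq> 0" using y1 n1 by (simp del: right_minus_eq)
      then have e': "((1 - q) * y1) * e = (th' 0 - th' 1) * y1 * (1 - q) + ph 1"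
        unfolding e_last[OF last] distrib_left by simp
      have "(q - 1 / q) * (((1 - q) * y1) * e) = - (1 - 1 / q) * (1 - 1 / q^2) * q^2 * C * (1 - q)"
        using up_core_only[OF q0 qq nq th' ph y1_def y2_def C_def] last[symmetric] True
        unfolding e' by simp
      then show ?thesis using y1 q0 n1 by (metis mult_eq_0_iff neg_equal_0_iff_equal power_eq_0_iff)
    next
      case False
      have 2: "y2 \<noteq> 0" using y2 False assms by simp
      have "(q - 1 / q) * ((1 - q) * y1) * ((1 - q^2) * y2) * e
          = - (1 - 1 / q) * (1 - 1 / q^2) * (b * q * q ^ d - c) * C * (1 - q) * (1 - q^2)"
        unfolding up_core_first[OF q0 qq nq th' ph y1_def y2_def C_def, OF True[THEN arg_cong[of _ _ "power q"], simplified], symmetric]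
        using e_mid[OF 2] by algebra
      moreover have "b * q * q ^ d - c \<noteq> 0" using bE True False assms by simp
      ultimately show ?thesis using y1 2 n1 by (metis mult_eq_0_iff neg_equal_0_iff_equal)
    qed
    ultimately show ?thesis by simp
  next
    case False
    define r where "r = p (\<theta> (Suc i)) (i - 1)"
    have r: "r \<noteq> 0" using p_nz[of "Suc i" "i - 1"] assms by (simp add: r_def)
    obtain n where n: "i = Suc n" using False by (cases i) auto
    have "p (\<theta> (Suc i)) i = (\<theta> (Suc i) - \<theta> n) * r" by (simp add: n r_def p_Suc)
    also have "\<theta> (Suc i) - \<theta> n = (q - 1 / q) * (b * q ^ i - c / q ^ i)"
      using q0 by (simp add: theta_seq_def n field_simps)
    finally have pi: "p (\<theta> (Suc i)) i = (q - 1 / q) * (b * q ^ i - c / q ^ i) * r" .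
    have "m i (Suc i) = r * (ph 0 + (q - 1 / q) * (b * q ^ i - c / q ^ i) * e)"
      unfolding m_up_formula[OF assms] e_def[symmetric] r_def[symmetric] pi ph_def
      by (simp add: distrib_left mult_ac)
    moreover have "ph 0 + (q - 1 / q) * (b * q ^ i - c / q ^ i) * e \<noteq> 0 \<longleftrightarrow> C \<noteq> 0"
    proof (cases "Suc i = d")
      case last: True
      have "(ph 0 + (q - 1 / q) * (b * q ^ i - c / q ^ i) * e) * ((1 - q) * y1)
          = - (1 - 1 / q) * (1 - 1 / q^2) * q^2 * (b * q ^ i - c) * C * (1 - q)"
        unfolding up_core_last[OF q0 qq nq th' ph y1_def y2_def C_def, OF last[THEN arg_cong[of _ _ "power q"], simplified, symmetric], symmetric]
        unfolding e_last[OF last] using y1 by (simp add: divide_simps)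
      then show ?thesis using y1 q0 n1 bQ[OF False]
        by (metis mult_eq_0_iff neg_equal_0_iff_equal power_eq_0_iff)
    next
      case notlast: False
      have 2: "y2 \<noteq> 0" using y2 notlast assms by simp
      have "(ph 0 + (q - 1 / q) * (b * q ^ i - c / q ^ i) * e) * ((1 - q) * y1) * ((1 - q^2) * y2)
          = - (1 - 1 / q) * (1 - 1 / q^2) * (b * q * q ^ d - c / q ^ i) * (b * q ^ i - c) * C
            * (1 - q) * (1 - q^2)"
        unfolding up_core_general[OF q0 qq nq th' ph y1_def y2_def C_def, symmetric]
        unfolding e_mid[OF 2, symmetric] by (simp only: algebra_simps)
      moreover have "b * q * q ^ d - c / q ^ i \<noteq> 0" using bE notlast assms by simp
      ultimately show ?thesis using y1 2 n1 bQ[OF False] 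
        by (metis mult_eq_0_iff neg_equal_0_iff_equal)
    qed
    ultimately show ?thesis using r by simp
  qed
  then show ?thesis by (simp add: C_def algebra_simps)
qed

end

section \<open>Linear functionals and one half of the Leonard property\<close>

lemma mult_vec_sum: "(X :: complex^'n^'m) *v (\<Sum>i\<in>S. c i *s h i) = (\<Sum>i\<in>S. c i *s (X *v h i))"
  by (induction S rule: infinite_finite_induct)
    (simp_all add: matrix_vector_right_distrib vector_scalar_commute)

definition functional :: "(complex^'n \<Rightarrow> complex) \<Rightarrow> bool" where
  "functional L \<longleftrightarrow> (\<forall>v w. L (v + w) = L v + L w) \<and> (\<forall>e v. L (e *s v) = e * L v)"

lemma functional_add: "functional L \<Longrightarrow> L (v + w) = L v + L w"
  and functional_scale: "functional L \<Longrightarrow> L (e *s v) = e * L v"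
  by (simp_all add: functional_def)

lemma functional_zero: "functional L \<Longrightarrow> L 0 = 0"
  unfolding functional_def by (metis mult_zero_left vector_smult_lzero)

lemma functional_sum:
  assumes "functional L"
  shows "L (\<Sum>i\<in>S. c i *s h i) = (\<Sum>i\<in>S. c i * L (h i))"
proof (induction S rule: infinite_finite_induct)
  case (insert x F)
  then show ?case using assms by (simp add: functional_def)
qed (use functional_zero[OF assms] in auto)

lemma functional_mult_vec: "functional L \<Longrightarrow> functional (\<lambda>w. L (X *v w))"
  by (simp add: functional_def matrix_vector_right_distrib vector_scalar_commute)

text \<open>Condition (ii) of a Leonard pair. Condition (i) is the same with the two maps
  interchanged.\<close>

definition half_leonard_pair :: "(complex^'n) set \<Rightarrow> (complex^'n \<Rightarrow> complex^'n)
    \<Rightarrow> (complex^'n \<Rightarrow> complex^'n) \<Rightarrow> bool" where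
  "half_leonard_pair V X X' \<longleftrightarrow>
     (\<exists>vs B B'. basis_list V vs \<and> represents vs X B \<and> represents vs X' B' \<and>
        diagonal_mat (length vs) B \<and> irred_tridiagonal (length vs) B')"

text \<open>The \<open>g k\<close> are the coordinate functionals of the basis \<open>u 0\<close>,
  ..., \<open>u d\<close> of \<open>W\<close>; \<open>g_u\<close> and \<open>g_expand\<close>
  together express that it is a basis. At the ends, \<open>u (Suc d) = 0\<close> stops
  \<open>X\<close>, and the zero split entry at 0 makes the value of \<open>k - 1\<close> there
  irrelevant.\<close>

locale split_pair = split_scalars q a b c a' b' c' \<tau> d
  for q a b c a' b' c' \<tau> :: complex and d :: nat +
  fixes W :: "(complex^'n) set" and u :: "nat \<Rightarrow> complex^'n" and g :: "nat \<Rightarrow> complex^'n \<Rightarrow> complex"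
    and X X' :: "complex^'n^'n"
  assumes subsp: "vec.subspace W" and u_in: "\<And>k. k \<le> d \<Longrightarrow> u k \<in> W" and u_end: "u (Suc d) = 0"
    and g_fun: "\<And>k. functional (g k)"
    and g_u: "\<And>k l. k \<le> d \<Longrightarrow> l \<le> d \<Longrightarrow> g k (u l) = of_bool (k = l)"
    and g_expand: "\<And>w. w \<in> W \<Longrightarrow> w = (\<Sum>k\<le>d. g k w *s u k)"
    and X_u: "\<And>k. k \<le> d \<Longrightarrow> X *v u k = theta_seq q a b c k *s u k + u (Suc k)"
    and X'_u: "\<And>k. k \<le> d \<Longrightarrow> X' *v u k = theta_seq q a' b' c' k *s u k
        + split_seq q \<tau> (b * b') (c * c') d k *s u (k - 1)"
begin

definition f where "f t w = (\<Sum>k\<le>d. p t k * g k w)"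
definition v where "v i = (\<Sum>k=i..d. \<alpha> i k *s u k)"

lemma functional_expand: "functional L \<Longrightarrow> w \<in> W \<Longrightarrow> L w = (\<Sum>k\<le>d. g k w * L (u k))"
  by (subst g_expand, assumption) (rule functional_sum)

lemma sum_in_W:
  assumes "\<And>i. i \<in> S \<Longrightarrow> h i \<in> W"
  shows "(\<Sum>i\<in>S. e i *s h i) \<in> W"
  using assms by (intro vec.subspace_sum[OF subsp] vec.subspace_scale[OF subsp])

lemma X_in:
  assumes "w \<in> W"
  shows "X *v w \<in> W"
proof -
  have "X *v u k \<in> W" if "k \<le> d" for k
    unfolding X_u[OF that] using u_in[of k] u_in[of "Suc k"] u_end that vec.subspace_0[OF subsp]
    by (intro vec.subspace_add[OF subsp] vec.subspace_scale[OF subsp]) (cases "k = d"; simp)+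
  then show ?thesis
    by (subst g_expand[OF assms], unfold mult_vec_sum) (rule sum_in_W, simp)
qed

lemma X'_in:
  assumes "w \<in> W"
  shows "X' *v w \<in> W"
proof -
  have "X' *v u k \<in> W" if "k \<le> d" for k
    unfolding X'_u[OF that] using that
    by (intro vec.subspace_add[OF subsp] vec.subspace_scale[OF subsp] u_in) auto
  then show ?thesis
    by (subst g_expand[OF assms], unfold mult_vec_sum) (rule sum_in_W, simp)
qed

lemma f_fun: "functional (f t)"
  using g_fun unfolding functional_def f_def
  by (simp add: sum.distrib distrib_left sum_distrib_left mult.left_commute)

lemma f_u: "k \<le> d \<Longrightarrow> f t (u k) = p t k"
  by (simp add: f_def g_u of_bool_def if_distrib sum.delta cong: if_cong)

lemma f_u_Suc: "j \<le> d \<Longrightarrow> k \<le> d \<Longrightarrow> f (\<theta> j) (u (Suc k)) = p (\<theta> j) (Suc k)"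
  using f_u[of "Suc k"] by (cases "k = d") (simp_all add: u_end p_zero functional_zero[OF f_fun])

lemma f_X:
  assumes "j \<le> d" "w \<in> W"
  shows "f (\<theta> j) (X *v w) = \<theta> j * f (\<theta> j) w"
proof -
  have "f (\<theta> j) (X *v u k) = \<theta> j * p (\<theta> j) k" if "k \<le> d" for k
    using f_fun[of "\<theta> j"] that assms(1)
    by (simp add: X_u functional_def f_u f_u_Suc) (simp add: p_Suc algebra_simps)
  then show ?thesis
    using functional_expand[OF functional_mult_vec[OF f_fun] assms(2), of "\<theta> j" X]
      functional_expand[OF f_fun assms(2), of "\<theta> j"]
    by (simp add: f_u sum_distrib_left mult.left_commute)
qed

lemma f_X'_u: "k \<le> d \<Longrightarrow> f t (X' *v u k) = F t k"
  using f_fun[of t] by (simp add: X'_u functional_def f_u F_def)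

lemma v_in: "v i \<in> W"
  unfolding v_def by (rule sum_in_W) (simp add: u_in)

lemma X_v:
  assumes "i \<le> d"
  shows "X *v v i = \<theta> i *s v i"
proof -
  have "X *v v i = (\<Sum>k=i..d. \<alpha> i k *s (\<theta> k *s u k + u (Suc k)))"
    unfolding v_def mult_vec_sum by (rule sum.cong) (simp_all add: X_u)
  moreover have "(\<Sum>k=i..d. \<alpha> i k *s (\<theta> k *s u k + u (Suc k))) $ n = (\<theta> i *s v i) $ n" for n
    using alpha_eigen[OF assms, of "\<lambda>k. u k $ n" 0] by (simp add: v_def u_end distrib_left mult.assoc)
  ultimately show ?thesis by (simp add: vec_eq_iff)
qed

lemma f_X'_v: "f (\<theta> j) (X' *v v i) = m i j"
  unfolding v_def mult_vec_sum functional_sum[OF f_fun] m_def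
  by (rule sum.cong) (simp_all add: f_X'_u)

lemma f_v:
  assumes "i \<le> d" "j \<le> d"
  shows "f (\<theta> j) (v i) = (if i = j then p (\<theta> i) i else 0)"
proof -
  have *: "f (\<theta> j) (v i) = (\<Sum>k=i..d. \<alpha> i k * p (\<theta> j) k)"
    unfolding v_def functional_sum[OF f_fun] by (rule sum.cong) (simp_all add: f_u)
  show ?thesis
  proof (cases "i = j")
    case True
    have "(\<Sum>k=i..d. \<alpha> i k * p (\<theta> i) k) = (\<Sum>k\<in>{i}. \<alpha> i k * p (\<theta> i) k)"
      by (rule sum.mono_neutral_right) (use assms in \<open>auto simp: p_zero\<close>)
    then show ?thesis using * True by (simp add: alpha_refl)
  next
    case False
    then show ?thesis using * alpha_p assms by simp
  qed
qed

text \<open>Triangularity: \<open>p (\<theta> k) l = 0\<close> for \<open>l > k\<close>, so once the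
  earlier coordinates are zero, \<open>f (\<theta> k) w\<close> sees only the coordinate
  \<open>g k w\<close>.\<close>

lemma f_separates:
  assumes w: "w \<in> W" and 0: "\<And>j. j \<le> d \<Longrightarrow> f (\<theta> j) w = 0"
  shows "w = 0"
proof -
  have "g k w = 0" if "k \<le> d" for k
    using that
  proof (induction k rule: less_induct)
    case (less k)
    have "f (\<theta> k) w = (\<Sum>l\<in>{k}. p (\<theta> k) l * g l w)"
      unfolding f_def
    proof (rule sum.mono_neutral_right)
      show "\<forall>l\<in>{..d} - {k}. p (\<theta> k) l * g l w = 0"
      proof
        fix l assume "l \<in> {..d} - {k}"
        then show "p (\<theta> k) l * g l w = 0"
          using less by (cases "l < k") (auto simp: p_zero)
      qed
    qed (use less in auto)
    then show ?case using 0[OF less.prems] p_nz[OF less.prems order_refl] by simp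
  qed
  then show ?thesis using g_expand[OF w] by simp
qed

lemma v_expand:
  assumes "w \<in> W"
  shows "w = (\<Sum>j\<le>d. (f (\<theta> j) w / p (\<theta> j) j) *s v j)"
proof -
  define x where "x = w + (-1) *s (\<Sum>j\<le>d. (f (\<theta> j) w / p (\<theta> j) j) *s v j)"
  have "x \<in> W" unfolding x_def
    by (intro vec.subspace_add[OF subsp] vec.subspace_scale[OF subsp] assms sum_in_W v_in)
  moreover have "f (\<theta> i) x = 0" if "i \<le> d" for i
  proof -
    have "f (\<theta> i) x = f (\<theta> i) w - (\<Sum>j\<le>d. f (\<theta> j) w / p (\<theta> j) j * f (\<theta> i) (v j))"
      unfolding x_def functional_add[OF f_fun] functional_scale[OF f_fun] functional_sum[OF f_fun]
      by simp
    also have "(\<Sum>j\<le>d. f (\<theta> j) w / p (\<theta> j) j * f (\<theta> i) (v j))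
       = (\<Sum>j\<in>{i}. f (\<theta> j) w / p (\<theta> j) j * f (\<theta> i) (v j))"
      by (rule sum.mono_neutral_right) (use that in \<open>auto simp: f_v\<close>)
    finally show ?thesis using that p_nz[OF that order_refl] by (simp add: f_v)
  qed
  ultimately have "x = 0" by (rule f_separates)
  then show ?thesis by (simp add: x_def)
qed

lemma v_inj: "inj_on v {..d}"
  by (rule inj_onI) (metis f_v p_nz atMost_iff order_refl)

lemma v_basis: "basis_list W (map v [0..<Suc d])"
proof -
  have set: "set (map v [0..<Suc d]) = v ` {..d}" by (auto simp: less_Suc_eq_le simp del: upt_Suc)
  have "vec.independent (v ` {..d})"
  proof
    assume "vec.dependent (v ` {..d})"
    then obtain e x where x: "x \<in> v ` {..d}" "e x \<noteq> 0" and s: "(\<Sum>x\<in>v ` {..d}. e x *s x) = 0"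
      by (auto simp: vec.dependent_finite)
    obtain j where j: "j \<le> d" "x = v j" using x by auto
    have "0 = f (\<theta> j) (\<Sum>i\<le>d. e (v i) *s v i)"
      using s by (simp add: sum.reindex[OF v_inj] functional_zero[OF f_fun])
    also have "\<dots> = (\<Sum>i\<in>{j}. e (v i) * f (\<theta> j) (v i))"
      unfolding functional_sum[OF f_fun]
      by (rule sum.mono_neutral_right) (use j in \<open>auto simp: f_v\<close>)
    finally show False using x j p_nz[of j j] by (simp add: f_v)
  qed
  moreover have "vec.span (v ` {..d}) = W"
  proof
    show "vec.span (v ` {..d}) \<subseteq> W"
      by (rule vec.span_minimal[OF _ subsp]) (use v_in in auto)
    show "W \<subseteq> vec.span (v ` {..d})"
    proof
      fix w assume "w \<in> W"
      show "w \<in> vec.span (v ` {..d})"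
        by (subst v_expand[OF \<open>w \<in> W\<close>], intro vec.span_sum vec.span_scale vec.span_base) auto
    qed
  qed
  moreover have "distinct (map v [0..<Suc d])"
    unfolding distinct_map using v_inj by (auto simp: inj_on_def less_Suc_eq_le simp del: upt_Suc)
  ultimately show ?thesis unfolding basis_list_def set by blast
qed

lemma half_leonard_pairI:
  assumes "\<And>i. i < d \<Longrightarrow> m i (Suc i) \<noteq> 0"
  shows "half_leonard_pair W ((*v) X) ((*v) X')"
proof -
  define vs where "vs = map v [0..<Suc d]"
  define B where "B i j = (if i = j then \<theta> i else 0)" for i j
  \<comment> \<open>The indices of \<open>m\<close> are transposed, and the denominator normalises
    the dual basis: \<open>f (\<theta> i)\<close> has the value \<open>p (\<theta> i) i\<close> on
    \<open>v i\<close>.\<close>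
  define B' where "B' i j = m j i / p (\<theta> i) i" for i j
  have len: "length vs = Suc d" and nth: "\<And>i. i \<le> d \<Longrightarrow> vs ! i = v i"
    unfolding vs_def by (simp_all del: upt_Suc)
  have "represents vs ((*v) X) B"
    unfolding represents_def len
  proof (intro allI impI)
    fix j assume "j < Suc d"
    then have "(\<Sum>i<Suc d. B i j *s vs ! i) = (\<Sum>i\<in>{j}. B i j *s vs ! i)"
      by (intro sum.mono_neutral_right) (auto simp: B_def)
    then show "X *v vs ! j = (\<Sum>i<Suc d. B i j *s vs ! i)"
      using \<open>j < Suc d\<close> by (simp add: B_def nth X_v)
  qed
  moreover have "represents vs ((*v) X') B'"
    unfolding represents_def len
  proof (intro allI impI)
    fix j assume j: "j < Suc d"
    have "X' *v v j = (\<Sum>i\<le>d. (f (\<theta> i) (X' *v v j) / p (\<theta> i) i) *s v i)"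
      by (intro v_expand X'_in v_in)
    also have "\<dots> = (\<Sum>i<Suc d. B' i j *s vs ! i)"
      by (rule sum.cong) (auto simp: nth B'_def f_X'_v)
    finally show "X' *v vs ! j = (\<Sum>i<Suc d. B' i j *s vs ! i)" using j by (simp add: nth)
  qed
  moreover have "diagonal_mat (length vs) B" by (simp add: diagonal_mat_def B_def)
  moreover have "irred_tridiagonal (length vs) B'"
    unfolding irred_tridiagonal_def len
    using m_lower m_upper m_Suc_nz assms p_nz[OF _ order_refl] by (auto simp: B'_def)
  ultimately show ?thesis using v_basis unfolding half_leonard_pair_def vs_def by blast
qed

text \<open>The eigenvalues of \<open>X\<close> are distinct, so any eigenbasis is \<open>v\<close>
  up to nonzero scalars \<open>s\<close> and a bijection \<open>\<pi>\<close> of the indices. Which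
  bijection it is need not be determined.\<close>

lemma half_leonard_pairD:
  assumes hl: "half_leonard_pair W ((*v) X) ((*v) X')" and i: "i < d"
  shows "m i (Suc i) \<noteq> 0"
proof -
  obtain vs B B' where bas: "basis_list W vs" and rX: "represents vs ((*v) X) B"
    and rX': "represents vs ((*v) X') B'"
    and diag: "diagonal_mat (length vs) B" and tri: "irred_tridiagonal (length vs) B'"
    using hl unfolding half_leonard_pair_def by blast
  define n where "n = length vs"
  have ind: "vec.independent (set vs)" and span: "vec.span (set vs) = W" and dist: "distinct vs"
    using bas by (auto simp: basis_list_def)
  have in_W: "vs ! k \<in> W" if "k < n" for k
    using that span vec.span_base[of "vs ! k" "set vs"] by (simp add: n_def)
  have nz: "vs ! k \<noteq> 0" if "k < n" for k
    using that ind vec.dependent_zero[of "set vs"] nth_mem[of k vs] by (metis n_def)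
  have eig: "X *v vs ! k = B k k *s vs ! k" if "k < n" for k
  proof -
    have "X *v vs ! k = (\<Sum>j<n. B j k *s vs ! j)" using rX that by (simp add: represents_def n_def)
    also have "\<dots> = (\<Sum>j\<in>{k}. B j k *s vs ! j)"
      by (rule sum.mono_neutral_right) (use that diag in \<open>auto simp: diagonal_mat_def n_def\<close>)
    finally show ?thesis by simp
  qed
  have "\<exists>j\<le>d. f (\<theta> j) (vs ! k) \<noteq> 0 \<and> (\<forall>l\<le>d. l \<noteq> j \<longrightarrow> f (\<theta> l) (vs ! k) = 0)" if k: "k < n" for k
  proof -
    obtain j where j: "j \<le> d" "f (\<theta> j) (vs ! k) \<noteq> 0" using f_separates[OF in_W[OF k]] nz[OF k] by blast
    have B: "(\<theta> l - B k k) * f (\<theta> l) (vs ! k) = 0" if "l \<le> d" for l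
      using f_X[OF that in_W[OF k]] eig[OF k] functional_scale[OF f_fun] by (auto simp: algebra_simps)
    have "B k k = \<theta> j" using B[OF j(1)] j(2) by simp
    then show ?thesis using B distinct j by (metis eq_iff_diff_eq_0 mult_eq_0_iff)
  qed
  then obtain \<pi> where pi: "\<And>k. k < n \<Longrightarrow> \<pi> k \<le> d" "\<And>k. k < n \<Longrightarrow> f (\<theta> (\<pi> k)) (vs ! k) \<noteq> 0"
    and pi0: "\<And>k l. k < n \<Longrightarrow> l \<le> d \<Longrightarrow> l \<noteq> \<pi> k \<Longrightarrow> f (\<theta> l) (vs ! k) = 0"
    by metis
  define s where "s k = f (\<theta> (\<pi> k)) (vs ! k) / p (\<theta> (\<pi> k)) (\<pi> k)" for k
  have s: "s k \<noteq> 0" if "k < n" for k using pi that p_nz by (simp add: s_def)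
  have vs: "vs ! k = s k *s v (\<pi> k)" if k: "k < n" for k
  proof -
    have "vs ! k = (\<Sum>j\<le>d. (f (\<theta> j) (vs ! k) / p (\<theta> j) j) *s v j)" by (rule v_expand[OF in_W[OF k]])
    also have "\<dots> = (\<Sum>j\<in>{\<pi> k}. (f (\<theta> j) (vs ! k) / p (\<theta> j) j) *s v j)"
      by (rule sum.mono_neutral_right) (use pi pi0 k in auto)
    finally show ?thesis by (simp add: s_def)
  qed
  have inj: "\<pi> k \<noteq> \<pi> l" if "k < n" "l < n" "k \<noteq> l" for k l
  proof
    assume "\<pi> k = \<pi> l"
    then have "vs ! k = (s k / s l) *s vs ! l" using vs that s by (simp add: vector_smult_assoc)
    moreover have "vs ! l \<in> set vs - {vs ! k}"
      using that dist by (auto simp: n_def nth_eq_iff_index_eq)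
    ultimately have "vs ! k \<in> vec.span (set vs - {vs ! k})"
      by (metis vec.span_base vec.span_scale)
    then show False using ind that nth_mem[of k vs] by (auto simp: vec.dependent_def n_def)
  qed
  have surj: "\<exists>k<n. \<pi> k = j" if "j \<le> d" for j
  proof (rule ccontr)
    assume "\<not> ?thesis"
    then have 0: "f (\<theta> j) (vs ! k) = 0" if "k < n" for k using that pi0 \<open>j \<le> d\<close> by blast
    have "vec.subspace {w. f (\<theta> j) w = 0}"
      unfolding vec.subspace_def
      by (simp add: functional_zero[OF f_fun] functional_add[OF f_fun] functional_scale[OF f_fun])
    moreover have "set vs \<subseteq> {w. f (\<theta> j) w = 0}"
      using 0 by (auto simp: in_set_conv_nth n_def)
    ultimately have "W \<subseteq> {w. f (\<theta> j) w = 0}" using span vec.span_minimal by blast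
    then show False using v_in[of j] f_v[of j j] that p_nz[of j j] by auto
  qed
  have entry: "m (\<pi> k) (\<pi> l) * s k = B' l k * f (\<theta> (\<pi> l)) (vs ! l)" if "k < n" "l < n" for k l
  proof -
    have "m (\<pi> k) (\<pi> l) * s k = f (\<theta> (\<pi> l)) (X' *v vs ! k)"
      by (simp add: vs[OF that(1)] vector_scalar_commute functional_scale[OF f_fun] f_X'_v)
    also have "X' *v vs ! k = (\<Sum>j<n. B' j k *s vs ! j)" using rX' that by (simp add: represents_def n_def)
    also have "f (\<theta> (\<pi> l)) \<dots> = (\<Sum>j<n. B' j k * f (\<theta> (\<pi> l)) (vs ! j))"
      by (rule functional_sum[OF f_fun])
    also have "\<dots> = (\<Sum>j\<in>{l}. B' j k * f (\<theta> (\<pi> l)) (vs ! j))"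
      by (rule sum.mono_neutral_right) (use that pi pi0 inj in auto)
    finally show ?thesis by simp
  qed
  obtain k where k: "k < n" "\<pi> k = i" using surj[of i] i by auto
  obtain l where l: "l < n" "\<pi> l = Suc i" using surj[of "Suc i"] i by auto
  \<comment> \<open>Off the diagonal, an irreducible tridiagonal matrix has nonzero entries exactly
    at adjacent indices, so \<open>B' k l\<close> and \<open>B' l k\<close> vanish together. The
    entry \<open>m (Suc i) i\<close> is already known to be nonzero.\<close>
  have "B' k l \<noteq> 0" using entry[OF l(1) k(1)] k l m_Suc_nz[OF i] s[OF l(1)] by auto
  then have "B' l k \<noteq> 0 \<or> k = l" using tri k l unfolding irred_tridiagonal_def n_def[symmetric]
    by (metis less_antisym not_less_eq linorder_neqE_nat)
  then show ?thesis using entry[OF k(1) l(1)] k l pi(2)[OF l(1)] by auto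
qed

lemma half_leonard_pair_iff:
  "half_leonard_pair W ((*v) X) ((*v) X') \<longleftrightarrow>
    (\<forall>i<d. \<tau> \<noteq> b * c' * q ^ i / q ^ d + c * b' / (q * q ^ i))"
  using half_leonard_pairI half_leonard_pairD m_up_nz_iff by blast

end

section \<open>Reversal of the split form\<close>

lemma theta_seq_flip:
  "q \<noteq> 0 \<Longrightarrow> i \<le> d \<Longrightarrow> theta_seq q a (c / q ^ d) (b * q ^ d) i = theta_seq q a b c (d - i)"
  by (simp add: theta_seq_def power_diff field_simps)

lemma split_seq_flip:
  assumes "q \<noteq> 0" "i \<le> Suc d"
  shows "split_seq q \<tau> (c' / q ^ d * (c / q ^ d)) (b' * q ^ d * (b * q ^ d)) d i
    = split_seq q \<tau> (b * b') (c * c') d (Suc d - i)"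
proof -
  have "q ^ (Suc d - i) = q * q ^ d / q ^ i" using assms by (simp add: power_diff)
  then show ?thesis unfolding split_seq_def using assms(1) by (simp add: mult_ac)
qed

context split_pair
begin

definition s where "s i = (\<Prod>l<i. \<phi> (d - l))"

lemma s_nz: "i \<le> d \<Longrightarrow> s i \<noteq> 0"
  unfolding s_def using split_nz by auto

lemma s_Suc: "s (Suc i) = \<phi> (d - i) * s i"
  by (simp add: s_def)

text \<open>Reversing the basis and rescaling by partial products of \<open>\<phi>\<close> exchanges the roles of \<open>X\<close> and \<open>X'\<close>.\<close>

lemma flip:
  "split_pair q a' (c' / q ^ d) (b' * q ^ d) a (c / q ^ d) (b * q ^ d) \<tau> d W
     (\<lambda>i. s i *s u (d - i)) (\<lambda>i w. g (d - i) w / s i) X' X"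
proof -
  note fl = theta_seq_flip[OF q0] split_seq_flip[OF q0]
  show ?thesis
  proof (unfold_locales, goal_cases)
    case 1
    then show ?case by (rule q0)
  next
    case (2 k)
    then show ?case by (rule q1)
  next
    case (3 i j)
    then show ?case by (simp add: fl distinct')
  next
    case (4 i j)
    then show ?case by (simp add: fl distinct)
  next
    case (5 i)
    then show ?case using split_nz[of "Suc d - i"] fl(2)[of i] by simp
  next
    case 6
    then show ?case by (rule subsp)
  next
    case (7 k)
    then show ?case by (intro vec.subspace_scale[OF subsp] u_in) simp
  next
    case 8
    \<comment> \<open>The truncated index makes the vector \<open>u 0\<close>, but its coefficient
      \<open>s (Suc d)\<close> contains the factor \<open>\<phi> 0 = 0\<close>.\<close>
    then show ?case by (simp add: s_Suc phi_0)
  next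
    case (9 k)
    then show ?case using g_fun[of "d - k"] by (simp add: functional_def add_divide_distrib)
  next
    case (10 k l)
    then show ?case using s_nz by (auto simp: functional_scale[OF g_fun] g_u)
  next
    case (11 w)
    have "w = (\<Sum>k\<le>d. g k w *s u k)" by (rule g_expand[OF 11])
    also have "\<dots> = (\<Sum>k\<le>d. g (d - k) w *s u (d - k))"
      by (rule sum.reindex_bij_witness[of _ "\<lambda>k. d - k" "\<lambda>k. d - k"]) auto
    also have "\<dots> = (\<Sum>k\<le>d. (g (d - k) w / s k) *s (s k *s u (d - k)))"
      by (rule sum.cong) (use s_nz in \<open>auto simp: vector_smult_assoc\<close>)
    finally show ?case .
  next
    case (12 k)
    have "X' *v (s k *s u (d - k)) = s k *s (theta_seq q a' b' c' (d - k) *s u (d - k)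
        + \<phi> (d - k) *s u (d - k - 1))"
      by (simp only: vector_scalar_commute X'_u[of "d - k"] diff_le_self)
    also have "\<dots> = theta_seq q a' b' c' (d - k) *s (s k *s u (d - k)) + s (Suc k) *s u (d - Suc k)"
      by (simp add: vec_eq_iff s_Suc algebra_simps)
    finally show ?case using 12 by (simp only: fl)
  next
    case (13 k)
    have 1: "X *v (s k *s u (d - k)) = s k *s (\<theta> (d - k) *s u (d - k) + u (Suc (d - k)))"
      by (simp only: vector_scalar_commute X_u[of "d - k"] diff_le_self)
    have 2: "s k *s u (Suc (d - k)) = \<phi> (Suc d - k) *s (s (k - 1) *s u (d - (k - 1)))"
    proof (cases k)
      case 0
      then show ?thesis by (simp add: u_end phi_Suc_d)
    next
      case (Suc l)
      then have "Suc (d - k) = d - l" "Suc d - k = d - l" using 13 by auto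
      then show ?thesis using Suc by (simp add: s_Suc vector_smult_assoc)
    qed
    have "X *v (s k *s u (d - k)) = \<theta> (d - k) *s (s k *s u (d - k)) + s k *s u (Suc (d - k))"
      unfolding 1 by (simp add: vec_eq_iff algebra_simps)
    then show ?case using 13 by (simp only: fl 2 le_SucI)
  qed
qed

lemma linear_endo_X: "linear_endo_on W ((*v) X)" "linear_endo_on W ((*v) X')"
  using X_in X'_in by (auto simp: linear_endo_on_def matrix_vector_right_distrib vector_scalar_commute)

theorem leonard_pair_iff:
  "leonard_pair W ((*v) X) ((*v) X') \<longleftrightarrow>
    (\<forall>i<d. \<tau> \<noteq> b * c' * q ^ i / q ^ d + c * b' / (q * q ^ i))"
proof -
  \<comment> \<open>The reversal preserves \<open>b * c'\<close> and \<open>c * b'\<close>, the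
    powers of \<open>q ^ d\<close> cancelling, so the second half yields literally the same
    condition for each \<open>i\<close>.\<close>
  have "half_leonard_pair W ((*v) X') ((*v) X) \<longleftrightarrow>
    (\<forall>i<d. \<tau> \<noteq> b * c' * q ^ i / q ^ d + c * b' / (q * q ^ i))"
    unfolding split_pair.half_leonard_pair_iff[OF flip] using q0 by (simp add: mult_ac)
  moreover have "leonard_pair W ((*v) X) ((*v) X') \<longleftrightarrow>
    half_leonard_pair W ((*v) X') ((*v) X) \<and> half_leonard_pair W ((*v) X) ((*v) X')"
    unfolding leonard_pair_def half_leonard_pair_def using linear_endo_X by blast
  ultimately show ?thesis using half_leonard_pair_iff by simp
qed

end

section \<open>Counting paths in the attenuated space\<close>

locale attenuated_space = vector_space smul
  for smul :: "'k::{field,finite} \<Rightarrow> 'v::{ab_group_add,finite} \<Rightarrow> 'v" +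
  fixes h :: "'v set"
  assumes h: "subspace h"
begin

section \<open>Subspaces compared by cardinality\<close>

abbreviation "P \<equiv> att_poset smul h"

text \<open>Sizes of subspaces, not dimensions, are compared, so that subspaces can be counted
  through their vectors without quotient spaces.\<close>

definition q where "q = CARD('k)"
definition ext where "ext x v = span (insert v x)"

lemma P_iff: "x \<in> P \<longleftrightarrow> subspace x \<and> x \<inter> h \<subseteq> {0}"
  using subspace_0 h by (auto simp: att_poset_def)

lemma P_subspace: "x \<in> P \<Longrightarrow> subspace x"
  by (simp add: P_iff)

lemma P_mono: "y \<in> P \<Longrightarrow> subspace x \<Longrightarrow> x \<subseteq> y \<Longrightarrow> x \<in> P"
  by (auto simp: P_iff)

lemma q_ge_2: "q \<ge> 2"
proof -
  have "card {0, 1 :: 'k} \<le> CARD('k)" by (rule card_mono) auto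
  then show ?thesis by (simp add: q_def)
qed

lemma card_pos: "subspace x \<Longrightarrow> card x > 0"
  using subspace_0[of x] by (auto simp: card_gt_0_iff)

lemma ext_subspace: "subspace (ext x v)"
  by (simp add: ext_def subspace_span)

lemma ext_sup: "x \<subseteq> ext x v" and ext_mem: "v \<in> ext x v"
  by (auto simp: ext_def intro: span_base)

lemma ext_iff: "subspace x \<Longrightarrow> w \<in> ext x v \<longleftrightarrow> (\<exists>k. w - smul k v \<in> x)"
  by (simp add: ext_def span_insert span_eq_iff[THEN iffD2])

lemma ext_least: "subspace y \<Longrightarrow> x \<subseteq> y \<Longrightarrow> v \<in> y \<Longrightarrow> ext x v \<subseteq> y"
  by (simp add: ext_def span_minimal)

lemma card_ext:
  assumes x: "subspace x" and v: "v \<notin> x"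
  shows "card (ext x v) = q * card x"
proof -
  have "bij_betw (\<lambda>(k, w). smul k v + w) (UNIV \<times> x) (ext x v)"
    unfolding bij_betw_def
  proof
    show "inj_on (\<lambda>(k, w). smul k v + w) (UNIV \<times> x)"
    proof (rule inj_onI, clarify)
      fix k w k' w' assume w: "w \<in> x" "w' \<in> x" and eq: "smul k v + w = smul k' v + w'"
      have e: "smul (k - k') v = w' - w" using eq by (simp add: scale_left_diff_distrib algebra_simps)
      have "k = k'"
      proof (rule ccontr)
        assume "k \<noteq> k'"
        then have "v = smul (inverse (k - k')) (w' - w)" by (simp add: e[symmetric])
        then show False using v w x by (simp add: subspace_diff subspace_scale)
      qed
      then show "k = k' \<and> w = w'" using eq by simp
    qed
    show "(\<lambda>(k, w). smul k v + w) ` (UNIV \<times> x) = ext x v"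
    proof
      show "(\<lambda>(k, w). smul k v + w) ` (UNIV \<times> x) \<subseteq> ext x v"
      proof clarify
        fix k w assume "w \<in> x"
        then have "smul k v + w - smul k v \<in> x" by simp
        then show "smul k v + w \<in> ext x v" unfolding ext_iff[OF x] by (rule exI)
      qed
      show "ext x v \<subseteq> (\<lambda>(k, w). smul k v + w) ` (UNIV \<times> x)"
      proof
        fix w assume "w \<in> ext x v"
        then obtain k where "w - smul k v \<in> x" using ext_iff[OF x] by blast
        then show "w \<in> (\<lambda>(k, w). smul k v + w) ` (UNIV \<times> x)"
          by (intro image_eqI[of _ _ "(k, w - smul k v)"]) auto
      qed
    qed
  qed
  from bij_betw_same_card[OF this] show ?thesis by (simp add: card_cartesian_product q_def)
qed

lemma ext_eq:
  assumes "subspace x" "subspace y" "x \<subseteq> y" "card y = q * card x" "v \<in> y" "v \<notin> x"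
  shows "ext x v = y"
  by (rule card_subset_eq) (use assms in \<open>auto simp: card_ext intro: ext_least[THEN subsetD]\<close>)

lemma no_between:
  assumes "subspace x" "subspace m" "subspace y" "x \<subseteq> m" "m \<subset> y" "card y = q * card x"
  shows "m = x"
proof (rule ccontr)
  assume "m \<noteq> x"
  then obtain v where "v \<in> m" "v \<notin> x" using assms by blast
  then have "ext x v = y" using assms by (intro ext_eq) auto
  then show False using ext_least[OF assms(2,4) \<open>v \<in> m\<close>] assms(5) by blast
qed

lemma card_span_independent:
  assumes "finite B" "independent B"
  shows "card (span B) = q ^ card B"
  using assms
proof (induction B)
  case empty
  then show ?case by simp
next
  case (insert v B)
  then have "v \<notin> span B" "independent B" by (auto simp: independent_insert)
  moreover have "span (insert v B) = ext (span B) v"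
    by (simp add: ext_def span_insert span_span)
  ultimately show ?case using insert card_ext[of "span B" v] by (simp add: subspace_span)
qed

lemma card_subspace:
  assumes "subspace x"
  shows "card x = q ^ dim x"
proof -
  obtain B where B: "B \<subseteq> x" "independent B" "x \<subseteq> span B" "card B = dim x"
    by (rule basis_exists)
  have "span B = x" using B span_minimal[OF B(1) assms] by blast
  then show ?thesis using card_span_independent[OF _ B(2)] B(4) by simp
qed

text \<open>Any vector of \<open>u - x\<close> generates \<open>u\<close> over \<open>x\<close>, so
  the sets \<open>u - x\<close> partition \<open>S\<close>; each has \<open>(q - 1) * card x\<close>
  elements.\<close>

lemma cover_count:
  assumes x: "subspace x" and S: "S \<inter> x = {}" and closed: "\<And>v. v \<in> S \<Longrightarrow> ext x v - x \<subseteq> S"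
  shows "card (ext x ` S) * ((q - 1) * card x) = card S"
proof -
  have S_eq: "S = (\<Union>u\<in>ext x ` S. u - x)"
    using S closed ext_mem by fast
  have "card (\<Union>u\<in>ext x ` S. u - x) = (\<Sum>u\<in>ext x ` S. card (u - x))"
  proof (rule card_UN_disjoint)
    show "\<forall>u\<in>ext x ` S. \<forall>u'\<in>ext x ` S. u \<noteq> u' \<longrightarrow> (u - x) \<inter> (u' - x) = {}"
    proof (intro ballI impI)
      fix u u' assume u: "u \<in> ext x ` S" "u' \<in> ext x ` S" "u \<noteq> u'"
      have E: "ext x w = t" if t: "t \<in> ext x ` S" "w \<in> t - x" for t w
      proof -
        obtain v where "t = ext x v" "v \<in> S" using t(1) by auto
        moreover then have "v \<notin> x" using S by blast
        ultimately show ?thesis using t by (intro ext_eq x) (auto simp: ext_subspace card_ext x ext_sup[THEN subsetD])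
      qed
      show "(u - x) \<inter> (u' - x) = {}" using E u by blast
    qed
  qed auto
  also have "\<dots> = (\<Sum>u\<in>ext x ` S. (q - 1) * card x)"
  proof (rule sum.cong)
    fix u assume "u \<in> ext x ` S"
    then obtain v where "u = ext x v" "v \<notin> x" using S by blast
    then show "card (u - x) = (q - 1) * card x"
      using card_Diff_subset[of x u] by (simp add: ext_sup card_ext x diff_mult_distrib)
  qed simp
  finally show ?thesis using S_eq by simp
qed

section \<open>Intervals, hyperplanes and covers\<close>

definition mid where "mid x y = {u. subspace u \<and> x \<subset> u \<and> u \<subset> y \<and> card u = q * card x}"

lemma card_mid:
  assumes x: "subspace x" and y: "subspace y" and xy: "x \<subseteq> y" and card: "card y = q * (q * card x)"
  shows "card (mid x y) = q + 1"
proof -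
  have lt: "q * card x < q * (q * card x)" using q_ge_2 card_pos[OF x] by simp
  have "mid x y = ext x ` (y - x)"
  proof
    show "mid x y \<subseteq> ext x ` (y - x)"
    proof
      fix u assume u: "u \<in> mid x y"
      then obtain v where "v \<in> u" "v \<notin> x" by (auto simp: mid_def)
      then have "ext x v = u" using u x by (intro ext_eq) (auto simp: mid_def)
      then show "u \<in> ext x ` (y - x)" using \<open>v \<in> u\<close> \<open>v \<notin> x\<close> u by (auto simp: mid_def)
    qed
    show "ext x ` (y - x) \<subseteq> mid x y"
    proof
      fix u assume "u \<in> ext x ` (y - x)"
      then obtain v where v: "u = ext x v" "v \<in> y" "v \<notin> x" by blast
      then have "card u = q * card x" by (simp add: card_ext x)
      moreover have "u \<subseteq> y" "u \<noteq> y" using ext_least[OF y xy] v card \<open>card u = _\<close> lt by auto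
      moreover have "x \<subseteq> u" "x \<noteq> u" using v ext_sup ext_mem by auto
      ultimately show "u \<in> mid x y" by (auto simp: mid_def v ext_subspace)
    qed
  qed
  then have "card (mid x y) * ((q - 1) * card x) = card (y - x)"
    using cover_count[OF x, of "y - x"] ext_least[OF y xy] by auto
  also have "\<dots> = (q + 1) * ((q - 1) * card x)"
    using card_Diff_subset[of x y] xy q_ge_2 by (simp add: card algebra_simps)
  finally have "card (mid x y) * ((q - 1) * card x) = (q + 1) * ((q - 1) * card x)" .
  moreover have "(q - 1) * card x \<noteq> 0" using q_ge_2 card_pos[OF x] by auto
  ultimately show ?thesis unfolding mult_cancel2 by blast
qed

definition cov where "cov x y \<longleftrightarrow> x \<in> P \<and> y \<in> P \<and> x \<subset> y \<and> card y = q * card x"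

lemma covI: "y \<in> P \<Longrightarrow> subspace x \<Longrightarrow> x \<subseteq> y \<Longrightarrow> card y = q * card x \<Longrightarrow> cov x y"
  using q_ge_2 card_pos[of x] P_mono[of y x] by (auto simp: cov_def)

lemma covers_iff: "covers P y x \<longleftrightarrow> cov x y"
proof
  assume c: "covers P y x"
  then have xy: "x \<in> P" "y \<in> P" "x \<subset> y" by (auto simp: covers_def)
  then obtain v where v: "v \<in> y" "v \<notin> x" by blast
  have "ext x v \<subseteq> y" using ext_least v xy by (auto simp: P_iff)
  moreover have "x \<subset> ext x v" using v ext_sup ext_mem by blast
  moreover have "ext x v \<in> P" using P_mono[OF xy(2) ext_subspace] \<open>ext x v \<subseteq> y\<close> .
  ultimately have "ext x v = y" using c by (auto simp: covers_def)
  then show "cov x y" using xy card_ext[of x v] v by (auto simp: cov_def P_iff)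
next
  assume c: "cov x y"
  have "\<not> (\<exists>z\<in>P. x \<subset> z \<and> z \<subset> y)"
  proof
    assume "\<exists>z\<in>P. x \<subset> z \<and> z \<subset> y"
    then obtain z where z: "z \<in> P" "x \<subset> z" "z \<subset> y" by blast
    then have "z = x" using c by (intro no_between[of x z y]) (auto simp: cov_def P_subspace)
    then show False using z by blast
  qed
  then show "covers P y x" using c by (simp add: covers_def cov_def)
qed

lemma card_inter_hyperplane:
  assumes y: "subspace y" and z: "subspace z" and yz: "y \<subseteq> z" "card z = q * card y"
    and u: "subspace u" "u \<subseteq> z" "\<not> u \<subseteq> y"
  shows "card u = q * card (u \<inter> y)"
proof -
  obtain v where v: "v \<in> u" "v \<notin> y" using u by blast
  have i: "subspace (u \<inter> y)" using u y by (simp add: subspace_inter)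
  have z_eq: "ext y v = z" using v u by (intro ext_eq y z yz) auto
  have "u = ext (u \<inter> y) v"
  proof
    show "ext (u \<inter> y) v \<subseteq> u" using v u by (intro ext_least) auto
    show "u \<subseteq> ext (u \<inter> y) v"
    proof
      fix w assume w: "w \<in> u"
      then obtain k where "w - smul k v \<in> y" using z_eq u ext_iff[OF y] by blast
      moreover have "w - smul k v \<in> u" using u w v by (simp add: subspace_diff subspace_scale)
      ultimately show "w \<in> ext (u \<inter> y) v" using ext_iff[OF i] by blast
    qed
  qed
  then show ?thesis using card_ext[OF i, of v] v by simp
qed

definition hyp where "hyp z = {u. subspace u \<and> u \<subseteq> z \<and> card z = q * card u}"

lemma hyp_neq: "u \<in> hyp z \<Longrightarrow> u \<subset> z"
  using q_ge_2 card_pos[of u] by (auto simp: hyp_def)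

text \<open>The recursion of the Gaussian numbers. A hyperplane of \<open>z\<close> other than
  \<open>y\<close> meets \<open>y\<close> in a hyperplane \<open>k\<close> of \<open>y\<close>;
  conversely, of the \<open>q + 1\<close> subspaces between \<open>k\<close> and \<open>z\<close>,
  exactly one is \<open>y\<close>.\<close>

lemma card_hyp:
  assumes z: "subspace z" and y: "y \<in> hyp z"
  shows "card (hyp z) = 1 + q * card (hyp y)"
proof -
  have ys: "subspace y" "y \<subseteq> z" "card z = q * card y" using y by (auto simp: hyp_def)
  have eq: "hyp z - {y} = (\<Union>k\<in>hyp y. mid k z - {y})"
  proof
    show "hyp z - {y} \<subseteq> (\<Union>k\<in>hyp y. mid k z - {y})"
    proof
      fix u assume u: "u \<in> hyp z - {y}"
      then have us: "subspace u" "u \<subseteq> z" "card z = q * card u" by (auto simp: hyp_def)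
      have cu: "card u = card y" using us ys q_ge_2 by simp
      have "\<not> u \<subseteq> y" using u cu card_subset_eq[of y u] by auto
      then have c: "card u = q * card (u \<inter> y)"
        by (rule card_inter_hyperplane[OF ys(1) z ys(2,3) us(1,2)])
      have k: "u \<inter> y \<in> hyp y" using c cu us ys by (simp add: hyp_def subspace_inter)
      have "u \<in> mid (u \<inter> y) z"
        using c us \<open>\<not> u \<subseteq> y\<close> hyp_neq[of u z] u unfolding mid_def by blast
      then show "u \<in> (\<Union>k\<in>hyp y. mid k z - {y})" using k u by blast
    qed
    show "(\<Union>k\<in>hyp y. mid k z - {y}) \<subseteq> hyp z - {y}"
      using ys by (auto simp: hyp_def mid_def)
  qed
  have "card (hyp z - {y}) = (\<Sum>k\<in>hyp y. card (mid k z - {y}))"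
    unfolding eq
  proof (rule card_UN_disjoint)
    show "\<forall>k\<in>hyp y. \<forall>k'\<in>hyp y. k \<noteq> k' \<longrightarrow> (mid k z - {y}) \<inter> (mid k' z - {y}) = {}"
    proof (intro ballI impI, rule ccontr)
      fix k k' assume k: "k \<in> hyp y" "k' \<in> hyp y" "k \<noteq> k'"
      assume "(mid k z - {y}) \<inter> (mid k' z - {y}) \<noteq> {}"
      then obtain u where u: "u \<in> mid k z" "u \<in> mid k' z" "u \<noteq> y" by blast
      have "t = u \<inter> y" if "t \<in> hyp y" "u \<in> mid t z" for t
      proof -
        have t: "subspace t" "t \<subseteq> y" "card y = q * card t" "subspace u" "t \<subset> u" "card u = q * card t"
          using that by (simp_all add: hyp_def mid_def)
        then have "\<not> y \<subseteq> u" using card_subset_eq[of u y] u(3) by auto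
        then have "u \<inter> y \<subset> y" by blast
        then show ?thesis using no_between[of t "u \<inter> y" y] t ys subspace_inter by blast
      qed
      then show False using k u by blast
    qed
  qed auto
  also have "\<dots> = (\<Sum>k\<in>hyp y. q)"
  proof (rule sum.cong)
    fix k assume k: "k \<in> hyp y"
    have "card (mid k z) = q + 1" using k ys by (intro card_mid z) (auto simp: hyp_def)
    moreover have "y \<in> mid k z" using k ys hyp_neq[OF k] hyp_neq[OF y] by (auto simp: mid_def hyp_def)
    ultimately show "card (mid k z - {y}) = q" by simp
  qed simp
  finally have "card (hyp z - {y}) = q * card (hyp y)" by simp
  moreover have "card (hyp z) = Suc (card (hyp z - {y}))" using y by (intro card.remove) auto
  ultimately show ?thesis by simp
qed

definition up where "up z = {u. cov z u}"

text \<open>A vector generates a cover of \<open>z\<close> within \<open>P\<close> exactly if it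
  lies outside the sum \<open>s\<close> of \<open>z\<close> and \<open>h\<close>. That sum is
  direct, hence of size \<open>card z * card h\<close>.\<close>

lemma card_up:
  assumes z: "z \<in> P"
  shows "card (up z) * ((q - 1) * card z) + card z * card h = CARD('v)"
proof -
  have zs: "subspace z" and zh: "z \<inter> h \<subseteq> {0}" using z by (auto simp: P_iff)
  define s where "s = (\<lambda>(a, b). a + b) ` (z \<times> h)"
  have inj: "inj_on (\<lambda>(a, b). a + b) (z \<times> h)"
  proof (rule inj_onI, clarify)
    fix a b a' b' assume ab: "a \<in> z" "a' \<in> z" "b \<in> h" "b' \<in> h" and e: "a + b = a' + b'"
    have "a - a' = b' - b" using e by (simp add: algebra_simps)
    moreover have "a - a' \<in> z" "b' - b \<in> h" using ab zs h by (auto simp: subspace_diff)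
    ultimately have "a - a' = 0" using zh by (metis IntI singletonD subsetD)
    then show "a = a' \<and> b = b'" using e by simp
  qed
  have card_s: "card s = card z * card h"
    unfolding s_def by (simp add: card_image[OF inj] card_cartesian_product)
  have z_s: "z \<subseteq> s" unfolding s_def using subspace_0[OF h] by force
  have s_scale: "smul k w \<in> s" if w: "w \<in> s" for k w
  proof -
    obtain a b where "a \<in> z" "b \<in> h" "w = a + b" using w by (auto simp: s_def)
    then show ?thesis unfolding s_def
      by (intro image_eqI[of _ _ "(smul k a, smul k b)"])
        (simp_all add: scale_right_distrib subspace_scale zs h)
  qed
  have s_add: "w + a \<in> s" if w: "w \<in> s" "a \<in> z" for w a
  proof -
    obtain a' b where "a' \<in> z" "b \<in> h" "w = a' + b" using w(1) by (auto simp: s_def)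
    then show ?thesis unfolding s_def using w(2)
      by (intro image_eqI[of _ _ "(a' + a, b)"]) (simp_all add: algebra_simps subspace_add zs)
  qed
  have out: "w \<notin> s" if vw: "v \<notin> s" "w \<in> ext z v" "w \<notin> z" for v w
  proof
    assume w: "w \<in> s"
    obtain k where k: "w - smul k v \<in> z" using vw ext_iff[OF zs] by blast
    have "k \<noteq> 0" using k vw by auto
    have "smul k v = w + - (w - smul k v)" by simp
    then have "smul k v \<in> s" using s_add[OF w subspace_neg[OF zs k]] by simp
    then have "smul (inverse k) (smul k v) \<in> s" by (rule s_scale)
    then show False using \<open>k \<noteq> 0\<close> that by simp
  qed
  have h_in_s: "h \<subseteq> s" unfolding s_def using subspace_0[OF zs] by force
  have "up z = ext z ` (- s)"
  proof
    show "up z \<subseteq> ext z ` (- s)"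
    proof
      fix u assume "u \<in> up z"
      then have u: "u \<in> P" "z \<subset> u" "card u = q * card z" by (auto simp: up_def cov_def)
      then obtain v where v: "v \<in> u" "v \<notin> z" by blast
      then have "ext z v = u" using u by (intro ext_eq zs P_subspace) auto
      moreover have "v \<notin> s"
      proof
        assume "v \<in> s"
        then obtain a b where ab: "a \<in> z" "b \<in> h" "v = a + b" by (auto simp: s_def)
        have "b = v - a" using ab by simp
        then have "b \<in> u" using ab u v P_subspace[OF u(1)] subspace_diff by blast
        then have "b = 0" using ab u by (auto simp: P_iff)
        then show False using ab v by simp
      qed
      ultimately show "u \<in> ext z ` (- s)" by blast
    qed
    show "ext z ` (- s) \<subseteq> up z"
    proof
      fix u assume "u \<in> ext z ` (- s)"
      then obtain v where v: "u = ext z v" "v \<notin> s" by blast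
      have "u \<inter> h \<subseteq> {0}" using out[OF v(2)] h_in_s zh v(1) by blast
      then have "u \<in> P" using v ext_subspace by (simp add: P_iff)
      moreover have "v \<notin> z" using v z_s by blast
      ultimately show "u \<in> up z" using v card_ext[OF zs] ext_sup
        by (auto simp: up_def intro!: covI zs)
    qed
  qed
  moreover have "card (ext z ` (- s)) * ((q - 1) * card z) = card (- s)"
    using out z_s by (intro cover_count zs) auto
  moreover have "card (- s) + card s = CARD('v)"
    using card_Un_disjoint[of "- s" s] by (simp add: Compl_partition2)
  ultimately show ?thesis using card_s by simp
qed

text \<open>By \<open>card_up\<close>, the number of covers of \<open>z\<close> is
  \<open>(CARD('v) / card z - card h) / (q - 1)\<close>; the term \<open>card h\<close> cancels in
  the difference.\<close>

lemma card_up_diff: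
  assumes c: "cov y z" and e: "e * card z = CARD('v)"
  shows "card (up y) = card (up z) + e"
proof -
  have yz: "y \<in> P" "z \<in> P" "card z = q * card y" using c by (auto simp: cov_def)
  define r where "r = q - 1"
  have r: "q = r + 1" "r > 0" using q_ge_2 by (auto simp: r_def)
  have Y: "card y > 0" using yz card_pos by (simp add: P_iff)
  have "q * (card (up y) * (r * card y) + card y * card h)
      = (card (up z) * (r * card z) + card z * card h) + r * (e * card z)"
    unfolding r_def card_up[OF yz(1)] card_up[OF yz(2)] e using r by (simp add: r_def[symmetric])
  then have "card (up y) * (q * r * card y) = (card (up z) + e) * (q * r * card y)"
    unfolding yz(3) by (simp add: algebra_simps)
  moreover have "q * r * card y \<noteq> 0" using Y r q_ge_2 by auto
  ultimately show ?thesis unfolding mult_cancel2 by blast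
qed

end

context attenuated_space
begin

section \<open>Three-step paths and the cubic relation\<close>

definition paths_LRR where "paths_LRR y z = {(u1, u2). cov y u1 \<and> cov u1 u2 \<and> cov z u2}"
definition paths_RLR where "paths_RLR y z = {(u1, u2). cov y u1 \<and> cov u2 u1 \<and> cov u2 z}"
definition paths_RRL where "paths_RRL y z = {(u1, u2). cov u1 y \<and> cov u1 u2 \<and> cov u2 z}"

lemma cov_mid_iff: 
  assumes "x \<in> P" "y \<in> P" "card y = q * (q * card x)"
  shows "u \<in> mid x y \<longleftrightarrow> cov x u \<and> cov u y"
proof
  assume u: "u \<in> mid x y"
  then have "u \<in> P" by (intro P_mono[OF assms(2)]) (auto simp: mid_def)
  then show "cov x u \<and> cov u y" using u assms by (simp add: mid_def cov_def)
next
  assume "cov x u \<and> cov u y"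
  then show "u \<in> mid x y" by (simp add: mid_def cov_def P_subspace)
qed

lemma cov_hyp_iff: "z \<in> P \<Longrightarrow> u \<in> hyp z \<longleftrightarrow> cov u z"
  unfolding hyp_def using covI[of z u] by (auto simp: cov_def P_subspace)

text \<open>In the second count, either \<open>u1 = z\<close> and \<open>u2\<close> is any
  hyperplane of \<open>z\<close>, or \<open>u1\<close> is another cover of \<open>y\<close>, which
  forces \<open>u2 = y\<close>. The choice \<open>u1 = z\<close>, \<open>u2 = y\<close> belongs to
  both kinds, hence the 1.\<close>

lemma paths_below:
  assumes c: "cov y z"
  shows "card (paths_LRR y z) = (q + 1) * card (up z)"
    and "card (paths_RLR y z) + 1 = card (hyp z) + card (up y)"
    and "card (paths_RRL y z) = (q + 1) * card (hyp y)"
proof -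
  have yz: "y \<in> P" "z \<in> P" "y \<subset> z" "card z = q * card y" "subspace y" "subspace z"
    using c by (auto simp: cov_def P_subspace)
  have "paths_LRR y z = (\<lambda>(u2, u1). (u1, u2)) ` (SIGMA u2:up z. mid y u2)"
  proof -
    have "cov y u1 \<and> cov u1 u2 \<and> cov z u2 \<longleftrightarrow> u2 \<in> up z \<and> u1 \<in> mid y u2" for u1 u2
    proof (cases "cov z u2")
      case True
      then have "u2 \<in> P" "card u2 = q * (q * card y)" using yz(4) by (simp_all add: cov_def)
      then show ?thesis using cov_mid_iff[OF yz(1)] True by (simp add: up_def)
    next
      case False
      then show ?thesis by (simp add: up_def)
    qed
    then show ?thesis by (auto simp: paths_LRR_def image_iff)
  qed
  then have "card (paths_LRR y z) = card (SIGMA u2:up z. mid y u2)"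
    by (simp add: card_image inj_on_def)
  also have "\<dots> = (\<Sum>u2\<in>up z. q + 1)"
    unfolding card_SigmaI[of "up z" "mid y", OF finite ballI[OF finite]]
  proof (rule sum.cong)
    fix u2 assume "u2 \<in> up z"
    then show "card (mid y u2) = q + 1"
      using yz by (intro card_mid) (auto simp: up_def cov_def P_subspace)
  qed simp
  finally show "card (paths_LRR y z) = (q + 1) * card (up z)" by simp
  have "paths_RRL y z = (SIGMA u1:hyp y. mid u1 z)"
  proof -
    have "cov u1 y \<and> cov u1 u2 \<and> cov u2 z \<longleftrightarrow> u1 \<in> hyp y \<and> u2 \<in> mid u1 z" for u1 u2
    proof (cases "cov u1 y")
      case True
      then have "u1 \<in> P" "card z = q * (q * card u1)" using yz(4) by (simp_all add: cov_def)
      then show ?thesis using cov_mid_iff[OF _ yz(2)] cov_hyp_iff[OF yz(1)] True by simp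
    next
      case False
      then show ?thesis using cov_hyp_iff[OF yz(1)] by simp
    qed
    then show ?thesis by (auto simp: paths_RRL_def)
  qed
  then have "card (paths_RRL y z) = (\<Sum>u1\<in>hyp y. card (mid u1 z))" by simp
  also have "\<dots> = (\<Sum>u1\<in>hyp y. q + 1)"
  proof (rule sum.cong)
    fix u1 assume "u1 \<in> hyp y"
    then show "card (mid u1 z) = q + 1"
      using yz by (intro card_mid) (auto simp: hyp_def)
  qed simp
  finally show "card (paths_RRL y z) = (q + 1) * card (hyp y)" by simp
  have "paths_RLR y z = {z} \<times> hyp z \<union> (up y - {z}) \<times> {y}"
  proof (intro set_eqI iffI)
    fix p assume "p \<in> paths_RLR y z"
    then obtain u1 u2 where p: "p = (u1, u2)" and c1: "cov y u1" "cov u2 u1" "cov u2 z"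
      by (auto simp: paths_RLR_def)
    have u: "subspace u1" "subspace u2" "card u1 = q * card y" "y \<subset> u1" "u2 \<subset> u1" "u2 \<subset> z"
      "card u1 = q * card u2"
      using c1 by (auto simp: cov_def P_subspace)
    show "p \<in> {z} \<times> hyp z \<union> (up y - {z}) \<times> {y}"
    proof (cases "u1 = z")
      case True
      then show ?thesis using p c1 cov_hyp_iff[OF yz(2)] by auto
    next
      case False
      have "u2 \<subseteq> y"
      proof
        fix v assume v: "v \<in> u2"
        show "v \<in> y"
        proof (rule ccontr)
          assume "v \<notin> y"
          have "ext y v = u1" using u yz v \<open>v \<notin> y\<close> by (intro ext_eq) auto
          moreover have "ext y v = z" using u yz v \<open>v \<notin> y\<close> by (intro ext_eq) auto
          ultimately show False using False by simp
        qed
      qed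
      moreover have "card u2 = card y" using u q_ge_2 by simp
      ultimately have "u2 = y" by (intro card_subset_eq) auto
      then show ?thesis using p False c1 by (auto simp: up_def)
    qed
  next
    fix p assume "p \<in> {z} \<times> hyp z \<union> (up y - {z}) \<times> {y}"
    then show "p \<in> paths_RLR y z"
      using c cov_hyp_iff[OF yz(2)] by (auto simp: paths_RLR_def up_def)
  qed
  then have "card (paths_RLR y z) = card ({z} \<times> hyp z) + card ((up y - {z}) \<times> {y})"
    by (simp only:) (rule card_Un_disjoint; auto)
  moreover have "card (up y) = Suc (card (up y - {z}))"
    using c by (intro card.remove) (auto simp: up_def)
  ultimately show "card (paths_RLR y z) + 1 = card (hyp z) + card (up y)"
    by (simp add: card_cartesian_product)
qed

text \<open>Everything takes place inside the sum \<open>s\<close> of \<open>y\<close> and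
  \<open>z\<close>. If \<open>s\<close> is in \<open>P\<close>, each of the three counts is
  \<open>q + 1\<close>. Otherwise \<open>h\<close> meets \<open>s\<close> in a line: there are no
  paths over \<open>s\<close>, and exactly one \<open>u\<close> between \<open>w\<close> and
  \<open>z\<close> has a sum with \<open>y\<close> outside \<open>P\<close>.\<close>

lemma paths_above:
  assumes y: "y \<in> P" and z: "z \<in> P" and card: "card z = q * card y" and nsub: "\<not> y \<subseteq> z"
    and int: "card y = q * card (y \<inter> z)"
  shows "card (paths_LRR y z) + q * card (paths_RRL y z) = (q + 1) * card (paths_RLR y z)"
proof -
  define w where "w = y \<inter> z"
  have sub: "subspace y" "subspace z" "subspace w"
    using y z by (auto simp: P_subspace w_def subspace_inter)
  have cw: "card y = q * card w" using int by (simp add: w_def)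
  have wP: "w \<in> P" using P_mono[OF y sub(3)] by (simp add: w_def)
  have wpos: "card w > 0" using sub by (simp add: card_pos)
  \<comment> \<open>One vector serves for all sums with \<open>y\<close>: it generates
    \<open>y\<close> over \<open>w\<close>, so for \<open>u\<close> between \<open>w\<close> and
    \<open>z\<close> the sum of \<open>u\<close> and \<open>y\<close> is
    \<open>ext u v\<close>.\<close>
  obtain v where v: "v \<in> y" "v \<notin> z" using nsub by blast
  have vw: "v \<notin> w" using v by (simp add: w_def)
  have y_eq: "ext w v = y" using v vw sub cw by (intro ext_eq) (auto simp: w_def)
  define s where "s = ext z v"
  have s: "subspace s" "z \<subseteq> s" "card s = q * card z"
    using ext_subspace ext_sup card_ext[OF sub(2) v(2)] by (auto simp: s_def)
  have ys: "y \<subseteq> s"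
    unfolding y_eq[symmetric] using s ext_mem[of v z] by (intro ext_least) (auto simp: s_def w_def)
  have s_eq: "u = s" if "subspace u" "y \<subseteq> u" "z \<subseteq> u" "card u = q * card z" for u
    unfolding s_def using that v sub by (intro ext_eq[symmetric]) auto
  have mid_wz: "card (mid w z) = q + 1"
    by (rule card_mid) (use sub card cw in \<open>auto simp: w_def\<close>)
  have RRL: "paths_RRL y z = {w} \<times> mid w z"
  proof (intro set_eqI iffI)
    fix p assume "p \<in> paths_RRL y z"
    then obtain u1 u2 where p: "p = (u1, u2)" and c: "cov u1 y" "cov u1 u2" "cov u2 z"
      by (auto simp: paths_RRL_def)
    have "u1 = w"
    proof (rule card_subset_eq)
      show "u1 \<subseteq> w" using c by (auto simp: cov_def w_def)
      show "card u1 = card w" using c cw q_ge_2 by (auto simp: cov_def)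
    qed simp
    then show "p \<in> {w} \<times> mid w z" using p c cov_mid_iff[OF wP z] card cw by auto
  next
    fix p assume "p \<in> {w} \<times> mid w z"
    moreover have "cov w y" using cw sub y by (intro covI) (auto simp: w_def)
    ultimately show "p \<in> paths_RRL y z"
      using cov_mid_iff[OF wP z] card cw by (auto simp: paths_RRL_def)
  qed
  have mid_card: "card u = card y" "subspace u" "u \<subseteq> z" "w \<subset> u" if "u \<in> mid w z" for u
    using that cw by (auto simp: mid_def)
  have RLR: "paths_RLR y z = (\<lambda>u. (ext u v, u)) ` {u \<in> mid w z. ext u v \<in> P}"
  proof (intro set_eqI iffI)
    fix p assume "p \<in> paths_RLR y z"
    then obtain u1 u2 where p: "p = (u1, u2)" and c: "cov y u1" "cov u2 u1" "cov u2 z"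
      by (auto simp: paths_RLR_def)
    have u: "subspace u1" "subspace u2" "card u1 = q * card y" "y \<subset> u1" "u2 \<subset> u1" "u2 \<subset> z"
      "card u1 = q * card u2" "u1 \<in> P" "u2 \<in> P"
      using c by (auto simp: cov_def P_subspace)
    have cu: "card u2 = card y" using u q_ge_2 by simp
    have "\<not> u2 \<subseteq> y" using cu card_subset_eq[of y u2] u nsub by auto
    then have "card u2 = q * card (u2 \<inter> y)"
      using u by (intro card_inter_hyperplane[OF sub(1) u(1) _ u(3) u(2)]) auto
    then have "card (u2 \<inter> y) = card w" using cu cw q_ge_2 by simp
    moreover have "u2 \<inter> y \<subseteq> w" using u by (auto simp: w_def)
    ultimately have "u2 \<inter> y = w" by (intro card_subset_eq) auto
    then have "u2 \<in> mid w z" using u cu cw nsub \<open>\<not> u2 \<subseteq> y\<close> by (auto simp: mid_def)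
    moreover have "ext u2 v = u1" using u v by (intro ext_eq) auto
    ultimately show "p \<in> (\<lambda>u. (ext u v, u)) ` {u \<in> mid w z. ext u v \<in> P}" using p u by auto
  next
    fix p assume "p \<in> (\<lambda>u. (ext u v, u)) ` {u \<in> mid w z. ext u v \<in> P}"
    then obtain u where p: "p = (ext u v, u)" and u: "u \<in> mid w z" "ext u v \<in> P" by blast
    note m = mid_card[OF u(1)]
    have c: "card (ext u v) = q * card u" using m v by (intro card_ext) auto
    have "y \<subseteq> ext u v"
      unfolding y_eq[symmetric] using m ext_sup[of u v] ext_mem[of v u]
      by (intro ext_least ext_subspace) auto
    then have "cov y (ext u v)" using u c m sub by (intro covI) auto
    moreover have "cov u (ext u v)" using u c m ext_sup by (intro covI) auto
    moreover have "cov u z" using m card z by (intro covI) auto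
    ultimately show "p \<in> paths_RLR y z" using p by (simp add: paths_RLR_def)
  qed
  have card_RLR: "card (paths_RLR y z) = card {u \<in> mid w z. ext u v \<in> P}"
    unfolding RLR by (rule card_image) (simp add: inj_on_def)
  have LRR_s: "u2 = s" if "cov y u1" "cov u1 u2" "cov z u2" for u1 u2
    using that by (intro s_eq) (auto simp: cov_def P_subspace)
  show ?thesis
  proof (cases "s \<in> P")
    case True
    have cs: "cov z s" using True s sub by (intro covI) auto
    have "paths_LRR y z = (\<lambda>u. (u, s)) ` mid y s"
      using cov_mid_iff[OF y True] s card cs LRR_s by (auto simp: paths_LRR_def)
    then have "card (paths_LRR y z) = card (mid y s)" by (simp add: card_image inj_on_def)
    also have "\<dots> = q + 1" by (rule card_mid) (use s sub ys card in auto)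
    finally have L: "card (paths_LRR y z) = q + 1" .
    have "ext u v \<in> P" if "u \<in> mid w z" for u
      using mid_card[OF that] v ys s by (intro P_mono[OF True] ext_subspace ext_least) auto
    then have "{u \<in> mid w z. ext u v \<in> P} = mid w z" by blast
    then show ?thesis unfolding L card_RLR RRL using mid_wz by (simp add: card_cartesian_product)
  next
    case False
    have "paths_LRR y z = {}"
    proof -
      have "u2 \<in> P" if "cov z u2" for u2 using that by (simp add: cov_def)
      then show ?thesis using LRR_s False unfolding paths_LRR_def by blast
    qed
    moreover have "\<exists>bad \<in> mid w z. {u \<in> mid w z. ext u v \<in> P} = mid w z - {bad}"
    proof -
      obtain t where t: "t \<in> s" "t \<in> h" "t \<noteq> 0" using False s by (auto simp: P_iff)
      obtain k where k: "t - smul k v \<in> z" using t ext_iff[OF sub(2)] unfolding s_def by blast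
      define z0 where "z0 = t - smul k v"
      have t_eq: "t = smul k v + z0" by (simp add: z0_def)
      have k0: "k \<noteq> 0"
      proof
        assume "k = 0"
        then have "t \<in> z" using k by simp
        then show False using t z by (auto simp: P_iff)
      qed
      have z0: "z0 \<in> z" using k by (simp add: z0_def)
      have z0w: "z0 \<notin> w"
      proof
        assume "z0 \<in> w"
        then have "t \<in> y" unfolding t_eq using v sub by (intro subspace_add subspace_scale) (auto simp: w_def)
        then show False using t y by (auto simp: P_iff)
      qed
      \<comment> \<open>The component \<open>z0\<close> in \<open>z\<close> of a vector
        \<open>t\<close> of \<open>h\<close> determines the excluded subspace: together with
        \<open>v\<close> it recovers \<open>t\<close>.\<close>
      define bad where "bad = ext w z0"
      have bad_card: "card bad = q * card w" using card_ext[OF sub(3) z0w] by (simp add: bad_def)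
      have bad_z: "bad \<subseteq> z" unfolding bad_def using z0 by (intro ext_least sub) (auto simp: w_def)
      have bad_mid: "bad \<in> mid w z"
      proof -
        have "bad \<noteq> z" using bad_card card cw wpos q_ge_2 by auto
        moreover have "w \<noteq> bad" using z0w ext_mem[of z0 w] by (auto simp: bad_def)
        ultimately show ?thesis
          using bad_card bad_z ext_sup[of w z0] ext_subspace by (auto simp: mid_def bad_def)
      qed
      have "ext bad v \<notin> P"
      proof
        assume "ext bad v \<in> P"
        moreover have "t \<in> ext bad v"
          unfolding t_eq using ext_mem[of v bad] ext_sup[of bad v] ext_mem[of z0 w]
          by (intro subspace_add subspace_scale ext_subspace) (auto simp: bad_def)
        ultimately show False using t by (auto simp: P_iff)
      qed
      moreover have "u = bad" if u: "u \<in> mid w z" "ext u v \<notin> P" for u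
      proof -
        note m = mid_card[OF u(1)]
        obtain t' where t': "t' \<in> ext u v" "t' \<in> h" "t' \<noteq> 0"
          using u ext_subspace by (auto simp: P_iff)
        obtain k' where k': "t' - smul k' v \<in> u" using t' ext_iff[OF m(2)] by blast
        define z' where "z' = t' - smul k' v"
        have z': "z' \<in> u" "z' \<in> z" using k' m by (auto simp: z'_def)
        have k'0: "k' \<noteq> 0"
        proof
          assume "k' = 0"
          then have "t' \<in> z" using k' m by auto
          then show False using t' z by (auto simp: P_iff)
        qed
        \<comment> \<open>The combination eliminates \<open>v\<close>, so it lies in both
          \<open>h\<close> and \<open>z\<close> and is zero. This is why the excluded subspace is
          unique.\<close>
        have e: "smul k' t - smul k t' = smul k' z0 - smul k z'"
          by (simp add: z'_def z0_def scale_right_diff_distrib mult.commute)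
        have "smul k' t - smul k t' \<in> h" using t t' h by (intro subspace_diff subspace_scale) auto
        moreover have "smul k' z0 - smul k z' \<in> z" using z0 z' sub by (intro subspace_diff subspace_scale) auto
        ultimately have "smul k' z0 - smul k z' = 0" using e z by (auto simp: P_iff)
        then have "smul k' z0 = smul k z'" by simp
        then have "smul (inverse k') (smul k' z0) = smul (inverse k') (smul k z')" by simp
        then have "z0 = smul (inverse k') (smul k z')" using k'0 by simp
        then have "z0 \<in> u" using z' m by (simp add: subspace_scale)
        then have "bad = u" unfolding bad_def using m z0w sub cw by (intro ext_eq) auto
        then show "u = bad" by simp
      qed
      ultimately show ?thesis using bad_mid by blast
    qed
    then obtain bad where "bad \<in> mid w z" "{u \<in> mid w z. ext u v \<in> P} = mid w z - {bad}" by blast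
    then have "card {u \<in> mid w z. ext u v \<in> P} = q" using mid_wz by simp
    ultimately show ?thesis unfolding card_RLR RRL using mid_wz by (simp add: card_cartesian_product)
  qed
qed

text \<open>A path of any of the three kinds produces a subspace of index \<open>q\<close> in
  \<open>y\<close> that is contained in \<open>z\<close>.\<close>

lemma paths_none:
  assumes y: "y \<in> P" and z: "z \<in> P" and card: "card z = q * card y" and nsub: "\<not> y \<subseteq> z"
    and int: "card y \<noteq> q * card (y \<inter> z)"
  shows "paths_LRR y z = {}" "paths_RLR y z = {}" "paths_RRL y z = {}"
proof -
  have sub: "subspace y" "subspace z" "subspace (y \<inter> z)"
    using y z by (auto simp: P_subspace subspace_inter)
  have no: False if "subspace x" "x \<subseteq> y \<inter> z" "card y = q * card x" for x
    using no_between[OF that(1) sub(3,1) that(2) _ that(3)] that(3) int nsub by auto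
  show "paths_LRR y z = {}"
  proof -
    have False if "cov y u1" "cov u1 u2" "cov z u2" for u1 u2
      using card_inter_hyperplane[of z u2 y] that sub nsub int by (auto simp: cov_def P_subspace)
    then show ?thesis by (auto simp: paths_LRR_def)
  qed
  show "paths_RRL y z = {}"
  proof -
    have False if "cov u1 y" "cov u1 u2" "cov u2 z" for u1 u2
      using that by (intro no[of u1]) (auto simp: cov_def P_subspace)
    then show ?thesis by (auto simp: paths_RRL_def)
  qed
  show "paths_RLR y z = {}"
  proof -
    have False if c: "cov y u1" "cov u2 u1" "cov u2 z" for u1 u2
    proof -
      have u: "subspace u1" "subspace u2" "card u1 = q * card y" "y \<subset> u1" "u2 \<subset> u1" "u2 \<subset> z"
        "card u1 = q * card u2"
        using c by (auto simp: cov_def P_subspace)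
      have cu: "card u2 = card y" using u q_ge_2 by simp
      have "\<not> u2 \<subseteq> y" using cu card_subset_eq[of y u2] u nsub by auto
      then have "card u2 = q * card (u2 \<inter> y)"
        using u by (intro card_inter_hyperplane[OF sub(1) u(1) _ u(3) u(2)]) auto
      then show False using u cu sub by (intro no[of "u2 \<inter> y"]) (auto simp: subspace_inter)
    qed
    then show ?thesis by (auto simp: paths_RLR_def)
  qed
qed

text \<open>The cubic relation entry by entry, with the negative terms moved across so that it is an
  equation of natural numbers.\<close>

theorem path_counts:
  assumes y: "y \<in> P" and z: "z \<in> P" and card: "card z = q * card y" and e: "e * card z = CARD('v)"
  shows "card (paths_LRR y z) + q * card (paths_RRL y z) + (q + 1) * (if cov y z then e else 0)
    = (q + 1) * card (paths_RLR y z)"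
proof (cases "y \<subseteq> z")
  case True
  then have c: "cov y z" using assms by (intro covI) (auto simp: P_subspace)
  have "y \<in> hyp z" using True card y by (simp add: hyp_def P_subspace)
  then have H: "card (hyp z) = 1 + q * card (hyp y)" using z by (intro card_hyp) (auto simp: P_subspace)
  have R: "card (paths_RLR y z) = q * card (hyp y) + card (up z) + e"
    using paths_below(2)[OF c] H card_up_diff[OF c e] by simp
  show ?thesis unfolding paths_below(1,3)[OF c] R using c by (simp add: algebra_simps)
next
  case False
  then have "\<not> cov y z" by (auto simp: cov_def)
  then show ?thesis using paths_above[OF y z card False] paths_none[OF y z card False]
    by (cases "card y = q * card (y \<inter> z)") auto
qed

end

section \<open>Eigenvectors\<close>

text \<open>The polynomial evaluated at \<open>B\<close> and applied to \<open>w\<close>, by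
  Horner's scheme.\<close>

definition poly_act :: "complex^'n^'n \<Rightarrow> complex poly \<Rightarrow> complex^'n \<Rightarrow> complex^'n" where
  "poly_act B p w = fold_coeffs (\<lambda>a v. a *s w + B *v v) p 0"

lemma poly_act_0: "poly_act B 0 w = 0"
  by (simp add: poly_act_def)

lemma poly_act_pCons: "poly_act B (pCons a p) w = a *s w + B *v poly_act B p w"
  by (cases "p = 0 \<and> a = 0") (auto simp: poly_act_def)

lemma poly_act_add: "poly_act B (p + p') w = poly_act B p w + poly_act B p' w"
proof (induction p p' rule: poly_induct2)
  case (pCons a p b p')
  show ?case
    unfolding add_pCons poly_act_pCons pCons matrix_vector_right_distrib
    by (simp add: vec_eq_iff algebra_simps)
qed (simp add: poly_act_0)

lemma poly_act_smult: "poly_act B (smult e p) w = e *s poly_act B p w"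
proof (induction p)
  case (pCons a p)
  have "e *s (a *s w + B *v poly_act B p w) = (e * a) *s w + B *v (e *s poly_act B p w)"
    by (simp add: vec_eq_iff distrib_left mult.assoc vector_scalar_commute)
  then show ?case by (simp only: smult_pCons poly_act_pCons pCons)
qed (simp add: poly_act_0)

lemma poly_act_sum: "poly_act B (\<Sum>i\<in>S. f i) w = (\<Sum>i\<in>S. poly_act B (f i) w)"
  by (induction S rule: infinite_finite_induct) (auto simp: poly_act_0 poly_act_add)

lemma poly_act_monom: "poly_act B (monom a k) w = a *s ((*v) B ^^ k) w"
  by (induction k) (simp_all add: monom_0 monom_Suc poly_act_pCons poly_act_0 vector_scalar_commute)

lemma poly_act_linear_factor:
  "poly_act B ([:- e, 1:] * p) w = B *v poly_act B p w - e *s poly_act B p w"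
proof -
  have "[:- e, 1:] * p = pCons 0 p + smult (- e) p" by simp
  then show ?thesis
    by (simp only: poly_act_add poly_act_smult poly_act_pCons) (simp add: vec_eq_iff)
qed

lemma poly_act_in:
  assumes "vec.subspace S" "\<And>v. v \<in> S \<Longrightarrow> B *v v \<in> S" "w \<in> S"
  shows "poly_act B p w \<in> S"
  using assms
  by (induction p) (auto simp: poly_act_0 poly_act_pCons intro: vec.subspace_add vec.subspace_scale vec.subspace_0)

text \<open>The \<open>CARD('n) + 1\<close> vectors obtained from \<open>w\<close> by powers of
  \<open>B\<close> are dependent. A repetition among them is invisible to dependence of a set and is
  treated separately.\<close>

lemma ex_annihilating_poly:
  fixes B :: "complex^'n^'n"
  shows "\<exists>p. p \<noteq> 0 \<and> poly_act B p w = 0"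
proof -
  define f where "f k = ((*v) B ^^ k) w" for k
  define n where "n = CARD('n)"
  show ?thesis
  proof (cases "inj_on f {..n}")
    case True
    have "vec.dependent (f ` {..n})"
      using vec.independent_card_le_dim[of "f ` {..n}" UNIV] card_image[OF True]
      by (auto simp: vec_dim_card n_def simp del: vec.dim_UNIV)
    then obtain e x where x: "x \<in> f ` {..n}" "e x \<noteq> 0" and s: "(\<Sum>x\<in>f ` {..n}. e x *s x) = 0"
      by (auto simp: vec.dependent_finite)
    define p where "p = (\<Sum>k\<le>n. monom (e (f k)) k)"
    obtain j where j: "j \<le> n" "x = f j" using x by auto
    have "coeff p j = e (f j)" using j by (simp add: p_def coeff_sum)
    then have "p \<noteq> 0" using x j by auto
    moreover have "poly_act B p w = 0"
      using s by (simp add: p_def poly_act_sum poly_act_monom f_def[symmetric] sum.reindex[OF True])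
    ultimately show ?thesis by blast
  next
    case False
    then obtain i j where ij: "f i = f j" "i \<noteq> j" by (auto simp: inj_on_def)
    define p where "p = monom (1 :: complex) i + monom (-1) j"
    have "coeff p i \<noteq> 0" using ij by (simp add: p_def)
    then have "p \<noteq> 0" by auto
    moreover have "poly_act B p w = 0"
      using ij by (simp add: p_def poly_act_add poly_act_monom f_def)
    ultimately show ?thesis by blast
  qed
qed

text \<open>Linear factors of a polynomial annihilating \<open>w\<close> are split off until the
  remaining one no longer annihilates \<open>w\<close>; its value at \<open>w\<close> is then an
  eigenvector.\<close>

lemma ex_eigenvector:
  fixes B :: "complex^'n^'n"
  assumes S: "vec.subspace S" "S \<noteq> {0}" and inv: "\<And>v. v \<in> S \<Longrightarrow> B *v v \<in> S"
  shows "\<exists>v\<in>S. v \<noteq> 0 \<and> (\<exists>e. B *v v = e *s v)"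
proof -
  obtain w where w: "w \<in> S" "w \<noteq> 0" using S vec.subspace_0 by blast
  obtain p where "p \<noteq> 0" "poly_act B p w = 0" using ex_annihilating_poly by blast
  then show ?thesis
  proof (induction "degree p" arbitrary: p rule: less_induct)
    case less
    show ?case
    proof (cases "degree p = 0")
      case True
      then obtain a where "p = [:a:]" by (rule degree_eq_zeroE)
      then show ?thesis using less w by (simp add: poly_act_pCons poly_act_0)
    next
      case False
      then have "\<not> constant (poly p)" by (simp add: constant_degree)
      then obtain e where "poly p e = 0" using fundamental_theorem_of_algebra by blast
      then obtain p' where p': "p = [:- e, 1:] * p'" using poly_eq_0_iff_dvd[of p e] unfolding dvd_def by blast
      have nz: "p' \<noteq> 0" using p' less by auto
      have eq: "B *v poly_act B p' w - e *s poly_act B p' w = 0"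
        using less.prems(2) unfolding p' poly_act_linear_factor .
      show ?thesis
      proof (cases "poly_act B p' w = 0")
        case True
        have "degree p = Suc (degree p')" unfolding p' using nz degree_mult_eq[of "[:- e, 1:]" p'] by simp
        then show ?thesis using less.hyps[OF _ nz True] by simp
      next
        case False
        then show ?thesis using eq poly_act_in[OF S(1) inv w(1)] by (metis eq_iff_diff_eq_0)
      qed
    qed
  qed
qed

section \<open>The raising and lowering matrices\<close>

lemma sum_of_bool_pairs:
  "(\<Sum>u1\<in>UNIV. \<Sum>u2\<in>UNIV. of_bool (Q u1 u2)) = (of_nat (card {(u1 :: 'a :: finite, u2 :: 'b :: finite). Q u1 u2}) :: complex)"
proof -
  have "(\<Sum>u1\<in>UNIV. \<Sum>u2\<in>UNIV. of_bool (Q u1 u2)) = (\<Sum>p\<in>UNIV. of_bool (p \<in> {(u1, u2). Q u1 u2}) :: complex)"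
    unfolding UNIV_Times_UNIV[symmetric] sum.cartesian_product by (simp add: case_prod_unfold)
  also have "\<dots> = of_nat (card {(u1, u2). Q u1 u2})" by simp
  finally show ?thesis .
qed

context attenuated_space
begin

abbreviation "R \<equiv> R_mat smul h"
abbreviation "L \<equiv> L_mat smul h"

lemma R_nth: "R $ x $ y = of_bool (cov y x)" and L_nth: "L $ x $ y = of_bool (cov x y)"
  by (simp_all add: R_mat_def L_mat_def covers_iff)

lemma LRR_nth: "(L ** R ** R) $ z $ y = of_nat (card (paths_LRR y z))"
proof -
  have "(L ** R ** R) $ z $ y = (\<Sum>u1\<in>UNIV. \<Sum>u2\<in>UNIV. of_bool (cov y u1 \<and> cov u1 u2 \<and> cov z u2))"
    unfolding matrix_matrix_mult_def vec_lambda_beta sum_distrib_right R_nth L_nth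
    by (intro sum.cong refl) (auto simp: of_bool_def)
  then show ?thesis by (simp only: sum_of_bool_pairs paths_LRR_def)
qed

lemma RLR_nth: "(R ** L ** R) $ z $ y = of_nat (card (paths_RLR y z))"
proof -
  have "(R ** L ** R) $ z $ y = (\<Sum>u1\<in>UNIV. \<Sum>u2\<in>UNIV. of_bool (cov y u1 \<and> cov u2 u1 \<and> cov u2 z))"
    unfolding matrix_matrix_mult_def vec_lambda_beta sum_distrib_right R_nth L_nth
    by (intro sum.cong refl) (auto simp: of_bool_def)
  then show ?thesis by (simp only: sum_of_bool_pairs paths_RLR_def)
qed

lemma RRL_nth: "(R ** R ** L) $ z $ y = of_nat (card (paths_RRL y z))"
proof -
  have "(R ** R ** L) $ z $ y = (\<Sum>u1\<in>UNIV. \<Sum>u2\<in>UNIV. of_bool (cov u1 y \<and> cov u1 u2 \<and> cov u2 z))"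
    unfolding matrix_matrix_mult_def vec_lambda_beta sum_distrib_right R_nth L_nth
    by (intro sum.cong refl) (auto simp: of_bool_def)
  then show ?thesis by (simp only: sum_of_bool_pairs paths_RRL_def)
qed

text \<open>Where the entry of \<open>R\<close> is nonzero, \<open>z\<close> covers
  \<open>y\<close>, so \<open>of_nat q * of_nat (card y)\<close> is the size of \<open>z\<close> and
  the quotient is the number \<open>e\<close> of \<open>path_counts\<close>. For pairs not on
  consecutive levels both sides are zero.\<close>

lemma relation_nth:
  "(L ** R ** R) $ z $ y - (of_nat q + 1) * (R ** L ** R) $ z $ y + of_nat q * (R ** R ** L) $ z $ y
    = - (of_nat q + 1) * (of_nat CARD('v) / (of_nat q * of_nat (card y))) * R $ z $ y"
proof (cases "y \<in> P \<and> z \<in> P \<and> card z = q * card y")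
  case True
  have dle: "dim z \<le> dim (UNIV :: 'v set)" 
  proof -
    obtain B where B: "B \<subseteq> z" "independent B" "z \<subseteq> span B" "card B = dim z"
      by (rule basis_exists)
    have "card (UNIV :: 'v set) = q ^ dim (UNIV :: 'v set)" by (rule card_subspace) simp
    moreover have "card z = q ^ dim z" using True by (intro card_subspace) (simp add: P_subspace)
    moreover have "card z \<le> card (UNIV :: 'v set)" by (rule card_mono) auto
    ultimately show ?thesis using q_ge_2 by simp
  qed
  define e where "e = q ^ (dim (UNIV :: 'v set) - dim z)"
  have e: "e * card z = CARD('v)"
    using True dle card_subspace[of z] card_subspace[of "UNIV :: 'v set"]
    by (simp add: P_subspace e_def power_add[symmetric])
  have z0: "card z > 0" using True by (intro card_pos) (simp add: P_subspace)
  have "of_nat q * of_nat (card y) = (of_nat (card z) :: complex)" using True by simp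
  moreover have "of_nat CARD('v) = of_nat e * (of_nat (card z) :: complex)"
    unfolding e[symmetric] by (rule of_nat_mult)
  moreover have "(of_nat (card z) :: complex) \<noteq> 0" using z0 by auto
  ultimately have ec: "of_nat CARD('v) / (of_nat q * of_nat (card y)) = (of_nat e :: complex)"
    by (metis nonzero_mult_div_cancel_right)
  have "of_nat (card (paths_LRR y z) + q * card (paths_RRL y z) + (q + 1) * (if cov y z then e else 0))
    = (of_nat ((q + 1) * card (paths_RLR y z)) :: complex)"
    using path_counts[OF _ _ _ e] True by simp
  then show ?thesis unfolding LRR_nth RLR_nth RRL_nth R_nth ec
    by (cases "cov y z") (simp_all add: algebra_simps)
next
  case False
  have "paths_LRR y z = {}"
  proof -
    have "y \<in> P \<and> z \<in> P \<and> card z = q * card y" if "cov y u1" "cov u1 u2" "cov z u2" for u1 u2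
      using that q_ge_2 by (simp add: cov_def)
    then show ?thesis using False unfolding paths_LRR_def by blast
  qed
  moreover have "paths_RLR y z = {}"
  proof -
    have "y \<in> P \<and> z \<in> P \<and> card z = q * card y" if "cov y u1" "cov u2 u1" "cov u2 z" for u1 u2
      using that q_ge_2 by (simp add: cov_def)
    then show ?thesis using False unfolding paths_RLR_def by blast
  qed
  moreover have "paths_RRL y z = {}"
  proof -
    have "y \<in> P \<and> z \<in> P \<and> card z = q * card y" if "cov u1 y" "cov u1 u2" "cov u2 z" for u1 u2
      using that q_ge_2 by (simp add: cov_def)
    then show ?thesis using False unfolding paths_RRL_def by blast
  qed
  moreover have "\<not> cov y z" using False by (simp add: cov_def)
  ultimately show ?thesis by (simp add: LRR_nth RLR_nth RRL_nth R_nth)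
qed

section \<open>Vectors supported on one level\<close>

definition level_vecs where "level_vecs j = {w :: complex^('v set). \<forall>y. w $ y \<noteq> 0 \<longrightarrow> y \<in> att_level smul h j}"

lemma level_iff: "y \<in> att_level smul h j \<longleftrightarrow> y \<in> P \<and> card y = q ^ j"
proof -
  have "card y = q ^ j \<longleftrightarrow> dim y = j" if "y \<in> P"
    using card_subspace[of y] that q_ge_2 by (simp add: P_subspace)
  then show ?thesis by (auto simp: att_level_def)
qed

lemma level_unique: "y \<in> att_level smul h i \<Longrightarrow> y \<in> att_level smul h j \<Longrightarrow> i = j"
  by (simp add: att_level_def)

lemma cov_level: "cov x y \<Longrightarrow> y \<in> att_level smul h (Suc j) \<longleftrightarrow> x \<in> att_level smul h j"
  using q_ge_2 by (auto simp: level_iff cov_def)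

lemma subspace_level_vecs: "vec.subspace (level_vecs j)"
proof (unfold vec.subspace_def, intro conjI allI ballI)
  show "0 \<in> level_vecs j" by (simp add: level_vecs_def)
next
  fix v w assume "v \<in> level_vecs j" "w \<in> level_vecs j"
  then show "v + w \<in> level_vecs j" unfolding level_vecs_def
    by simp (metis add.right_neutral)
next
  fix e v assume "v \<in> level_vecs j"
  then show "e *s v \<in> level_vecs j" by (simp add: level_vecs_def)
qed

lemma R_level:
  assumes "w \<in> level_vecs j"
  shows "R *v w \<in> level_vecs (Suc j)"
  unfolding level_vecs_def
proof (intro CollectI allI impI)
  fix z assume "(R *v w) $ z \<noteq> 0"
  then obtain y where "R $ z $ y * w $ y \<noteq> 0"
    unfolding matrix_vector_mult_def by (auto elim: sum.not_neutral_contains_not_neutral)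
  then show "z \<in> att_level smul h (Suc j)"
    using assms cov_level[of y z j] by (auto simp: R_nth level_vecs_def)
qed

lemma L_level:
  assumes "w \<in> level_vecs (Suc j)"
  shows "L *v w \<in> level_vecs j"
  unfolding level_vecs_def
proof (intro CollectI allI impI)
  fix z assume "(L *v w) $ z \<noteq> 0"
  then obtain y where "L $ z $ y * w $ y \<noteq> 0"
    unfolding matrix_vector_mult_def by (auto elim: sum.not_neutral_contains_not_neutral)
  then show "z \<in> att_level smul h j"
    using assms cov_level[of z y j] by (auto simp: L_nth level_vecs_def)
qed

lemma L_level_0:
  assumes "w \<in> level_vecs 0"
  shows "L *v w = 0"
proof -
  have "L $ z $ y * w $ y = 0" for z y
  proof (rule ccontr)
    assume "L $ z $ y * w $ y \<noteq> 0"
    then have "cov z y" "y \<in> att_level smul h 0" using assms by (auto simp: L_nth level_vecs_def)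
    then have "q * card z = 1" by (simp add: cov_def level_iff)
    then show False using q_ge_2 by simp
  qed
  then have "(\<Sum>y\<in>UNIV. L $ z $ y * w $ y) = 0" for z by (intro sum.neutral) blast
  then show ?thesis by (simp add: vec_eq_iff matrix_vector_mult_def)
qed

lemma F_nth: "(F_mat smul h i *v w) $ y = (if y \<in> att_level smul h i then w $ y else 0)"
proof -
  have "(F_mat smul h i *v w) $ y = (\<Sum>z\<in>UNIV. if z = y then (if y \<in> att_level smul h i then w $ y else 0) else 0)"
    unfolding matrix_vector_mult_def vec_lambda_beta by (rule sum.cong) (auto simp: F_mat_def)
  then show ?thesis by simp
qed

lemma F_in_level: "F_mat smul h i *v w \<in> level_vecs i"
  by (simp add: level_vecs_def F_nth)

lemma F_level: "w \<in> level_vecs j \<Longrightarrow> F_mat smul h i *v w = (if i = j then w else 0)"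
  using level_unique by (auto simp: vec_eq_iff F_nth level_vecs_def)

lemma relation_level:
  assumes w: "w \<in> level_vecs j"
  shows "L *v (R *v (R *v w)) = (of_nat q + 1) *s (R *v (L *v (R *v w))) - of_nat q *s (R *v (R *v (L *v w)))
     - ((of_nat q + 1) * (of_nat CARD('v) / (of_nat q * of_nat q ^ j))) *s (R *v w)"
proof (unfold vec_eq_iff, rule allI)
  fix z
  define e :: complex where "e = (of_nat q + 1) * (of_nat CARD('v) / (of_nat q * of_nat q ^ j))"
  have 1: "((L ** R ** R) $ z $ y - (of_nat q + 1) * (R ** L ** R) $ z $ y + of_nat q * (R ** R ** L) $ z $ y
     + e * R $ z $ y) * w $ y = 0" for y
  proof (cases "w $ y = 0")
    case False
    then have "y \<in> att_level smul h j" using w by (simp add: level_vecs_def)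
    then have "(of_nat (card y) :: complex) = of_nat q ^ j" by (simp add: level_iff)
    then show ?thesis unfolding relation_nth e_def
      by (simp only: mult_minus_left add.left_inverse mult_zero_left)
  qed simp
  have "((L ** R ** R) *v w) $ z - (of_nat q + 1) * ((R ** L ** R) *v w) $ z + of_nat q * ((R ** R ** L) *v w) $ z
      + e * (R *v w) $ z = 0"
    using sum.neutral[of UNIV, OF ballI, OF 1]
    unfolding matrix_vector_mult_def vec_lambda_beta
    by (simp add: sum_distrib_left ring_distribs sum.distrib sum_subtractf mult.assoc)
  then show "(L *v (R *v (R *v w))) $ z = ((of_nat q + 1) *s (R *v (L *v (R *v w))) - of_nat q *s (R *v (R *v (L *v w)))
     - ((of_nat q + 1) * (of_nat CARD('v) / (of_nat q * of_nat q ^ j))) *s (R *v w)) $ z"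
    unfolding e_def[symmetric] by (simp add: matrix_vector_mul_assoc matrix_mul_assoc algebra_simps)
qed

end

section \<open>Modules of the algebra T\<close>

lemma mat_scale_vec: "(e *m B) *v w = e *s (B *v w)"
  by (simp add: vec_eq_iff mat_scale_def matrix_vector_mult_def sum_distrib_left mult.assoc)

lemma mat_sum_vec: "(\<Sum>i\<in>S. B i) *v w = (\<Sum>i\<in>S. B i *v w)"
  by (induction S rule: infinite_finite_induct) (simp_all add: matrix_vector_mult_add_rdistrib)

lemma sum_single_vec:
  assumes "finite S" "j \<in> S" "\<And>i. i \<in> S \<Longrightarrow> i \<noteq> j \<Longrightarrow> f i = 0"
  shows "sum f S = f j"
proof -
  have "sum f S = sum f {j}" by (rule sum.mono_neutral_right) (use assms in auto)
  then show ?thesis by simp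
qed

lemma mat_id_on_vec:
  assumes "w \<in> vecs_on S"
  shows "mat_id_on S *v w = w"
proof (unfold vec_eq_iff, rule allI)
  fix x
  have "(mat_id_on S *v w) $ x = (\<Sum>y\<in>UNIV. if y = x then w $ x else 0)"
    unfolding matrix_vector_mult_def vec_lambda_beta
    by (rule sum.cong) (use assms in \<open>auto simp: mat_id_on_def vecs_on_def\<close>)
  then show "(mat_id_on S *v w) $ x = w $ x" by simp
qed

lemma mats_on_mult:
  assumes "B \<in> mats_on S" "C \<in> mats_on S"
  shows "B ** C \<in> mats_on S"
  unfolding mats_on_def
proof (intro CollectI allI impI)
  fix x y assume "(B ** C) $ x $ y \<noteq> 0"
  then obtain z where "B $ x $ z * C $ z $ y \<noteq> 0"
    unfolding matrix_matrix_mult_def vec_lambda_beta by (auto elim: sum.not_neutral_contains_not_neutral)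
  then show "x \<in> S \<and> y \<in> S" using assms by (auto simp: mats_on_def)
qed

locale attenuated_space_dims = attenuated_space +
  fixes N M :: nat
  assumes dim_UNIV: "dim (UNIV :: 'b set) = N + M" and dim_h: "dim h = M"
begin

abbreviation "F \<equiv> F_mat smul h"

definition level_mat where "level_mat k = (\<Sum>i=0..N. k i *m F i)"

lemma dim_le: "x \<in> P \<Longrightarrow> dim x \<le> N"
  using att_poset_dim_le[OF vector_space_axioms dim_UNIV h dim_h] .

lemma level_mat_vec: "level_mat k *v w = (\<Sum>i=0..N. k i *s (F i *v w))"
  by (simp add: level_mat_def mat_sum_vec mat_scale_vec)

lemma level_mat_level:
  assumes "w \<in> level_vecs j" "j \<le> N"
  shows "level_mat k *v w = k j *s w"
  unfolding level_mat_vec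
  by (subst sum_single_vec[of _ j]) (use assms in \<open>auto simp: F_level\<close>)

lemma level_decompose:
  assumes "w \<in> vecs_on P"
  shows "w = (\<Sum>i=0..N. F i *v w)"
proof (unfold vec_eq_iff, rule allI)
  fix y
  show "w $ y = (\<Sum>i=0..N. F i *v w) $ y"
  proof (cases "y \<in> P")
    case True
    then have "(\<Sum>i=0..N. (F i *v w) $ y) = (F (dim y) *v w) $ y"
      using dim_le by (intro sum_single_vec) (auto simp: F_nth att_level_def)
    then show ?thesis using True by (simp add: F_nth att_level_def)
  next
    case False
    then have 0: "w $ y = 0" using assms by (auto simp: vecs_on_def)
    then have "(F i *v w) $ y = 0" for i by (simp add: F_nth)
    then show ?thesis using 0 by simp
  qed
qed

lemma level_vecs_high: "N < j \<Longrightarrow> w \<in> level_vecs j \<Longrightarrow> w = 0"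
  using dim_le by (force simp: level_vecs_def vec_eq_iff att_level_def)

lemma K_eq: "K_mat smul h N M = level_mat (\<lambda>i. of_nat q ^ (N + M - i))"
  by (simp add: K_mat_def level_mat_def q_def)

lemma K_inv_eq: "mat_inv_on P (K_mat smul h N M) = level_mat (\<lambda>i. inverse (of_nat q ^ (N + M - i)))"
  unfolding level_mat_def using mat_inv_on_K_mat[OF vector_space_axioms dim_UNIV h dim_h]
  by (simp add: q_def)

lemma generators_on:
  "R \<in> mats_on P" "L \<in> mats_on P" "level_mat k \<in> mats_on P"
proof -
  show "R \<in> mats_on P" "L \<in> mats_on P" by (auto simp: mats_on_def R_nth L_nth cov_def)
  have "level_mat k $ x $ y = 0" if "\<not> (x \<in> P \<and> y \<in> P)" for x y
  proof -
    have "F i $ x $ y = 0" for i using that by (auto simp: F_mat_def att_level_def)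
    then show ?thesis by (simp add: level_mat_def mat_scale_def)
  qed
  then show "level_mat k \<in> mats_on P" by (auto simp: mats_on_def)
qed

text \<open>The matrices that preserve \<open>U\<close> form a subalgebra, so generators suffice.
  Closure under every \<open>level_mat k\<close> covers \<open>K_mat\<close> and its inverse at
  once.\<close>

lemma T_moduleI:
  assumes U: "U \<subseteq> vecs_on P" "vec.subspace U"
    and R: "\<And>w. w \<in> U \<Longrightarrow> R *v w \<in> U" and L: "\<And>w. w \<in> U \<Longrightarrow> L *v w \<in> U"
    and K: "\<And>k w. w \<in> U \<Longrightarrow> level_mat k *v w \<in> U"
  shows "T_module smul h N M U"
proof -
  define S where "S = {B \<in> mats_on P. \<forall>w\<in>U. B *v w \<in> U}"
  have "T_alg smul h N M \<subseteq> S"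
    unfolding T_alg_def
  proof (rule hull_minimal)
    show "{R, L, K_mat smul h N M, mat_inv_on P (K_mat smul h N M)} \<subseteq> S"
      unfolding K_inv_eq unfolding K_eq S_def using R L K generators_on by auto
    show "subalgebra_on P S"
      unfolding subalgebra_on_def
    proof (intro conjI ballI allI)
      show "S \<subseteq> mats_on P" by (auto simp: S_def)
      have "mat_id_on P \<in> mats_on P" by (auto simp: mat_id_on_def mats_on_def)
      moreover have "mat_id_on P *v w = w" if "w \<in> U" for w using mat_id_on_vec that U(1) by blast
      ultimately show "mat_id_on P \<in> S" by (simp add: S_def)
    next
      fix B C assume BC: "B \<in> S" "C \<in> S"
      have "B + C \<in> mats_on P"
        unfolding mats_on_def
      proof (intro CollectI allI impI)
        fix x y assume "(B + C) $ x $ y \<noteq> 0"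
        then have "B $ x $ y \<noteq> 0 \<or> C $ x $ y \<noteq> 0" by auto
        then show "x \<in> P \<and> y \<in> P" using BC by (auto simp: S_def mats_on_def)
      qed
      then show "B + C \<in> S" using BC U(2)
        by (auto simp: S_def matrix_vector_mult_add_rdistrib intro: vec.subspace_add)
      show "B ** C \<in> S" using BC mats_on_mult[of B P C]
        by (auto simp: S_def matrix_vector_mul_assoc[symmetric])
    next
      fix e B assume "B \<in> S"
      then show "e *m B \<in> S" using U(2)
        by (auto simp: S_def mats_on_def mat_scale_vec intro: vec.subspace_scale) (auto simp: mat_scale_def)
    qed
  qed
  then show ?thesis using U unfolding T_module_def S_def by blast
qed

context
  fixes W assumes W: "T_module smul h N M W"
begin

lemma module_subspace: "vec.subspace W" and module_on: "W \<subseteq> vecs_on P"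
  using W by (auto simp: T_module_def)

lemma module_closed:
  assumes "w \<in> W"
  shows "R *v w \<in> W" "L *v w \<in> W" "K_mat smul h N M *v w \<in> W"
proof -
  have "{R, L, K_mat smul h N M, mat_inv_on P (K_mat smul h N M)} \<subseteq> T_alg smul h N M"
    unfolding T_alg_def by (rule hull_subset)
  then show "R *v w \<in> W" "L *v w \<in> W" "K_mat smul h N M *v w \<in> W"
    using W assms by (auto simp: T_module_def)
qed

lemma module_F:
  assumes w: "w \<in> W" and i: "i \<le> N"
  shows "F i *v w \<in> W"
proof -
  define k where "k i = (of_nat q ^ (N + M - i) :: complex)" for i
  have kinj: "k i \<noteq> k j" if "i \<le> N" "j \<le> N" "i \<noteq> j" for i j
  proof -
    have "q ^ (N + M - i) \<noteq> q ^ (N + M - j)" using that q_ge_2 by simp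
    then show ?thesis unfolding k_def using of_nat_eq_iff by (metis of_nat_power)
  qed
  have sub: "(\<Sum>l=0..N. (\<Prod>j\<in>J. k l - k j) *s (F l *v w)) \<in> W" if "finite J" for J
    using that
  proof (induction J)
    case empty
    then show ?case using level_decompose[of w] w module_on by auto
  next
    case (insert j J)
    let ?S = "\<Sum>l=0..N. (\<Prod>j\<in>J. k l - k j) *s (F l *v w)"
    have "K_mat smul h N M *v ?S = (\<Sum>l=0..N. (\<Prod>j\<in>J. k l - k j) *s (k l *s (F l *v w)))"
      unfolding mult_vec_sum K_eq k_def
      by (rule sum.cong) (auto simp: level_mat_level[OF F_in_level])
    then have eq: "(\<Sum>l=0..N. (\<Prod>j\<in>insert j J. k l - k j) *s (F l *v w))
        = K_mat smul h N M *v ?S + (- k j) *s ?S"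
      using insert by (simp add: vec_eq_iff sum_distrib_left sum_negf[symmetric] sum.distrib[symmetric] algebra_simps)
    show ?case unfolding eq
      by (intro vec.subspace_add[OF module_subspace] vec.subspace_scale[OF module_subspace]
          module_closed(3) insert.IH)
  qed
  \<comment> \<open>Lagrange interpolation: the product of all \<open>K - k j\<close> with \<open>j \<noteq> i\<close> is a nonzero multiple of \<open>F i\<close>.\<close>
  define e where "e = (\<Prod>j\<in>{0..N} - {i}. k i - k j)"
  have e: "e \<noteq> 0" using kinj i by (auto simp: e_def)
  have "(\<Sum>l=0..N. (\<Prod>j\<in>{0..N} - {i}. k l - k j) *s (F l *v w)) = e *s (F i *v w)"
    unfolding e_def
  proof (rule sum_single_vec)
    fix l assume "l \<in> {0..N}" "l \<noteq> i"
    then have "(\<Prod>j\<in>{0..N} - {i}. k l - k j) = 0" by (intro prod_zero) auto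
    then show "(\<Prod>j\<in>{0..N} - {i}. k l - k j) *s (F l *v w) = 0" by simp
  qed (use i in auto)
  then have "e *s (F i *v w) \<in> W" using sub[of "{0..N} - {i}"] by simp
  then have "inverse e *s (e *s (F i *v w)) \<in> W" by (rule vec.subspace_scale[OF module_subspace])
  then show ?thesis using e by (simp add: vector_smult_assoc)
qed

lemma support_iff: "i \<in> support_levels smul h N W \<longleftrightarrow> i \<le> N \<and> (\<exists>w\<in>W. F i *v w \<noteq> 0)"
proof -
  have 0: "0 \<in> W" by (rule vec.subspace_0[OF module_subspace])
  have "(\<lambda>w. F i *v w) ` W = {0} \<longleftrightarrow> (\<forall>w\<in>W. F i *v w = 0)"
  proof
    assume "\<forall>w\<in>W. F i *v w = 0"
    then show "(\<lambda>w. F i *v w) ` W = {0}" using 0 by (simp add: image_constant cong: image_cong)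
  qed blast
  then show ?thesis unfolding support_levels_def by simp
qed

lemma support_iff_level:
  "i \<in> support_levels smul h N W \<longleftrightarrow> i \<le> N \<and> (\<exists>w\<in>W \<inter> level_vecs i. w \<noteq> 0)"
proof
  assume "i \<in> support_levels smul h N W"
  then obtain w where "i \<le> N" "w \<in> W" "F i *v w \<noteq> 0" using support_iff by blast
  then show "i \<le> N \<and> (\<exists>w\<in>W \<inter> level_vecs i. w \<noteq> 0)" using module_F F_in_level by blast
next
  assume "i \<le> N \<and> (\<exists>w\<in>W \<inter> level_vecs i. w \<noteq> 0)"
  then obtain w where "i \<le> N" "w \<in> W" "w \<in> level_vecs i" "w \<noteq> 0" by blast
  then have "F i *v w \<noteq> 0" by (simp add: F_level)
  then show "i \<in> support_levels smul h N W" using support_iff \<open>i \<le> N\<close> \<open>w \<in> W\<close> by blast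
qed

text \<open>On the lowest level of \<open>W\<close>, \<open>L\<close> is zero because the level
  beneath is not in the support. The product \<open>L ** R\<close> preserves that level and so has
  an eigenvector there.\<close>

lemma endpoint_vector:
  assumes "W \<noteq> {0}"
  obtains w0 e where "w0 \<in> W" "w0 \<in> level_vecs (endpoint smul h N W)" "w0 \<noteq> 0"
    "L *v w0 = 0" "L *v (R *v w0) = e *s w0"
proof -
  let ?r = "endpoint smul h N W"
  let ?S = "support_levels smul h N W"
  obtain w where w: "w \<in> W" "w \<noteq> 0" using assms vec.subspace_0[OF module_subspace] by blast
  have "\<exists>i\<le>N. F i *v w \<noteq> 0"
  proof (rule ccontr)
    assume "\<not> (\<exists>i\<le>N. F i *v w \<noteq> 0)"
    then have "(\<Sum>i=0..N. F i *v w) = 0" by (intro sum.neutral) auto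
    then show False using level_decompose[of w] module_on w by auto
  qed
  then have ne: "?S \<noteq> {}" using support_iff w by blast
  have fin: "finite ?S" by (simp add: support_levels_def)
  have r: "?r \<in> ?S" using Min_in[OF fin ne] by (simp add: endpoint_def)
  have least: "?r \<le> i" if "i \<in> ?S" for i using Min_le[OF fin that] by (simp add: endpoint_def)
  define E where "E = W \<inter> level_vecs ?r"
  have E0: "L *v w = 0" if w: "w \<in> E" for w
  proof (cases ?r)
    case 0
    then show ?thesis using w L_level_0 by (simp add: E_def)
  next
    case (Suc j)
    then have Lw: "L *v w \<in> W \<inter> level_vecs j" using w L_level module_closed by (simp add: E_def)
    have "j \<le> N" using r Suc by (simp add: support_levels_def)
    moreover have "j \<notin> ?S" using least[of j] Suc by auto
    ultimately show ?thesis using support_iff_level Lw by blast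
  qed
  have "vec.subspace E" unfolding E_def
    by (intro vec.subspace_inter module_subspace subspace_level_vecs)
  moreover have "E \<noteq> {0}" using r unfolding E_def support_iff_level by blast
  moreover have "(L ** R) *v w \<in> E" if "w \<in> E" for w
    using that R_level L_level module_closed by (simp add: E_def matrix_vector_mul_assoc[symmetric])
  ultimately obtain w0 e where "w0 \<in> E" "w0 \<noteq> 0" "(L ** R) *v w0 = e *s w0"
    using ex_eigenvector by blast
  then show thesis using that[of w0 e] E0 by (simp add: E_def matrix_vector_mul_assoc)
qed

end

end

text \<open>
  The recursion is the cubic relation applied to the vectors \<open>w k\<close> with \<open>R (w k) = w (Suc k)\<close>, where
  \<open>L (w k) = lower_coeff q \<kappa> e k *s w (k - 1)\<close>.
\<close>

fun lower_coeff :: "complex \<Rightarrow> complex \<Rightarrow> complex \<Rightarrow> nat \<Rightarrow> complex" where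
  "lower_coeff q \<kappa> e 0 = 0"
| "lower_coeff q \<kappa> e (Suc 0) = e"
| "lower_coeff q \<kappa> e (Suc (Suc k)) =
     (q + 1) * lower_coeff q \<kappa> e (Suc k) - q * lower_coeff q \<kappa> e k - (q + 1) * \<kappa> / (q * q ^ k)"

text \<open>The right side solves the same inhomogeneous recursion and vanishes at 0 and at
  \<open>Suc d\<close>. The difference \<open>z\<close> solves the homogeneous one, with
  characteristic roots 1 and \<open>q\<close>; as \<open>z 0 = 0\<close>, it is a multiple of
  \<open>q ^ k - 1\<close>, and its zero at \<open>Suc d\<close> makes it vanish.\<close>

lemma lower_coeff_closed:
  assumes q0: "q \<noteq> 0" and q1: "\<And>k. k \<ge> 1 \<Longrightarrow> q ^ k \<noteq> 1" and zero: "lower_coeff q \<kappa> e (Suc d) = 0"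
  shows "lower_coeff q \<kappa> e k = \<kappa> / (q ^ d * (q - 1)^2) * ((q ^ k - 1) * (q * q ^ d / q ^ k - 1))"
proof -
  define X where "X k = \<kappa> / (q ^ d * (q - 1)^2) * ((q ^ k - 1) * (q * q ^ d / q ^ k - 1))" for k
  define z where "z k = lower_coeff q \<kappa> e k - X k" for k
  have qm: "q - 1 \<noteq> 0" using q1[of 1] by simp
  have X: "X (Suc (Suc k)) = (q + 1) * X (Suc k) - q * X k - (q + 1) * \<kappa> / (q * q ^ k)" for k
  proof -
    define Q D where "Q = q ^ k" and "D = q ^ d"
    have "Q \<noteq> 0" "D \<noteq> 0" using q0 by (simp_all add: Q_def D_def)
    then show ?thesis unfolding X_def power_Suc Q_def[symmetric] D_def[symmetric] using q0 qm
      by (simp add: divide_simps power2_eq_square) algebra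
  qed
  have z: "z (Suc (Suc k)) = (q + 1) * z (Suc k) - q * z k" for k
    unfolding z_def X by (simp add: algebra_simps)
  have z0: "z 0 = 0" by (simp add: z_def X_def)
  have zk: "z k * (q - 1) = z 1 * (q ^ k - 1)" for k
  proof (induction k rule: induct_nat_012)
    case (ge2 n)
    have "z (Suc (Suc n)) * (q - 1) = (q + 1) * (z (Suc n) * (q - 1)) - q * (z n * (q - 1))"
      unfolding z by algebra
    also have "\<dots> = z 1 * (q ^ Suc (Suc n) - 1)"
      unfolding ge2 by (simp add: algebra_simps)
    finally show ?case .
  qed (simp_all add: z0)
  have "z (Suc d) = 0" using zero q0 by (simp add: z_def X_def)
  then have "z 1 = 0" using zk[of "Suc d"] q1[of "Suc d"] by simp
  then have "z k = 0" using zk[of k] qm by simp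
  then show ?thesis by (simp add: z_def X_def)
qed

section \<open>Irreducible modules as chains\<close>

context attenuated_space_dims
begin

text \<open>The vectors reached from an endpoint vector by \<open>R\<close> span a nonzero
  submodule, which is all of \<open>W\<close> by irreducibility. They lie on different levels, so
  the length of the chain is the diameter.\<close>

lemma irreducible_chain:
  assumes irr: "irreducible_T_module smul h N M W"
  defines "r \<equiv> endpoint smul h N W" and "d \<equiv> module_diameter smul h N W"
  obtains w :: "nat \<Rightarrow> complex^('b set)" and e :: complex where
    "\<And>k. w k \<in> level_vecs (r + k)" "\<And>k. w k \<in> W" "\<And>k. R *v w k = w (Suc k)"
    "\<And>k. L *v w k = lower_coeff (of_nat q) (of_nat q ^ (N + M) / of_nat q ^ r) e k *s w (k - 1)"
    "\<And>k. k \<le> d \<Longrightarrow> w k \<noteq> 0" "w (Suc d) = 0" "r + d \<le> N" "W = vec.span (w ` {..d})"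
    "lower_coeff (of_nat q) (of_nat q ^ (N + M) / of_nat q ^ r) e (Suc d) = 0"
proof -
  define qq \<kappa> :: complex where "qq = of_nat q" and "\<kappa> = qq ^ (N + M) / qq ^ r"
  have W: "T_module smul h N M W" "W \<noteq> {0}" using irr by (auto simp: irreducible_T_module_def)
  have simple: "U = {0} \<or> U = W" if "T_module smul h N M U" "U \<subseteq> W" for U
    using irr that by (auto simp: irreducible_T_module_def)
  obtain w0 e where w0: "w0 \<in> W" "w0 \<in> level_vecs r" "w0 \<noteq> 0" "L *v w0 = 0"
      "L *v (R *v w0) = e *s w0"
    using endpoint_vector[OF W] unfolding r_def by blast
  define w where "w k = ((*v) R ^^ k) w0" for k
  have w_0: "w 0 = w0" by (simp add: w_def)
  have Rw: "R *v w k = w (Suc k)" for k by (simp add: w_def)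
  have wW: "w k \<in> W" for k
    by (induction k) (auto simp: w_0 w0 Rw[symmetric] module_closed[OF W(1)])
  have wl: "w k \<in> level_vecs (r + k)" for k
    by (induction k) (auto simp: w_0 w0 Rw[symmetric] R_level)
  let ?x = "lower_coeff qq \<kappa> e"
  have card_UNIV: "of_nat CARD('b) = qq ^ (N + M)"
    using card_subspace[of UNIV] dim_UNIV by (simp add: qq_def)
  \<comment> \<open>Two consecutive indices are carried through the induction because the recursion
    has order two.\<close>
  have Lw: "L *v w k = ?x k *s w (k - 1) \<and> L *v w (Suc k) = ?x (Suc k) *s w k" for k
  proof (induction k)
    case 0
    then show ?case using w0 Rw[of 0] by (simp add: w_0)
  next
    case (Suc k)
    have RL: "R *v (R *v (L *v w k)) = ?x k *s w (Suc k)"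
    proof (cases k)
      case 0
      then show ?thesis using w0 by (simp add: w_0)
    next
      case (Suc l)
      then have "L *v w k = ?x k *s w l" using Suc.IH by simp
      then show ?thesis using Suc by (simp add: vector_scalar_commute Rw)
    qed
    have kap: "of_nat CARD('b) / (qq * qq ^ (r + k)) = \<kappa> / (qq * qq ^ k)"
      unfolding card_UNIV \<kappa>_def by (simp add: power_add)
    have "L *v w (Suc (Suc k)) = (qq + 1) *s (?x (Suc k) *s w (Suc k)) - qq *s (?x k *s w (Suc k))
        - ((qq + 1) * (\<kappa> / (qq * qq ^ k))) *s w (Suc k)"
      using relation_level[OF wl[of k]] Suc.IH unfolding RL qq_def[symmetric] kap
      by (simp only: Rw vector_scalar_commute)
    also have "\<dots> = ?x (Suc (Suc k)) *s w (Suc k)"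
      by (simp add: vec_eq_iff algebra_simps)
    finally show ?case using Suc.IH by simp
  qed
  \<comment> \<open>The chain stops because there is nothing above level \<open>N\<close>.\<close>
  have "\<exists>k. w (Suc k) = 0"
    using level_vecs_high[OF _ wl[of "Suc N"]] by (intro exI[of _ N]) simp
  define D where "D = (LEAST k. w (Suc k) = 0)"
  have wD: "w (Suc D) = 0" unfolding D_def by (rule LeastI_ex) fact
  have w_nz: "w k \<noteq> 0" if "k \<le> D" for k
  proof (cases k)
    case 0
    then show ?thesis using w0 by (simp add: w_0)
  next
    case (Suc l)
    then show ?thesis using not_less_Least[of l "\<lambda>k. w (Suc k) = 0"] that by (auto simp: D_def)
  qed
  have rD: "r + k \<le> N" if "k \<le> D" for k
    using level_vecs_high[OF _ wl[of k]] w_nz[OF that] by (meson not_le)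
  define U where "U = vec.span (w ` {..D})"
  have spanI: "B *v v \<in> U" if "v \<in> U" and gen: "\<And>k. k \<le> D \<Longrightarrow> B *v w k \<in> U" for B v
  proof -
    have "vec.subspace {v. B *v v \<in> U}"
      unfolding U_def vec.subspace_def
      by (auto simp: matrix_vector_right_distrib vector_scalar_commute intro: vec.span_add vec.span_scale vec.span_zero)
    then have "vec.span (w ` {..D}) \<subseteq> {v. B *v v \<in> U}"
      using gen by (intro vec.span_minimal) auto
    then show ?thesis using that(1) by (auto simp: U_def)
  qed
  have wU: "w k \<in> U" if "k \<le> D" for k using that by (auto simp: U_def intro: vec.span_base)
  have U0: "0 \<in> U" by (simp add: U_def vec.span_zero)
  have UW: "U \<subseteq> W" unfolding U_def
    by (rule vec.span_minimal[OF _ module_subspace[OF W(1)]]) (use wW in auto)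
  have "T_module smul h N M U"
  proof (rule T_moduleI)
    show "U \<subseteq> vecs_on P" using UW module_on[OF W(1)] by blast
    show "vec.subspace U" by (simp add: U_def vec.subspace_span)
    show "R *v v \<in> U" if "v \<in> U" for v
    proof (rule spanI[OF that])
      fix k assume "k \<le> D"
      then show "R *v w k \<in> U" unfolding Rw using wU[of "Suc k"] wD U0 by (cases "k = D") auto
    qed
    show "L *v v \<in> U" if "v \<in> U" for v
    proof (rule spanI[OF that])
      fix k assume "k \<le> D"
      then have "w (k - 1) \<in> U" by (intro wU) simp
      then show "L *v w k \<in> U" using Lw[of k] by (simp add: U_def vec.span_scale)
    qed
    show "level_mat c *v v \<in> U" if "v \<in> U" for c v
    proof (rule spanI[OF that])
      fix k assume k: "k \<le> D"
      then show "level_mat c *v w k \<in> U"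
        unfolding level_mat_level[OF wl rD[OF k]] using wU[OF k] by (simp add: U_def vec.span_scale)
    qed
  qed
  then have WU: "W = U" using simple[OF _ UW] wU[of 0] w_nz[of 0] by auto
  have supp: "support_levels smul h N W = {r..r + D}"
  proof (intro set_eqI iffI)
    fix i assume i: "i \<in> {r..r + D}"
    then have "i - r \<le> D" "r + (i - r) = i" by auto
    then have "w (i - r) \<in> W \<inter> level_vecs i" "w (i - r) \<noteq> 0"
      using wW wl[of "i - r"] w_nz[of "i - r"] by auto
    then show "i \<in> support_levels smul h N W" using i rD[of D] unfolding support_iff_level[OF W(1)] by auto
  next
    fix i assume i: "i \<in> support_levels smul h N W"
    show "i \<in> {r..r + D}"
    proof (rule ccontr)
      assume out: "i \<notin> {r..r + D}"
      have "F i *v v = 0" if "v \<in> W" for v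
      proof -
        have "vec.subspace {v. F i *v v = 0}"
          unfolding vec.subspace_def by (auto simp: matrix_vector_right_distrib vector_scalar_commute)
        moreover have "w ` {..D} \<subseteq> {v. F i *v v = 0}" using out F_level[OF wl] by auto
        ultimately have "U \<subseteq> {v. F i *v v = 0}" unfolding U_def by (rule vec.span_minimal[rotated])
        then show ?thesis using that WU by auto
      qed
      then show False using i support_iff[OF W(1)] by blast
    qed
  qed
  have dD: "d = D" unfolding d_def module_diameter_def supp by simp
  have "?x (Suc D) *s w D = 0" using Lw[of D] wD by simp
  then have x0: "?x (Suc D) = 0" using w_nz[of D] by (auto simp: vec_eq_iff)
  show thesis
  proof (rule that[of w e])
    show "w k \<in> level_vecs (r + k)" for k by (rule wl)
    show "w k \<in> W" for k by (rule wW)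
    show "R *v w k = w (Suc k)" for k by (rule Rw)
    show "L *v w k = lower_coeff (of_nat q) (of_nat q ^ (N + M) / of_nat q ^ r) e k *s w (k - 1)" for k
      using Lw[of k] by (simp add: \<kappa>_def qq_def)
    show "w k \<noteq> 0" if "k \<le> d" for k using w_nz that dD by simp
    show "w (Suc d) = 0" using wD dD by simp
    show "r + d \<le> N" using rD[of D] dD by simp
    show "W = vec.span (w ` {..d})" using WU dD by (simp add: U_def)
    show "lower_coeff (of_nat q) (of_nat q ^ (N + M) / of_nat q ^ r) e (Suc d) = 0"
      using x0 dD by (simp add: \<kappa>_def qq_def)
  qed
qed

section \<open>A and A* on an irreducible module\<close>

lemma A_mat_level:
  assumes v: "v \<in> level_vecs j" and j: "j \<le> N"
  shows "A_mat smul h N \<alpha> \<theta> *v v = (if j < N then \<alpha> j *s (R *v v) else 0) + \<theta> j *s v"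
proof -
  have "(\<Sum>i<N. \<alpha> i *m (R ** F i)) *v v = (\<Sum>i<N. \<alpha> i *s (R *v (F i *v v)))"
    by (simp add: mat_sum_vec mat_scale_vec matrix_vector_mul_assoc)
  also have "\<dots> = (if j < N then \<alpha> j *s (R *v v) else 0)"
  proof (cases "j < N")
    case True
    then show ?thesis by (subst sum_single_vec[of _ j]) (auto simp: F_level[OF v])
  next
    case False
    then show ?thesis by (auto simp: F_level[OF v] intro!: sum.neutral)
  qed
  finally show ?thesis
    using level_mat_level[OF v j, of \<theta>]
    by (simp add: A_mat_def matrix_vector_mult_add_rdistrib level_mat_def)
qed

lemma A_star_mat_level:
  assumes v: "v \<in> level_vecs j" and j: "j \<le> N"
  shows "A_star_mat smul h N \<alpha>' \<theta>' *v v = \<alpha>' j *s (L *v v) + \<theta>' j *s v"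
proof -
  have "(\<Sum>i=1..N. \<alpha>' i *m (L ** F i)) *v v = (\<Sum>i=1..N. \<alpha>' i *s (L *v (F i *v v)))"
    by (simp add: mat_sum_vec mat_scale_vec matrix_vector_mul_assoc)
  also have "\<dots> = \<alpha>' j *s (L *v v)"
  proof (cases "j = 0")
    case True
    then show ?thesis using L_level_0 v by (auto simp: F_level[OF v] intro!: sum.neutral)
  next
    case False
    then show ?thesis using j by (subst sum_single_vec[of _ j]) (auto simp: F_level[OF v])
  qed
  finally show ?thesis
    using level_mat_level[OF v j, of \<theta>']
    by (simp add: A_star_mat_def matrix_vector_mult_add_rdistrib level_mat_def)
qed

lemma leonard_pair_on_module:
  fixes W :: "(complex^('b set)) set"
  assumes irr: "irreducible_T_module smul h N M W"
    and \<alpha>: "\<And>i. i < N \<Longrightarrow> \<alpha> i \<noteq> 0" and \<alpha>': "\<And>i. 1 \<le> i \<Longrightarrow> i \<le> N \<Longrightarrow> \<alpha>' i \<noteq> 0"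
    and dist: "\<And>i j. i \<le> N \<Longrightarrow> j \<le> N \<Longrightarrow> i \<noteq> j \<Longrightarrow> \<theta> i \<noteq> \<theta> j"
    and dist': "\<And>i j. i \<le> N \<Longrightarrow> j \<le> N \<Longrightarrow> i \<noteq> j \<Longrightarrow> \<theta>' i \<noteq> \<theta>' j"
  defines "Q \<equiv> (of_nat q :: complex)"
  assumes \<theta>: "\<And>i. i \<le> N \<Longrightarrow> \<theta> i = a + b * Q ^ i + c / Q ^ i"
    and \<theta>': "\<And>i. i \<le> N \<Longrightarrow> \<theta>' i = a' + b' * Q ^ i + c' / Q ^ i"
    and \<xi>: "\<And>i. i < N \<Longrightarrow> \<alpha> i * \<alpha>' (i + 1) = x - (Q - 1)^2 * c * c' / (Q ^ (N + M) * Q * Q ^ i)"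
    and bb: "b * b' = 0"
  defines "r \<equiv> endpoint smul h N W" and "d \<equiv> module_diameter smul h N W"
  shows "leonard_pair W ((*v) (A_mat smul h N \<alpha> \<theta>)) ((*v) (A_star_mat smul h N \<alpha>' \<theta>')) \<longleftrightarrow>
    (\<forall>i\<in>{1..d}. x \<noteq> Q ^ r * Q ^ d / Q ^ (N + M) * (Q - 1)^2 * (b * c' + c * b') / Q ^ i)"
proof -
  let ?A = "A_mat smul h N \<alpha> \<theta>" and ?A' = "A_star_mat smul h N \<alpha>' \<theta>'"
  define \<kappa> where "\<kappa> = Q ^ (N + M) / Q ^ r"
  \<comment> \<open>The scaling turns \<open>\<xi>\<close> times the lowering coefficients into
    \<open>split_seq\<close>: it is \<open>x\<close> times the constant in front of the closed form
    of these coefficients.\<close>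
  define \<tau> where "\<tau> = x * \<kappa> / (Q ^ d * (Q - 1)^2)"
  obtain w e where wl: "\<And>k. w k \<in> level_vecs (r + k)" and wW: "\<And>k. w k \<in> W"
    and Rw: "\<And>k. R *v w k = w (Suc k)"
    and Lw: "\<And>k. L *v w k = lower_coeff Q \<kappa> e k *s w (k - 1)"
    and w_nz: "\<And>k. k \<le> d \<Longrightarrow> w k \<noteq> 0" and w_end: "w (Suc d) = 0" and rd: "r + d \<le> N"
    and span: "W = vec.span (w ` {..d})" and x_end: "lower_coeff Q \<kappa> e (Suc d) = 0"
    using irreducible_chain[OF irr] unfolding r_def d_def Q_def \<kappa>_def by blast
  have Q0: "Q \<noteq> 0" using q_ge_2 by (simp add: Q_def)
  have Q1: "Q ^ k \<noteq> 1" if "k \<ge> 1" for k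
  proof -
    have "q ^ k > 1" using q_ge_2 that by (intro one_less_power) auto
    then have "of_nat (q ^ k) \<noteq> (of_nat 1 :: complex)" unfolding of_nat_eq_iff by (rule less_imp_neq[THEN not_sym])
    then show ?thesis by (simp only: Q_def of_nat_power of_nat_1 not_False_eq_True)
  qed
  have Qm: "Q - 1 \<noteq> 0" using Q1[of 1] by simp
  have \<kappa>0: "\<kappa> \<noteq> 0" using Q0 by (simp add: \<kappa>_def)
  have xs: "lower_coeff Q \<kappa> e k = \<kappa> / (Q ^ d * (Q - 1)^2) * ((Q ^ k - 1) * (Q * Q ^ d / Q ^ k - 1))" for k
    by (rule lower_coeff_closed[OF Q0 Q1 x_end])
  \<comment> \<open>The shift of indices from the chain to the levels, which start at
    \<open>r\<close>, is absorbed into the coefficients.\<close>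
  define b1 c1 b2 c2 where "b1 = b * Q ^ r" and "c1 = c / Q ^ r" and "b2 = b' * Q ^ r" and "c2 = c' / Q ^ r"
  have th: "theta_seq Q a b1 c1 k = \<theta> (r + k)" if "k \<le> d" for k
    using that rd \<theta>[of "r + k"] by (simp add: theta_seq_def b1_def c1_def power_add mult_ac)
  have th': "theta_seq Q a' b2 c2 k = \<theta>' (r + k)" if "k \<le> d" for k
    using that rd \<theta>'[of "r + k"] by (simp add: theta_seq_def b2_def c2_def power_add mult_ac)
  have bb1: "b1 * b2 = 0" using bb by (auto simp: b1_def b2_def)
  have ph: "split_seq Q \<tau> (b1 * b2) (c1 * c2) d (Suc k)
      = \<alpha> (r + k) * \<alpha>' (r + Suc k) * lower_coeff Q \<kappa> e (Suc k)" if "Suc k \<le> d" for k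
  proof -
    have "\<alpha> (r + k) * \<alpha>' (r + Suc k) = x - (Q - 1)^2 * c * c' / (Q ^ (N + M) * Q * Q ^ (r + k))"
      using \<xi>[of "r + k"] that rd by simp
    also have "\<dots> = (\<tau> - c1 * c2 / (Q ^ Suc k * Q ^ d)) * (Q ^ d * (Q - 1)^2 / \<kappa>)"
      using Q0 Qm by (simp add: \<tau>_def \<kappa>_def c1_def c2_def power_add field_simps)
    finally show ?thesis unfolding xs split_seq_def bb1 using Q0 Qm \<kappa>0 by simp
  qed
  have ph_nz: "split_seq Q \<tau> (b1 * b2) (c1 * c2) d k \<noteq> 0" if k: "1 \<le> k" "k \<le> d" for k
  proof -
    obtain l where l: "k = Suc l" using k by (cases k) auto
    have "Q ^ Suc d = Q ^ (Suc d - k) * Q ^ k" using k by (simp add: power_add[symmetric])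
    then have "Q * Q ^ d / Q ^ k = Q ^ (Suc d - k)" using Q0 by simp
    then have "lower_coeff Q \<kappa> e k \<noteq> 0"
      unfolding xs using Q0 Qm \<kappa>0 Q1[of k] Q1[of "Suc d - k"] k by simp
    then show ?thesis using ph[of l] \<alpha>[of "r + l"] \<alpha>'[of "r + Suc l"] k l rd by auto
  qed
  \<comment> \<open>With this scaling, \<open>A\<close> sends each \<open>u k\<close> to
    \<open>u (Suc k)\<close> with coefficient 1.\<close>
  define s where "s k = (\<Prod>l<k. \<alpha> (r + l))" for k
  have s_nz: "s k \<noteq> 0" if "k \<le> d" for k using that rd \<alpha> by (auto simp: s_def)
  define u where "u k = s k *s w k" for k
  have u_nz: "u k \<noteq> 0" if "k \<le> d" for k using s_nz w_nz that by (simp add: u_def)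
  have ul: "u k \<in> level_vecs (r + k)" for k
    unfolding u_def by (intro vec.subspace_scale[OF subspace_level_vecs] wl)
  \<comment> \<open>The \<open>u k\<close> live on different levels, so one entry where
    \<open>u k\<close> is nonzero already gives its coordinate functional on
    \<open>W\<close>.\<close>
  define y where "y k = (SOME y. u k $ y \<noteq> 0)" for k
  have y: "u k $ y k \<noteq> 0" if "k \<le> d" for k
    unfolding y_def by (rule someI_ex) (use u_nz[OF that] in \<open>simp add: vec_eq_iff\<close>)
  have y0: "u l $ y k = 0" if "k \<le> d" "l \<noteq> k" for k l
  proof (rule ccontr)
    assume "u l $ y k \<noteq> 0"
    then have "r + l = r + k"
      using ul[of l] ul[of k] y[OF that(1)] level_unique[of "y k" "r + l" "r + k"]
      by (auto simp: level_vecs_def)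
    then show False using that by simp
  qed
  define g where "g k v = v $ y k / u k $ y k" for k v
  have g_fun: "functional (g k)" for k by (simp add: functional_def g_def add_divide_distrib)
  have g_u: "g k (u l) = of_bool (k = l)" if "k \<le> d" for k l
    using y[OF that] y0[OF that, of l] by (cases "k = l") (auto simp: g_def)
  have sub: "vec.subspace W" by (simp add: span vec.subspace_span)
  have g_expand: "v = (\<Sum>k\<le>d. g k v *s u k)" if "v \<in> W" for v
  proof -
    have "vec.subspace {v. v = (\<Sum>k\<le>d. g k v *s u k)}"
    proof (unfold vec.subspace_def, intro conjI ballI allI)
      show "0 \<in> {v. v = (\<Sum>k\<le>d. g k v *s u k)}" by (simp add: g_def)
    next
      fix v v' assume "v \<in> {v. v = (\<Sum>k\<le>d. g k v *s u k)}" "v' \<in> {v. v = (\<Sum>k\<le>d. g k v *s u k)}"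
      then have "v + v' = (\<Sum>k\<le>d. g k v *s u k) + (\<Sum>k\<le>d. g k v' *s u k)" by simp
      also have "\<dots> = (\<Sum>k\<le>d. g k (v + v') *s u k)"
        by (simp add: functional_add[OF g_fun] sum.distrib vec_eq_iff algebra_simps)
      finally show "v + v' \<in> {v. v = (\<Sum>k\<le>d. g k v *s u k)}" by simp
    next
      fix f v assume "v \<in> {v. v = (\<Sum>k\<le>d. g k v *s u k)}"
      then have "f *s v = f *s (\<Sum>k\<le>d. g k v *s u k)" by simp
      also have "\<dots> = (\<Sum>k\<le>d. g k (f *s v) *s u k)"
        by (simp add: functional_scale[OF g_fun] vec_eq_iff sum_distrib_left mult.assoc)
      finally show "f *s v \<in> {v. v = (\<Sum>k\<le>d. g k v *s u k)}" by simp
    qed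
    moreover have "w l \<in> {v. v = (\<Sum>k\<le>d. g k v *s u k)}" if l: "l \<le> d" for l
    proof -
      have wu: "w l = inverse (s l) *s u l" using s_nz[OF l] by (simp add: u_def vector_smult_assoc)
      have "(\<Sum>k\<le>d. g k (w l) *s u k) = g l (w l) *s u l"
        using l g_u by (intro sum_single_vec) (auto simp: wu functional_scale[OF g_fun])
      also have "\<dots> = w l" using g_u[OF l, of l] by (simp add: wu functional_scale[OF g_fun])
      finally show ?thesis by simp
    qed
    ultimately have "W \<subseteq> {v. v = (\<Sum>k\<le>d. g k v *s u k)}"
      unfolding span by (intro vec.span_minimal) auto
    then show ?thesis using that by blast
  qed
  have split: "split_pair Q a b1 c1 a' b2 c2 \<tau> d W u g ?A ?A'"
  proof (unfold_locales, goal_cases)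
    case 1
    then show ?case by (rule Q0)
  next
    case (2 k)
    then show ?case by (rule Q1)
  next
    case (3 i j)
    then show ?case using th dist[of "r + i" "r + j"] rd by simp
  next
    case (4 i j)
    then show ?case using th' dist'[of "r + i" "r + j"] rd by simp
  next
    case (5 i)
    then show ?case by (rule ph_nz)
  next
    case 6
    then show ?case by (rule sub)
  next
    case (7 k)
    then show ?case unfolding u_def by (intro vec.subspace_scale[OF sub] wW)
  next
    case 8
    then show ?case by (simp add: u_def w_end)
  next
    case (9 k)
    then show ?case by (rule g_fun)
  next
    case (10 k l)
    then show ?case using g_u by simp
  next
    case (11 v)
    then show ?case by (rule g_expand)
  next
    case (12 k)
    have R: "(if r + k < N then \<alpha> (r + k) *s (R *v u k) else 0) = u (Suc k)"
    proof (cases "k = d")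
      case True
      have "R *v u k = 0" by (simp add: u_def vector_scalar_commute Rw True w_end)
      then show ?thesis by (simp add: u_def True w_end)
    next
      case False
      then have "r + k < N" using 12 rd by simp
      then show ?thesis by (simp add: u_def vector_scalar_commute Rw s_def vector_smult_assoc mult.commute)
    qed
    have "r + k \<le> N" using 12 rd by simp
    from A_mat_level[OF ul this, of \<alpha> \<theta>] show ?case
      unfolding R th[OF 12] by (simp add: add.commute)
  next
    case (13 k)
    have L: "\<alpha>' (r + k) *s (L *v u k) = split_seq Q \<tau> (b1 * b2) (c1 * c2) d k *s u (k - 1)"
    proof (cases k)
      case 0
      then show ?thesis by (simp add: u_def vector_scalar_commute Lw split_seq_def)
    next
      case (Suc l)
      have "\<alpha>' (r + k) *s (L *v u k) = (\<alpha>' (r + k) * (s k * lower_coeff Q \<kappa> e k)) *s w l"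
        by (simp add: u_def vector_scalar_commute Lw Suc vector_smult_assoc)
      also have "\<dots> = (\<alpha> (r + l) * \<alpha>' (r + Suc l) * lower_coeff Q \<kappa> e (Suc l)) *s u l"
        by (simp add: Suc u_def vector_smult_assoc s_def mult_ac)
      finally show ?thesis using ph[of l] 13 Suc by simp
    qed
    have "r + k \<le> N" using 13 rd by simp
    from A_star_mat_level[OF ul this, of \<alpha>' \<theta>'] show ?case
      unfolding L th'[OF 13] by (simp add: add.commute)
  qed
  have bc: "b1 * c2 = b * c'" "c1 * b2 = c * b'" using Q0 by (simp_all add: b1_def c1_def b2_def c2_def)
  have cond: "x = Q ^ r * Q ^ d / Q ^ (N + M) * (Q - 1)^2 * (b * c' + c * b') / Q ^ i
      \<longleftrightarrow> \<tau> = (b * c' + c * b') / Q ^ i" for i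
    using Q0 Qm by (simp add: \<tau>_def \<kappa>_def power_add field_simps)
  have "leonard_pair W ((*v) ?A) ((*v) ?A') \<longleftrightarrow>
    (\<forall>i<d. \<tau> \<noteq> b * c' * Q ^ i / Q ^ d + c * b' / (Q * Q ^ i))"
    using split_pair.leonard_pair_iff[OF split] by (simp only: bc)
  \<comment> \<open>As \<open>b * b' = 0\<close>, one of the two summands is zero. If
    \<open>b = 0\<close>, the ranges match under \<open>i\<close> to \<open>Suc i\<close>; if
    \<open>b' = 0\<close>, under \<open>i\<close> to \<open>d - i\<close>.\<close>
  also have "\<dots> \<longleftrightarrow> (\<forall>i\<in>{1..d}. \<tau> \<noteq> (b * c' + c * b') / Q ^ i)"
  proof (cases "b = 0")
    case True
    have "(\<forall>i<d. \<tau> \<noteq> c * b' / (Q * Q ^ i)) \<longleftrightarrow> (\<forall>i\<in>Suc ` {..<d}. \<tau> \<noteq> c * b' / Q ^ i)"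
      unfolding ball_simps by (auto simp: Ball_def)
    then show ?thesis by (simp add: True image_Suc_lessThan)
  next
    case False
    then have b': "b' = 0" using bb by simp
    have flip: "Q ^ i / Q ^ d = 1 / Q ^ (d - i)" if "i \<le> d" for i
      using Q0 that by (simp add: power_diff)
    have "(\<forall>i<d. \<tau> \<noteq> b * c' * (Q ^ i / Q ^ d)) \<longleftrightarrow> (\<forall>i\<in>{1..d}. \<tau> \<noteq> b * c' / Q ^ i)"
    proof (intro iffI ballI allI impI)
      fix i assume *: "\<forall>i<d. \<tau> \<noteq> b * c' * (Q ^ i / Q ^ d)" "i \<in> {1..d}"
      then have "\<tau> \<noteq> b * c' * (Q ^ (d - i) / Q ^ d)" by simp
      then show "\<tau> \<noteq> b * c' / Q ^ i" unfolding flip[of "d - i", OF diff_le_self] using *(2) by simp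
    next
      fix i assume *: "\<forall>i\<in>{1..d}. \<tau> \<noteq> b * c' / Q ^ i" "i < d"
      then have "\<tau> \<noteq> b * c' / Q ^ (d - i)" by simp
      then show "\<tau> \<noteq> b * c' * (Q ^ i / Q ^ d)" using flip[of i] *(2) by simp
    qed
    then show ?thesis by (simp add: b')
  qed
  finally show ?thesis by (simp only: cond)
qed

end

section \<open>The eight cases in a common form\<close>

theorem theorem12p1:
  fixes smul :: "'k::{field,finite} \<Rightarrow> 'v::{ab_group_add,finite} \<Rightarrow> 'v"
    and h :: "'v set" and N M r d :: nat and q :: complex
    and \<alpha> \<alpha>' \<theta> \<theta>' \<xi> :: "nat \<Rightarrow> complex"
    and a b c a' b' c' x :: complex
    and W :: "(complex^('v set)) set"
  assumes "N \<ge> 6" and "M \<ge> 1" and "q = of_nat CARD('k)"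
    and "vector_space smul" and "vector_space.dim smul (UNIV :: 'v set) = N + M"
    and "module.subspace smul h" and "vector_space.dim smul h = M"
    and "\<forall>i<N. \<alpha> i \<noteq> 0" and "\<forall>i\<in>{1..N}. \<alpha>' i \<noteq> 0"
    and "\<forall>i\<le>N. \<forall>j\<le>N. i \<noteq> j \<longrightarrow> \<theta> i \<noteq> \<theta> j \<and> \<theta>' i \<noteq> \<theta>' j"
    and "\<forall>i<N. \<xi> i = \<alpha> i * \<alpha>' (i + 1)"
    and "eight_cases q N M \<xi> \<theta> \<theta>' a b c a' b' c' x"
    and "irreducible_T_module smul h N M W"
    and "r = endpoint smul h N W" and "d = module_diameter smul h N W"
  shows "leonard_pair W ((*v) (A_mat smul h N \<alpha> \<theta>)) ((*v) (A_star_mat smul h N \<alpha>' \<theta>')) \<longleftrightarrow>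
    (\<forall>i\<in>{1..d}. x \<noteq> q powi (int r + int d - int N - int M) * (q - 1)^2 * (b * c' + c * b') * q powi (- int i))"
proof -
  interpret attenuated_space_dims smul h N M
    unfolding attenuated_space_dims_def attenuated_space_def
      attenuated_space_axioms_def attenuated_space_dims_axioms_def
    using assms(4-7) by simp
  have Q: "of_nat (attenuated_space.q TYPE('k)) = q"
    using assms(3) by (simp add: q_def)
  have q0: "q \<noteq> 0" using assms(3) by simp
  have neg: "z * q powi (- int i) = z / q ^ i" for z i
    by (simp add: power_int_minus divide_inverse)
  have top: "q powi (-1 - int N - int M - int i) = 1 / (q ^ (N + M) * q * q ^ i)" for i
  proof -
    have e: "-1 - int N - int M - int i = - int (Suc (N + M + i))" by simp
    show ?thesis unfolding e power_int_minus power_int_of_nat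
      by (simp add: power_add divide_inverse mult_ac)
  qed
  have bot: "q powi (int r + int d - int N - int M) = q ^ r * q ^ d / q ^ (N + M)"
  proof -
    have "int r + int d - int N - int M = int (r + d) - int (N + M)" by simp
    then show ?thesis using power_int_diff[OF disjI1[OF q0], of "int (r + d)" "int (N + M)"]
      by (simp only: power_int_of_nat power_add)
  qed
  \<comment> \<open>In the common form \<open>b\<close> belongs to \<open>q ^ i\<close> and
    \<open>c\<close> to the inverse power. The letters are generalised because the cases II use them
    the other way round.\<close>
  have core: "leonard_pair W ((*v) (A_mat smul h N \<alpha> \<theta>)) ((*v) (A_star_mat smul h N \<alpha>' \<theta>')) \<longleftrightarrow>
      (\<forall>i\<in>{1..d}. x \<noteq> q ^ r * q ^ d / q ^ (N + M) * (q - 1)^2 * (b * c' + c * b') / q ^ i)"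
    if "b * b' = 0" "\<And>i. i \<le> N \<Longrightarrow> \<theta> i = a + b * q ^ i + c / q ^ i"
      "\<And>i. i \<le> N \<Longrightarrow> \<theta>' i = a' + b' * q ^ i + c' / q ^ i"
      "\<And>i. i < N \<Longrightarrow> \<xi> i = x - (q - 1)^2 * c * c' / (q ^ (N + M) * q * q ^ i)"
    for b c b' c'
    unfolding assms(14,15) Q[symmetric]
    by (rule leonard_pair_on_module) (use assms(8-11,13) that in \<open>auto simp: Q\<close>)
  have "leonard_pair W ((*v) (A_mat smul h N \<alpha> \<theta>)) ((*v) (A_star_mat smul h N \<alpha>' \<theta>')) \<longleftrightarrow>
      (\<forall>i\<in>{1..d}. x \<noteq> q ^ r * q ^ d / q ^ (N + M) * (q - 1)^2 * (b * c' + c * b') / q ^ i)"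
    using assms(12) unfolding eight_cases_def neg top
  proof (elim disjE conjE, goal_cases)
    case 1
    then show ?case by (intro core) (auto simp: mult_ac)
  next
    case 2
    then show ?case by (intro core) (auto simp: mult_ac)
  next
    case 3
    then show ?case by (intro core) (auto simp: mult_ac)
  next
    case 4
    \<comment> \<open>Here \<open>c * c' = 0\<close>. Interchanging the letters leaves
      \<open>b * c' + c * b'\<close> unchanged.\<close>
    then show ?case using core[of c c' b b'] by (simp add: mult_ac add_ac)
  next
    case 5
    then show ?case using core[of c c' b b'] by (simp add: mult_ac add_ac)
  next
    case 6
    then show ?case using core[of c c' b b'] by (simp add: mult_ac add_ac)
  next
    case 7
    then show ?case by (intro core) auto
  next
    case 8
    then show ?case by (intro core) auto
  qed
  then show ?thesis unfolding neg bot .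
qed

end
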